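(* Let $\mathfrak g$ be a simple Lie algebra, $\alpha\in\Pi$ a simple root and $1\le k\le d_\alpha$. Then the eigenvalue $\gamma_\alpha(k)$ of the Casimir element $\mathcal C_\alpha(0)$ on $\mathfrak g_\alpha(k)$ is $$\gamma_\alpha(k)=\frac{k}{2h^*r_\alpha}\sum_{i\ge 1}q_\alpha(ki).$$ In particular, $\gamma_\alpha(1)=\dfrac{q_\alpha}{2h^*r_\alpha}$.
   Context: The ground field $\Bbbk$ is algebraically closed of characteristic $0$. $\mathfrak g$ is a simple Lie algebra with Killing form $\Phi$, Cartan subalgebra $\mathfrak t$, root system $\Delta$, positive roots $\Delta^+$, simple roots $\Pi$, highest root $\theta$. $(\ ,\ )$ is the bilinear form on $\mathfrak t^*$ induced by $\Phi|_{\mathfrak t}$. $\varphi_\alpha$ is the fundamental weight corresponding to $\alpha\in\Pi$. $h^*$ is the dual Coxeter number of $\mathfrak g$ (so $(\theta,\theta)=1/h^*$), and $r_\alpha=(\theta,\theta)/(\alpha,\alpha)$. For $\gamma=\sum_{\beta\in\Pi}n_\beta\beta$ put $\mathsf{ht}_\alpha(\gamma)=n_\alpha$; $\Delta_\alpha(i)=\{\gamma\in\Delta\mid \mathsf{ht}_\alpha(\gamma)=i\}$; $d_\alpha=\mathsf{ht}_\alpha(\theta)$. The $(\mathbb Z,\alpha)$-grading is $\mathfrak g=\bigoplus_{i=-d_\alpha}^{d_\alpha}\mathfrak g_\alpha(i)$ with $\mathfrak g_\alpha(0)=\mathfrak t\oplus\bigoplus_{\gamma\in\Delta_\alpha(0)}\mathfrak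 g^\gamma$ and $\mathfrak g_\alpha(i)=\bigoplus_{\gamma\in\Delta_\alpha(i)}\mathfrak g^\gamma$ for $i\ne0$, where $\mathfrak g^\gamma$ is the root space. Each nonzero $\mathfrak g_\alpha(i)$, $i\neq 0$, is a simple $\mathfrak g_\alpha(0)$-module. $\mathcal C_\alpha(0)=\sum_j e_j'e_j\in\mathcal U(\mathfrak g_\alpha(0))$ is the Casimir element, where $\{e_j\},\{e'_j\}$ are bases of $\mathfrak g_\alpha(0)$ dual with respect to $\Phi|_{\mathfrak g_\alpha(0)}$; $\gamma_\alpha(i)$ is the scalar by which it acts on $\mathfrak g_\alpha(i)$. For a finite set $M\subset\mathfrak t^*$, $|M|$ denotes the sum of its elements. For $i\ge1$ the integer $q_\alpha(i)$ is defined by $|\Delta_\alpha(i)|=q_\alpha(i)\varphi_\alpha$ (so $q_\alpha(i)=0$ for $i>d_\alpha$), and $q_\alpha=\sum_{i\ge1}q_\alpha(i)$. *)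

theory Defs
  imports
    Complex_Main
    "HOL-Library.Function_Algebras"
    "HOL-Computational_Algebra.Polynomial"
begin

text \<open>Scalar-valued functions as a vector space; functionals on a subspace \<open>t\<close> of a Lie algebra are
  represented in it by functions that vanish outside \<open>t\<close>, so that equality of functionals is
  equality of functions.\<close>

definition scale_fun :: "'k::field \<Rightarrow> ('g \<Rightarrow> 'k) \<Rightarrow> 'g \<Rightarrow> 'k"
  where "scale_fun c f = (\<lambda>x. c * f x)"

interpretation functionals: vector_space scale_fun
  by unfold_locales (auto simp: scale_fun_def fun_eq_iff algebra_simps)

locale lie_algebra = finite_dimensional_vector_space scale Basis
  for scale :: "'k::field \<Rightarrow> 'g::ab_group_add \<Rightarrow> 'g" (infixr \<open>*s\<close> 75)
  and Basis :: "'g set" +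
  fixes br :: "'g \<Rightarrow> 'g \<Rightarrow> 'g"
  assumes br_add_left: "br (x + y) z = br x z + br y z"
    and br_add_right: "br x (y + z) = br x y + br x z"
    and br_scale_left: "br (c *s x) y = c *s br x y"
    and br_scale_right: "br x (c *s y) = c *s br x y"
    and br_self: "br x x = 0"
    and jacobi: "br x (br y z) + br y (br z x) + br z (br x y) = 0"
begin

definition lie_ideal :: "'g set \<Rightarrow> bool"
  where "lie_ideal I \<longleftrightarrow> subspace I \<and> (\<forall>x. \<forall>y\<in>I. br x y \<in> I)"

definition lie_subalgebra :: "'g set \<Rightarrow> bool"
  where "lie_subalgebra S \<longleftrightarrow> subspace S \<and> (\<forall>x\<in>S. \<forall>y\<in>S. br x y \<in> S)"

primrec lower_central :: "'g set \<Rightarrow> nat \<Rightarrow> 'g set"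
  where
    "lower_central S 0 = S"
  | "lower_central S (Suc n) = span {br x y | x y. x \<in> S \<and> y \<in> lower_central S n}"

definition cartan_subalgebra :: "'g set \<Rightarrow> bool"
  where "cartan_subalgebra t \<longleftrightarrow>
    lie_subalgebra t \<and> (\<exists>n. lower_central t n = {0}) \<and> {x. \<forall>y\<in>t. br x y \<in> t} = t"

definition trace :: "('g \<Rightarrow> 'g) \<Rightarrow> 'k"
  where "trace f = (\<Sum>b\<in>Basis. representation Basis (f b) b)"

definition killing :: "'g \<Rightarrow> 'g \<Rightarrow> 'k"
  where "killing x y = trace (\<lambda>z. br x (br y z))"

definition dual_bases :: "'g set \<Rightarrow> nat \<Rightarrow> (nat \<Rightarrow> 'g) \<Rightarrow> (nat \<Rightarrow> 'g) \<Rightarrow> bool"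
  where "dual_bases S n e e' \<longleftrightarrow>
    inj_on e {..<n} \<and> independent (e ` {..<n}) \<and> span (e ` {..<n}) = S \<and>
    inj_on e' {..<n} \<and> independent (e' ` {..<n}) \<and> span (e' ` {..<n}) = S \<and>
    (\<forall>i<n. \<forall>j<n. killing (e i) (e' j) = (if i = j then 1 else 0))"

text \<open>The action on the adjoint module, and hence on its \<open>S\<close>-submodules, of the Casimir element
  \<open>\<Sum>j. e' j * e j\<close> of the enveloping algebra of \<open>S\<close>, for \<open>dual_bases S n e e'\<close>.\<close>

definition casimir_action :: "nat \<Rightarrow> (nat \<Rightarrow> 'g) \<Rightarrow> (nat \<Rightarrow> 'g) \<Rightarrow> 'g \<Rightarrow> 'g"
  where "casimir_action n e e' x = (\<Sum>j<n. br (e' j) (br (e j) x))"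

end

locale simple_lie_algebra = lie_algebra +
  assumes nonabelian: "\<exists>x y. br x y \<noteq> 0"
    and simple: "lie_ideal I \<Longrightarrow> I = {0} \<or> I = UNIV"

locale simple_lie_with_cartan = simple_lie_algebra +
  fixes t :: "'b set"
  assumes cartan: "cartan_subalgebra t"
begin

definition cartan_dual :: "('b \<Rightarrow> 'a) set"
  where "cartan_dual = {f. (\<forall>x\<in>t. \<forall>y\<in>t. f (x + y) = f x + f y) \<and>
    (\<forall>c. \<forall>x\<in>t. f (c *s x) = c * f x) \<and> (\<forall>x. x \<notin> t \<longrightarrow> f x = 0)}"

definition root_space :: "('b \<Rightarrow> 'a) \<Rightarrow> 'b set"
  where "root_space \<gamma> = {x. \<forall>h\<in>t. br h x = \<gamma> h *s x}"

definition roots :: "('b \<Rightarrow> 'a) set"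
  where "roots = {\<gamma> \<in> cartan_dual. \<gamma> \<noteq> 0 \<and> root_space \<gamma> \<noteq> {0}}"

definition killing_dual_vector :: "('b \<Rightarrow> 'a) \<Rightarrow> 'b"
  where "killing_dual_vector f = (THE h. h \<in> t \<and> (\<forall>x\<in>t. killing h x = f x))"

definition dual_form :: "('b \<Rightarrow> 'a) \<Rightarrow> ('b \<Rightarrow> 'a) \<Rightarrow> 'a"
  where "dual_form f g = killing (killing_dual_vector f) (killing_dual_vector g)"

definition simple_system :: "('b \<Rightarrow> 'a) set \<Rightarrow> bool"
  where "simple_system simples \<longleftrightarrow>
    simples \<subseteq> roots \<and> functionals.independent simples \<and> functionals.span simples = cartan_dual \<and>
    (\<forall>\<gamma>\<in>roots. \<exists>m :: ('b \<Rightarrow> 'a) \<Rightarrow> int. \<gamma> = (\<Sum>\<beta>\<in>simples. scale_fun (of_int (m \<beta>)) \<beta>) \<and>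
      ((\<forall>\<beta>\<in>simples. m \<beta> \<ge> 0) \<or> (\<forall>\<beta>\<in>simples. m \<beta> \<le> 0)))"

end

locale simple_lie_with_base = simple_lie_with_cartan +
  fixes simples :: "('b \<Rightarrow> 'a) set"
  assumes simple_system: "simple_system simples"
begin

text \<open>The coordinates of a root in the basis \<open>simples\<close> lie in the image of the integers in the ground
  field; \<open>ht\<close> and \<open>q\<close> take the integers themselves, which are unique in characteristic 0.\<close>

definition ht :: "('b \<Rightarrow> 'a) \<Rightarrow> ('b \<Rightarrow> 'a) \<Rightarrow> int"
  where "ht \<alpha> \<gamma> = (THE m. of_int m = functionals.representation simples \<gamma> \<alpha>)"

definition positive_roots :: "('b \<Rightarrow> 'a) set"
  where "positive_roots = {\<gamma> \<in> roots. \<forall>\<beta>\<in>simples. ht \<beta> \<gamma> \<ge> 0}"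

definition highest_root :: "'b \<Rightarrow> 'a"
  where "highest_root = (THE \<theta>. \<theta> \<in> roots \<and> (\<forall>\<gamma>\<in>roots. \<forall>\<beta>\<in>simples. ht \<beta> \<gamma> \<le> ht \<beta> \<theta>))"

definition rho :: "'b \<Rightarrow> 'a"
  where "rho = scale_fun (1 / 2) (\<Sum>\<gamma>\<in>positive_roots. \<gamma>)"

text \<open>\<open>h* = 1 + (\<rho>, \<theta>\<^sup>\<or>)\<close> with \<open>\<theta>\<^sup>\<or> = 2\<theta> / (\<theta>, \<theta>)\<close>.\<close>

definition dual_coxeter :: 'a
  where "dual_coxeter = 1 + 2 * dual_form rho highest_root / dual_form highest_root highest_root"

definition length_ratio :: "('b \<Rightarrow> 'a) \<Rightarrow> 'a"
  where "length_ratio \<alpha> = dual_form highest_root highest_root / dual_form \<alpha> \<alpha>"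

definition fundamental_weight :: "('b \<Rightarrow> 'a) \<Rightarrow> 'b \<Rightarrow> 'a"
  where "fundamental_weight \<alpha> = (THE \<phi>. \<phi> \<in> cartan_dual \<and>
    (\<forall>\<beta>\<in>simples. 2 * dual_form \<phi> \<beta> / dual_form \<beta> \<beta> = (if \<beta> = \<alpha> then 1 else 0)))"

definition depth :: "('b \<Rightarrow> 'a) \<Rightarrow> int"
  where "depth \<alpha> = ht \<alpha> highest_root"

definition roots_of_height :: "('b \<Rightarrow> 'a) \<Rightarrow> int \<Rightarrow> ('b \<Rightarrow> 'a) set"
  where "roots_of_height \<alpha> i = {\<gamma> \<in> roots. ht \<alpha> \<gamma> = i}"

definition grade :: "('b \<Rightarrow> 'a) \<Rightarrow> int \<Rightarrow> 'b set"
  where "grade \<alpha> i =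
    span ((if i = 0 then t else {}) \<union> (\<Union>\<gamma>\<in>roots_of_height \<alpha> i. root_space \<gamma>))"

definition q :: "('b \<Rightarrow> 'a) \<Rightarrow> int \<Rightarrow> int"
  where "q \<alpha> i = (THE m. (\<Sum>\<gamma>\<in>roots_of_height \<alpha> i. \<gamma>) =
    scale_fun (of_int m) (fundamental_weight \<alpha>))"

text \<open>\<open>casimir_eigenvalue \<alpha> k\<close> is the scalar by which the Casimir element of \<open>grade \<alpha> 0\<close> acts on
  \<open>grade \<alpha> k\<close>; the Casimir element does not depend on the dual bases in which it is written.\<close>

definition casimir_acts_by_scalar :: "('b \<Rightarrow> 'a) \<Rightarrow> int \<Rightarrow> 'a \<Rightarrow> bool"
  where "casimir_acts_by_scalar \<alpha> k c \<longleftrightarrow> (\<forall>n e e'. dual_bases (grade \<alpha> 0) n e e' \<longrightarrow>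
    (\<forall>x\<in>grade \<alpha> k. casimir_action n e e' x = c *s x))"

definition casimir_eigenvalue :: "('b \<Rightarrow> 'a) \<Rightarrow> int \<Rightarrow> 'a"
  where "casimir_eigenvalue \<alpha> k = (THE c. casimir_acts_by_scalar \<alpha> k c)"

text \<open>The sum over all \<open>i \<ge> 1\<close>; only finitely many terms are nonzero.\<close>

definition q_total :: "('b \<Rightarrow> 'a) \<Rightarrow> int"
  where "q_total \<alpha> = (\<Sum>i | i \<ge> 1 \<and> q \<alpha> i \<noteq> 0. q \<alpha> i)"

end

end

theory Submission
  imports Defs
begin

text \<open>Write \<open>K\<close> for the Killing form, \<open>g(i)\<close> for the pieces of the grading by the simple root \<open>\<alpha>\<close>, and
  \<open>C\<close> for the Casimir element of \<open>g(0)\<close>.  Expanding in dual bases gives, for all \<open>x\<close> and \<open>y\<close>,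
  \<open>K(C x, y) = T 0\<close>, where \<open>T i\<close> is the trace of \<open>ad y ad x\<close> on \<open>g(i)\<close> (lemma \<open>killing_casimir\<close>).

  Let \<open>x\<close> have degree \<open>k\<close> and \<open>y\<close> degree \<open>-k\<close>.  Cyclicity of the trace moves \<open>ad y\<close> from one end of
  \<open>ad y ad x\<close> to the other and so relates degree \<open>i\<close> to degree \<open>i + k\<close>: the number \<open>T i - T (i + k)\<close> is
  the trace of \<open>ad [x, y]\<close> on \<open>g(i + k)\<close> (lemma \<open>trace_step\<close>).  As \<open>g(i) = 0\<close> for large \<open>i\<close>, summing
  over \<open>0, k, 2 k, \<dots>\<close> turns \<open>T 0\<close> into the sum over \<open>n \<ge> 1\<close> of the traces of \<open>ad [x, y]\<close> on \<open>g(n k)\<close>.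
  If \<open>x\<close> and \<open>y\<close> are root vectors for \<open>\<nu>\<close> and \<open>-\<nu>\<close>, then \<open>[x, y]\<close> is \<open>K(x, y)\<close> times the vector of
  \<open>t\<close> dual to \<open>\<nu>\<close>, and the trace on \<open>g(i)\<close> is \<open>K(x, y)\<close> times the inner product of \<open>\<nu>\<close> with the sum
  \<open>q(i) \<phi>\<close> of the roots of height \<open>i\<close>, where \<open>\<phi>\<close> is the fundamental weight.  This inner product is
  \<open>q(i) k (\<alpha>, \<alpha>) / 2\<close>.  Nondegeneracy of \<open>K\<close> therefore makes \<open>C\<close> act on \<open>g(k)\<close> by the scalar
  \<open>k (\<alpha>, \<alpha>) / 2 * (q(k) + q(2 k) + \<dots>)\<close>.  The factor \<open>(\<alpha>, \<alpha>) / 2\<close> is \<open>1 / (2 h r)\<close>, \<open>h\<close> being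
  the dual Coxeter number and \<open>r\<close> the length ratio, because \<open>h (\<theta>, \<theta>) = 1\<close> for the highest root
  \<open>\<theta>\<close> (lemma \<open>dual_coxeter_highest_root\<close>).  The scalar is determined because every \<open>g(k)\<close> with \<open>k\<close>
  between \<open>1\<close> and the height of \<open>\<theta>\<close> is nonzero (lemma \<open>height_occurs\<close>).

  The structure theory that this rests on is developed from the definition of a Cartan subalgebra as
  a nilpotent self-normalizing subalgebra, and the trace relation above does most of the work there
  too.  Applied to generalized weight spaces instead of the \<open>\<alpha>\<close>-grading, it shows that \<open>ad [x, y]\<close> has
  trace zero along a string of weights that does not continue beyond its ends.  This yields the
  nondegeneracy of \<open>K\<close> (theorem \<open>killing_nondegenerate\<close>) and the integrality of the numbers \<open>2 (\<gamma>, \<beta>) / (\<beta>, \<beta>)\<close> (lemma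
  \<open>cartan_integer\<close>).  Started on \<open>t\<close>, it shows that root spaces are lines (lemma
  \<open>mult_root_multiples\<close>), and summed over all weights for \<open>x\<close> in the highest root space it gives
  \<open>h (\<theta>, \<theta>) = 1\<close>.\<close>

section \<open>Generalized eigenspaces\<close>

text \<open>A separate locale keeps the names below apart from the real vector spaces, which interpret its parent.\<close>

locale operators = finite_dimensional_vector_space
begin

abbreviation endo :: "('b \<Rightarrow> 'b) \<Rightarrow> bool"
  where "endo f \<equiv> Vector_Spaces.linear scale scale f"

lemma endoI:
  assumes "\<And>x y. f (x + y) = f x + f y" "\<And>c x. f (c *s x) = c *s f x"
  shows "endo f"
  using assms vector_space_axioms by (simp add: Vector_Spaces.linear_iff)

lemma endo_add: "endo f \<Longrightarrow> f (x + y) = f x + f y"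
  by (simp add: Vector_Spaces.linear_iff)

lemma endo_scale: "endo f \<Longrightarrow> f (c *s x) = c *s f x"
  by (simp add: Vector_Spaces.linear_iff)

lemma endo_zero: "endo f \<Longrightarrow> f 0 = 0"
  using endo_scale[of f 0 0] by simp

lemma endo_diff: "endo f \<Longrightarrow> f (x - y) = f x - f y"
  using endo_add[of f "x - y" y] by (simp add: algebra_simps)

lemma endo_sum:
  assumes "endo f" shows "f (sum g A) = (\<Sum>x\<in>A. f (g x))"
  by (induct A rule: infinite_finite_induct)
    (simp_all add: endo_add[OF assms] endo_zero[OF assms])

lemma endo_comp:
  assumes "endo f" "endo g" shows "endo (\<lambda>x. f (g x))"
  by (rule endoI) (simp_all add: assms[THEN endo_add] assms[THEN endo_scale])

lemma endo_id: "endo (\<lambda>x. x)"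
  by (rule endoI) simp_all

lemma endo_plus:
  assumes "endo f" "endo g" shows "endo (\<lambda>x. f x + g x)"
  by (rule endoI) (simp_all add: assms[THEN endo_add] assms[THEN endo_scale] algebra_simps)

lemma endo_minus:
  assumes "endo f" "endo g" shows "endo (\<lambda>x. f x - g x)"
  by (rule endoI) (simp_all add: assms[THEN endo_add] assms[THEN endo_scale] algebra_simps)

lemma endo_scaled:
  assumes "endo f" shows "endo (\<lambda>x. c *s f x)"
  by (rule endoI) (simp_all add: assms[THEN endo_add] assms[THEN endo_scale] algebra_simps)

lemma endo_sums:
  assumes "\<And>i. i \<in> A \<Longrightarrow> endo (f i)" shows "endo (\<lambda>x. \<Sum>i\<in>A. f i x)"
  by (rule endoI)
    (simp_all add: assms[THEN endo_add] assms[THEN endo_scale] sum.distrib scale_sum_right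
      cong: sum.cong)

lemma endo_funpow:
  assumes "endo f" shows "endo (f ^^ n)"
proof (induct n)
  case 0
  show ?case by (rule endoI) simp_all
next
  case (Suc n)
  show ?case using endo_comp[OF assms Suc] by (simp add: comp_def)
qed

lemma funpow_zero_mono:
  assumes "endo f" "(f ^^ n) x = 0" "n \<le> m"
  shows "(f ^^ m) x = 0"
proof -
  have "(f ^^ m) x = (f ^^ (m - n)) ((f ^^ n) x)"
    using assms(3) by (metis comp_apply funpow_add le_add_diff_inverse2)
  then show ?thesis using assms(2) endo_zero[OF endo_funpow[OF assms(1)]] by simp
qed

lemma span_of_subspace: "subspace S \<Longrightarrow> span S = S"
  using span_minimal[of S S] span_superset[of S] by auto

lemma subspace_endo_image:
  assumes f: "endo f" and S: "subspace S" shows "subspace (f ` S)"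
proof (rule subspaceI)
  show "0 \<in> f ` S" by (rule image_eqI[of _ f 0]) (simp_all add: endo_zero[OF f] subspace_0[OF S])
  show "x + y \<in> f ` S" if xy: "x \<in> f ` S" "y \<in> f ` S" for x y
  proof -
    obtain u v where "x = f u" "y = f v" "u \<in> S" "v \<in> S" using xy by auto
    then show ?thesis
      by (intro image_eqI[of _ f "u + v"]) (simp_all add: endo_add[OF f] subspace_add[OF S])
  qed
  show "c *s x \<in> f ` S" if x: "x \<in> f ` S" for c x
  proof -
    obtain u where "x = f u" "u \<in> S" using x by auto
    then show ?thesis
      by (intro image_eqI[of _ f "c *s u"]) (simp_all add: endo_scale[OF f] subspace_scale[OF S])
  qed
qed

lemma endo_span:
  assumes f: "endo f" and S: "subspace S" and "\<And>x. x \<in> B \<Longrightarrow> f x \<in> S" and x: "x \<in> span B"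
  shows "f x \<in> S"
proof -
  have "subspace {x. f x \<in> S}"
    by (rule subspaceI)
      (simp_all add: endo_zero[OF f] endo_add[OF f] endo_scale[OF f] subspace_0[OF S]
        subspace_add[OF S] subspace_scale[OF S])
  moreover have "B \<subseteq> {x. f x \<in> S}" using assms(3) by auto
  ultimately have "span B \<subseteq> {x. f x \<in> S}" by (rule span_minimal[rotated])
  then show ?thesis using x by auto
qed

lemma endo_span_zero:
  assumes "endo f" "\<And>x. x \<in> B \<Longrightarrow> f x = 0" "x \<in> span B"
  shows "f x = 0"
  using endo_span[OF assms(1) subspace_single_0 _ assms(3)] assms(2) by simp

definition eigenshift :: "('b \<Rightarrow> 'b) \<Rightarrow> 'a \<Rightarrow> 'b \<Rightarrow> 'b"
  where "eigenshift f a = (\<lambda>x. f x - a *s x)"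

definition gen_eigenspace :: "('b \<Rightarrow> 'b) \<Rightarrow> 'a \<Rightarrow> 'b set"
  where "gen_eigenspace f a = {x. \<exists>n. (eigenshift f a ^^ n) x = 0}"

lemma endo_eigenshift: "endo f \<Longrightarrow> endo (eigenshift f a)"
  unfolding eigenshift_def by (intro endo_minus endo_scaled endo_id)

lemma subspace_gen_eigenspace:
  assumes "endo f" shows "subspace (gen_eigenspace f a)"
proof (rule subspaceI)
  note lin = endo_funpow[OF endo_eigenshift[OF assms, of a]]
  show "0 \<in> gen_eigenspace f a" by (auto simp: gen_eigenspace_def endo_zero[OF lin])
  show "c *s x \<in> gen_eigenspace f a" if "x \<in> gen_eigenspace f a" for c x
    using that by (auto simp: gen_eigenspace_def endo_scale[OF lin])
  fix x y assume "x \<in> gen_eigenspace f a" "y \<in> gen_eigenspace f a"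
  then obtain m n where "(eigenshift f a ^^ m) x = 0" "(eigenshift f a ^^ n) y = 0"
    by (auto simp: gen_eigenspace_def)
  then have "(eigenshift f a ^^ max m n) x = 0" "(eigenshift f a ^^ max m n) y = 0"
    using funpow_zero_mono[OF endo_eigenshift[OF assms]] by (metis max.cobounded1 max.cobounded2)+
  then have "(eigenshift f a ^^ max m n) (x + y) = 0" by (simp add: endo_add[OF lin])
  then show "x + y \<in> gen_eigenspace f a" by (auto simp: gen_eigenspace_def)
qed

lemma eigenshift_gen_eigenspace:
  assumes "endo f" "x \<in> gen_eigenspace f b"
  shows "f x \<in> gen_eigenspace f b" "eigenshift f a x \<in> gen_eigenspace f b"
    "(eigenshift f a ^^ n) x \<in> gen_eigenspace f b"
proof -
  note sub = subspace_gen_eigenspace[OF assms(1), of b]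
  have *: "f y \<in> gen_eigenspace f b" if y: "y \<in> gen_eigenspace f b" for y
  proof -
    obtain n where "(eigenshift f b ^^ n) y = 0" using y by (auto simp: gen_eigenspace_def)
    then have "(eigenshift f b ^^ n) (eigenshift f b y) = 0"
      by (metis assms(1) endo_eigenshift endo_zero funpow_swap1)
    then have "eigenshift f b y \<in> gen_eigenspace f b" by (auto simp: gen_eigenspace_def)
    then have "eigenshift f b y + b *s y \<in> gen_eigenspace f b"
      by (intro subspace_add[OF sub] subspace_scale[OF sub] y)
    then show ?thesis by (simp add: eigenshift_def)
  qed
  show "f x \<in> gen_eigenspace f b" by (rule *[OF assms(2)])
  have **: "eigenshift f a y \<in> gen_eigenspace f b" if "y \<in> gen_eigenspace f b" for y
    unfolding eigenshift_def by (intro subspace_diff[OF sub] subspace_scale[OF sub] * that)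
  show "eigenshift f a x \<in> gen_eigenspace f b" by (rule **[OF assms(2)])
  show "(eigenshift f a ^^ n) x \<in> gen_eigenspace f b"
    by (induct n) (auto simp: assms(2) **)
qed

text \<open>On the generalized eigenspace for \<open>b\<close> the operator \<open>f - a\<close> is a nonzero scalar plus a locally
  nilpotent operator, hence bijective.\<close>

lemma eigenshift_surj_on:
  assumes "endo f" "a \<noteq> b" "subspace U" "\<And>x. x \<in> U \<Longrightarrow> f x \<in> U"
    and "x \<in> gen_eigenspace f b" "x \<in> U"
  shows "\<exists>w \<in> gen_eigenspace f b \<inter> U. eigenshift f a w = x"
proof -
  note sub = subspace_gen_eigenspace[OF assms(1), of b]
  have "\<exists>w \<in> gen_eigenspace f b \<inter> U. eigenshift f a w = x"
    if "(eigenshift f b ^^ n) x = 0" "x \<in> U" for n x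
    using that
  proof (induct n arbitrary: x)
    case 0
    then show ?case
      using subspace_0[OF sub] subspace_0[OF assms(3)] endo_zero[OF endo_eigenshift[OF assms(1)]]
      by auto
  next
    case (Suc n)
    have x: "x \<in> gen_eigenspace f b" using Suc.prems unfolding gen_eigenspace_def by blast
    have "eigenshift f b x \<in> U"
      unfolding eigenshift_def
      using Suc.prems assms by (intro subspace_diff subspace_scale) auto
    moreover have "(eigenshift f b ^^ n) (eigenshift f b x) = 0"
      using Suc.prems(1) by (simp add: funpow_swap1)
    ultimately obtain w where w: "w \<in> gen_eigenspace f b" "w \<in> U" "eigenshift f a w = eigenshift f b x"
      using Suc.hyps[of "eigenshift f b x"] by auto
    let ?w = "(1 / (b - a)) *s (x - w)"
    have "eigenshift f a ?w = (1 / (b - a)) *s (eigenshift f a x - eigenshift f a w)"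
      by (simp add: endo_scale[OF endo_eigenshift[OF assms(1)]] endo_diff[OF endo_eigenshift[OF assms(1)]])
    also have "\<dots> = (1 / (b - a)) *s ((b - a) *s x)"
      unfolding w(3) by (simp add: eigenshift_def algebra_simps)
    also have "\<dots> = x" using assms(2) by simp
    finally have "eigenshift f a ?w = x" .
    moreover have "?w \<in> gen_eigenspace f b"
      by (intro subspace_scale[OF sub] subspace_diff[OF sub] x w)
    moreover have "?w \<in> U"
      by (intro subspace_scale[OF assms(3)] subspace_diff[OF assms(3)] Suc.prems w)
    ultimately show ?case by blast
  qed
  then show ?thesis using assms(5,6) unfolding gen_eigenspace_def by blast
qed

lemma eigenshift_inj_on:
  assumes "endo f" "a \<noteq> b" "x \<in> gen_eigenspace f b" "(eigenshift f a ^^ n) x = 0"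
  shows "x = 0"
  using assms(3,4)
proof (induct n arbitrary: x)
  case (Suc n)
  have "eigenshift f a x = 0"
    using Suc.hyps[of "eigenshift f a x"] Suc.prems eigenshift_gen_eigenspace[OF assms(1)]
    by (simp add: funpow_swap1)
  then have fx: "f x = a *s x" by (simp add: eigenshift_def)
  obtain m where m: "(eigenshift f b ^^ m) x = 0" using Suc.prems by (auto simp: gen_eigenspace_def)
  have "(eigenshift f b ^^ k) x = (a - b) ^ k *s x" for k
    by (induct k)
      (simp_all add: endo_scale[OF endo_eigenshift[OF assms(1)]], simp add: eigenshift_def fx algebra_simps)
  with m show ?case using assms(2) by simp
qed simp

text \<open>Evaluation of polynomials at an endomorphism, by Horner's scheme.\<close>

definition poly_act :: "('b \<Rightarrow> 'b) \<Rightarrow> 'a poly \<Rightarrow> 'b \<Rightarrow> 'b"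
  where "poly_act f p x = fold_coeffs (\<lambda>a y. a *s x + f y) p 0"

lemma poly_act_0 [simp]: "poly_act f 0 x = 0"
  by (simp add: poly_act_def)

lemma poly_act_pCons: "endo f \<Longrightarrow> poly_act f (pCons a p) x = a *s x + f (poly_act f p x)"
  by (cases "p = 0 \<and> a = 0") (auto simp: poly_act_def dest: endo_zero)

lemma poly_act_add:
  assumes "endo f" shows "poly_act f (p + q) x = poly_act f p x + poly_act f q x"
  by (induct p q rule: poly_induct2)
    (simp_all add: poly_act_pCons[OF assms] endo_add[OF assms] algebra_simps)

lemma poly_act_smult:
  assumes "endo f" shows "poly_act f (smult c p) x = c *s poly_act f p x"
  by (induct p) (simp_all add: poly_act_pCons[OF assms] endo_scale[OF assms] algebra_simps)

lemma poly_act_endo: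
  assumes "endo f" shows "endo (poly_act f p)"
proof (induct p)
  case 0
  show ?case by (rule endoI) simp_all
next
  case (pCons a p)
  show ?case unfolding poly_act_pCons[OF assms]
    by (intro endo_plus endo_scaled endo_id endo_comp[OF assms] pCons)
qed

lemma poly_act_commute:
  assumes "endo f" shows "poly_act f p (f x) = f (poly_act f p x)"
  by (induct p) (simp_all add: poly_act_pCons[OF assms] assms[THEN endo_scale]
      assms[THEN endo_add] assms[THEN endo_zero])

lemma poly_act_linear_factor:
  assumes "endo f"
  shows "poly_act f ([:- a, 1:] * p) x = poly_act f p (eigenshift f a x)"
proof -
  have "poly_act f ([:- a, 1:] * p) x = poly_act f (smult (- a) p + pCons 0 p) x" by simp
  also have "\<dots> = - a *s poly_act f p x + f (poly_act f p x)"
    unfolding poly_act_add[OF assms] poly_act_smult[OF assms] poly_act_pCons[OF assms] by simp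
  also have "\<dots> = poly_act f p (eigenshift f a x)"
    by (simp add: eigenshift_def endo_diff[OF poly_act_endo[OF assms]]
        endo_scale[OF poly_act_endo[OF assms]] poly_act_commute[OF assms])
  finally show ?thesis .
qed

lemma annihilating_polynomial:
  assumes "endo f"
  shows "\<exists>p. p \<noteq> 0 \<and> poly_act f p x = 0"
proof (rule ccontr)
  assume *: "\<not> ?thesis"
  let ?K = "\<lambda>n. (\<lambda>i. (f ^^ i) x) ` {..<n}"
  have monom: "poly_act f (monom 1 i) x = (f ^^ i) x" for i
    by (induct i) (simp_all add: monom_0 monom_Suc poly_act_pCons[OF assms] endo_zero[OF assms])
  have span: "span (?K n) \<subseteq> {poly_act f p x | p. \<forall>i\<ge>n. coeff p i = 0}" for n
  proof (rule span_minimal)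
    show "?K n \<subseteq> {poly_act f p x | p. \<forall>i\<ge>n. coeff p i = 0}"
    proof clarify
      fix i assume "i < n"
      then show "\<exists>p. (f ^^ i) x = poly_act f p x \<and> (\<forall>i\<ge>n. coeff p i = 0)"
        by (intro exI[of _ "monom 1 i"]) (auto simp: monom)
    qed
    show "subspace {poly_act f p x | p. \<forall>i\<ge>n. coeff p i = 0}" (is "subspace ?Z")
    proof (rule subspaceI)
      show "0 \<in> ?Z" by (auto intro!: exI[of _ 0])
    next
      fix y z assume "y \<in> ?Z" "z \<in> ?Z"
      then obtain p r where "y = poly_act f p x" "z = poly_act f r x"
        "\<forall>i\<ge>n. coeff p i = 0" "\<forall>i\<ge>n. coeff r i = 0" by blast
      then show "y + z \<in> ?Z" by (auto intro!: exI[of _ "p + r"] simp: poly_act_add[OF assms])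
    next
      fix c y assume "y \<in> ?Z"
      then obtain p where "y = poly_act f p x" "\<forall>i\<ge>n. coeff p i = 0" by blast
      then show "c *s y \<in> ?Z" by (auto intro!: exI[of _ "smult c p"] simp: poly_act_smult[OF assms])
    qed
  qed
  have new: "(f ^^ n) x \<notin> span (?K n)" for n
  proof
    assume "(f ^^ n) x \<in> span (?K n)"
    then obtain p where p: "(f ^^ n) x = poly_act f p x" "\<forall>i\<ge>n. coeff p i = 0"
      using span by blast
    have "poly_act f (monom 1 n + smult (-1) p) x = 0"
      using p(1) by (simp add: monom poly_act_add[OF assms] poly_act_smult[OF assms] del: smult_minus_left)
    moreover have "coeff (monom 1 n + smult (-1) p) n = 1" using p(2) by simp
    ultimately show False using * by (metis coeff_0 zero_neq_one)
  qed
  have "independent (?K n) \<and> card (?K n) = n" for n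
  proof (induct n)
    case (Suc n)
    have "?K (Suc n) = insert ((f ^^ n) x) (?K n)" by (auto simp: lessThan_Suc)
    moreover have "(f ^^ n) x \<notin> ?K n" using new[of n] by (rule contrapos_nn) (rule span_base)
    ultimately show ?case
      using Suc new[of n] by (simp add: independent_insert)
  qed (simp add: independent_empty)
  then have "Suc dimension \<le> dim (UNIV :: 'b set)"
    using independent_card_le_dim[of "?K (Suc dimension)" UNIV] by (metis subset_UNIV)
  then show False by (simp add: dimension_def)
qed

text \<open>If \<open>(f - a) x\<close> is a sum of generalized eigenvectors then so is \<open>x\<close>: the components for
  eigenvalues other than \<open>a\<close> can be lifted along \<open>f - a\<close>, and what is left of \<open>x\<close> after
  subtracting the lifts is a generalized eigenvector for \<open>a\<close>.  Peeling off the linear factors of an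
  annihilating polynomial gives the decomposition.\<close>

lemma gen_eigenspaces_span:
  fixes f :: "'b \<Rightarrow> 'b"
  assumes split: "\<And>p :: 'a poly. degree p > 0 \<Longrightarrow> \<exists>a. poly p a = 0"
    and f: "endo f" and U: "subspace U" "\<And>x. x \<in> U \<Longrightarrow> f x \<in> U" and "x \<in> U"
  shows "x \<in> span (\<Union>a. gen_eigenspace f a \<inter> U)"
proof -
  let ?E = "span (\<Union>a. gen_eigenspace f a \<inter> U)"
  have EU: "?E \<subseteq> U" by (rule span_minimal) (auto simp: U)
  have step: "x \<in> ?E" if shifted: "eigenshift f a x \<in> ?E" and "x \<in> U" for a x
  proof -
    note lin = endo_eigenshift[OF f, of a]
    let ?G = "gen_eigenspace f a \<inter> U"
    note sub = subspace_inter[OF subspace_gen_eigenspace[OF f, of a] U(1)]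
    have image: "subspace (eigenshift f a ` ?E)" by (rule subspace_endo_image[OF lin subspace_span])
    have "?E \<subseteq> {u + v | u v. u \<in> ?G \<and> v \<in> eigenshift f a ` ?E}"
    proof (rule span_minimal[OF _ subspace_sums[OF sub image]], rule subsetI)
      fix z assume "z \<in> (\<Union>a. gen_eigenspace f a \<inter> U)"
      then obtain b where b: "z \<in> gen_eigenspace f b" "z \<in> U" by auto
      have "z \<in> ?G \<or> z \<in> eigenshift f a ` ?E"
      proof (cases "a = b")
        case False
        then obtain w where w: "w \<in> gen_eigenspace f b \<inter> U" "eigenshift f a w = z"
          using eigenshift_surj_on[OF f False U b] by blast
        then have "w \<in> ?E" by (intro span_base) auto
        then show ?thesis using w(2) by auto
      qed (use b in simp)
      moreover have "z = z + 0" "z = 0 + z" by simp_all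
      ultimately show "z \<in> {u + v | u v. u \<in> ?G \<and> v \<in> eigenshift f a ` ?E}"
        using subspace_0[OF sub] subspace_0[OF image] by blast
    qed
    then obtain u w where w: "eigenshift f a x = u + eigenshift f a w" "u \<in> ?G" "w \<in> ?E"
      using shifted by blast
    then have "eigenshift f a (x - w) = u" by (simp add: endo_diff[OF lin])
    then obtain n where "(eigenshift f a ^^ n) (eigenshift f a (x - w)) = 0"
      using w(2) unfolding gen_eigenspace_def by blast
    then have "(eigenshift f a ^^ Suc n) (x - w) = 0" by (simp add: funpow_swap1)
    then have "x - w \<in> gen_eigenspace f a" unfolding gen_eigenspace_def by blast
    moreover have "x - w \<in> U" using \<open>x \<in> U\<close> w(3) EU by (intro subspace_diff[OF U(1)]) auto
    ultimately have "x - w \<in> ?E" by (intro span_base) auto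
    then have "x - w + w \<in> ?E" using w(3) by (rule span_add)
    then show ?thesis by simp
  qed
  have "x \<in> ?E" if "p \<noteq> 0" "poly_act f p x = 0" "x \<in> U" for p x
    using that
  proof (induct "degree p" arbitrary: p x)
    case 0
    obtain c where p: "p = [:c:]" using 0(1)[symmetric] by (rule degree_eq_zeroE)
    with 0 have "c \<noteq> 0" by simp
    then have "x = 0" using 0(3) p by (simp add: poly_act_pCons[OF f] endo_zero[OF f])
    then show ?case by (simp add: span_zero)
  next
    case (Suc n)
    then obtain a where "poly p a = 0" using split[of p] by auto
    then obtain r where r: "p = [:- a, 1:] * r" by (metis dvdE poly_eq_0_iff_dvd)
    with Suc have r0: "r \<noteq> 0" by auto
    have deg: "degree p = Suc (degree r)"
      unfolding r using r0 by (subst degree_mult_eq) auto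
    have "eigenshift f a x \<in> ?E"
    proof (rule Suc.hyps(1)[of r])
      show "n = degree r" using Suc.hyps(2) deg by simp
      show "poly_act f r (eigenshift f a x) = 0"
        using Suc.prems(2) unfolding r poly_act_linear_factor[OF f] .
      show "eigenshift f a x \<in> U"
        unfolding eigenshift_def using Suc.prems U by (intro subspace_diff subspace_scale) auto
    qed (rule r0)
    then show ?case using Suc.prems(3) by (rule step)
  qed
  moreover obtain p where "p \<noteq> 0" "poly_act f p x = 0" using annihilating_polynomial[OF f] by metis
  ultimately show ?thesis using assms(5) by simp
qed

end

section \<open>Finite direct sums and their projections\<close>

locale direct_sum = operators scale Basis
  for scale :: "'k::field \<Rightarrow> 'g::ab_group_add \<Rightarrow> 'g" (infixr \<open>*s\<close> 75)
  and Basis :: "'g set" +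
  fixes I :: "'i set" and V :: "'i \<Rightarrow> 'g set"
  assumes finite_index: "finite I"
    and subspace_part: "subspace (V i)"
    and part_outside: "i \<notin> I \<Longrightarrow> V i = {0}"
    and parts_exhaust: "\<exists>v. (\<forall>i. v i \<in> V i) \<and> x = (\<Sum>i\<in>I. v i)"
    and parts_independent: "(\<And>i. v i \<in> V i) \<Longrightarrow> (\<Sum>i\<in>I. v i) = 0 \<Longrightarrow> v i = 0"
begin

definition proj :: "'i \<Rightarrow> 'g \<Rightarrow> 'g"
  where "proj i x = (SOME v. (\<forall>i. v i \<in> V i) \<and> x = (\<Sum>i\<in>I. v i)) i"

lemma proj_mem: "proj i x \<in> V i"
  and sum_proj: "(\<Sum>i\<in>I. proj i x) = x"
  using someI_ex[OF parts_exhaust[of x]] unfolding proj_def by auto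

lemma proj_unique:
  assumes "\<And>i. v i \<in> V i" "x = (\<Sum>i\<in>I. v i)"
  shows "proj i x = v i"
proof -
  have "proj i x - v i = 0"
  proof (rule parts_independent[of "\<lambda>i. proj i x - v i"])
    show "proj i x - v i \<in> V i" for i
      by (intro subspace_diff subspace_part proj_mem assms)
    show "(\<Sum>i\<in>I. proj i x - v i) = 0"
      by (simp add: sum_subtractf sum_proj assms(2))
  qed
  then show ?thesis by simp
qed

lemma endo_proj: "endo (proj i)"
proof (rule endoI)
  show "proj i (x + y) = proj i x + proj i y" for x y
    by (rule proj_unique) (simp_all add: subspace_add subspace_part proj_mem sum.distrib sum_proj)
  show "proj i (c *s x) = c *s proj i x" for c x
    by (rule proj_unique)
      (simp_all add: subspace_scale subspace_part proj_mem scale_sum_right[symmetric] sum_proj)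
qed

lemma part_nonzero_index: "x \<in> V i \<Longrightarrow> x \<noteq> 0 \<Longrightarrow> i \<in> I"
  using part_outside by blast

lemma proj_part:
  assumes "x \<in> V j" shows "proj i x = (if i = j then x else 0)"
proof (rule proj_unique[where v = "\<lambda>i. if i = j then x else 0"])
  show "(if i = j then x else 0) \<in> V i" for i using assms subspace_0[OF subspace_part] by simp
  show "x = (\<Sum>i\<in>I. if i = j then x else 0)"
    using part_nonzero_index[OF assms] finite_index by (auto simp: sum.delta')
qed

lemma proj_self: "x \<in> V i \<Longrightarrow> proj i x = x"
  by (simp add: proj_part)

lemma proj_proj: "proj i (proj j x) = (if i = j then proj j x else 0)"
  by (rule proj_part[OF proj_mem])

lemma proj_shift:
  assumes f: "endo f" and shift: "\<And>i x. x \<in> V i \<Longrightarrow> f x \<in> V (\<sigma> i)" and "inj \<sigma>"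
  shows "proj (\<sigma> i) (f x) = f (proj i x)"
proof -
  have "proj (\<sigma> i) (f x) = proj (\<sigma> i) (f (\<Sum>j\<in>I. proj j x))" by (simp add: sum_proj)
  also have "\<dots> = (\<Sum>j\<in>I. proj (\<sigma> i) (f (proj j x)))"
    by (simp add: endo_sum[OF f] endo_sum[OF endo_proj])
  also have "\<dots> = (\<Sum>j\<in>I. if j = i then f (proj j x) else 0)"
    using assms(3) by (intro sum.cong refl) (auto simp: proj_part[OF shift[OF proj_mem]] inj_eq)
  also have "\<dots> = f (proj i x)"
  proof (cases "i \<in> I")
    case True
    then show ?thesis by (simp add: finite_index)
  next
    case False
    then have "proj i x = 0" using part_outside proj_mem[of i x] by auto
    moreover have "(\<Sum>j\<in>I. if j = i then f (proj j x) else 0) = 0"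
      using False by (intro sum.neutral) auto
    ultimately show ?thesis by (simp add: endo_zero[OF f])
  qed
  finally show ?thesis .
qed

end

section \<open>Traces\<close>

sublocale lie_algebra \<subseteq> operators
  by unfold_locales

abbreviation (in lie_algebra) linear_form :: "('g \<Rightarrow> 'k) \<Rightarrow> bool"
  where "linear_form \<phi> \<equiv> Vector_Spaces.linear scale (*) \<phi>"

context lie_algebra
begin

lemma linear_formI:
  assumes "\<And>x y. \<phi> (x + y) = \<phi> x + \<phi> y" "\<And>c x. \<phi> (c *s x) = c * \<phi> x"
  shows "linear_form \<phi>"
proof -
  have "vector_space ((*) :: 'k \<Rightarrow> 'k \<Rightarrow> 'k)" by unfold_locales (auto simp: algebra_simps)
  then show ?thesis using assms vector_space_axioms by (simp add: Vector_Spaces.linear_iff)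
qed

lemma linear_form_add: "linear_form \<phi> \<Longrightarrow> \<phi> (x + y) = \<phi> x + \<phi> y"
  and linear_form_scale: "linear_form \<phi> \<Longrightarrow> \<phi> (c *s x) = c * \<phi> x"
  by (simp_all add: Vector_Spaces.linear_iff)

lemma linear_form_zero: "linear_form \<phi> \<Longrightarrow> \<phi> 0 = 0"
  using linear_form_scale[of \<phi> 0 0] by simp

lemma linear_form_sum:
  assumes "linear_form \<phi>" shows "\<phi> (sum g A) = (\<Sum>x\<in>A. \<phi> (g x))"
  by (induct A rule: infinite_finite_induct)
    (simp_all add: linear_form_add[OF assms] linear_form_zero[OF assms])

lemma rep_add: "representation Basis (x + y) b = representation Basis x b + representation Basis y b"
  by (simp add: representation_add independent_Basis span_Basis)

lemma rep_scale: "representation Basis (c *s x) b = c * representation Basis x b"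
  by (simp add: representation_scale independent_Basis span_Basis)

lemma rep_sum: "representation Basis (sum f A) b = (\<Sum>a\<in>A. representation Basis (f a) b)"
  using representation_sum[of Basis A f] by (simp add: independent_Basis span_Basis fun_eq_iff)

lemma sum_rep: "(\<Sum>b\<in>Basis. representation Basis x b *s b) = x"
  by (rule sum_representation_eq) (simp_all add: independent_Basis span_Basis finite_Basis)

lemma trace_add: "trace (\<lambda>x. f x + g x) = trace f + trace g"
  by (simp add: trace_def rep_add sum.distrib)

lemma trace_scale: "trace (\<lambda>x. c *s f x) = c * trace f"
  by (simp add: trace_def rep_scale sum_distrib_left)

lemma trace_diff: "trace (\<lambda>x. f x - g x) = trace f - trace g"
  using trace_add[of "\<lambda>x. f x - g x" g] by simp

lemma trace_zero: "trace (\<lambda>x. 0) = 0"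
  using trace_scale[of 0 "\<lambda>x. x"] by simp

lemma trace_sum: "trace (\<lambda>x. \<Sum>i\<in>A. f i x) = (\<Sum>i\<in>A. trace (f i))"
  by (simp add: trace_def rep_sum sum.swap[of _ A])

lemma trace_rank_one:
  assumes "linear_form \<phi>" shows "trace (\<lambda>x. \<phi> x *s v) = \<phi> v"
proof -
  have "trace (\<lambda>x. \<phi> x *s v) = \<phi> (\<Sum>b\<in>Basis. representation Basis v b *s b)"
    by (simp add: trace_def rep_scale linear_form_sum[OF assms] linear_form_scale[OF assms]
        mult.commute)
  then show ?thesis by (simp add: sum_rep)
qed

text \<open>Writing one factor as a sum of operators of rank one reduces this to their traces.\<close>

lemma trace_comp_commute:
  assumes "endo f" "endo g" shows "trace (\<lambda>x. f (g x)) = trace (\<lambda>x. g (f x))"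
proof -
  have form: "linear_form (\<lambda>x. representation Basis (g x) b)" for b
    by (rule linear_formI) (simp_all add: endo_add[OF assms(2)] endo_scale[OF assms(2)] rep_add rep_scale)
  have "f (g x) = (\<Sum>b\<in>Basis. representation Basis (g x) b *s f b)" for x
  proof -
    have "f (g x) = f (\<Sum>b\<in>Basis. representation Basis (g x) b *s b)" by (simp add: sum_rep)
    then show ?thesis by (simp add: endo_sum[OF assms(1)] endo_scale[OF assms(1)])
  qed
  then have "trace (\<lambda>x. f (g x)) = (\<Sum>b\<in>Basis. representation Basis (g (f b)) b)"
    by (simp add: trace_sum trace_rank_one[OF form])
  then show ?thesis by (simp add: trace_def)
qed

lemma projector_exists:
  assumes "subspace S"
  shows "\<exists>Q. endo Q \<and> (\<forall>x. Q x \<in> S) \<and> (\<forall>x\<in>S. Q x = x)"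
proof -
  interpret pair: vector_space_pair scale scale by unfold_locales
  obtain B where B: "B \<subseteq> S" "independent B" "S \<subseteq> span B"
    using basis_exists[of S] by metis
  obtain Q where Q: "\<forall>x\<in>B. Q x = x" "endo Q" "range Q = span ((\<lambda>x. x) ` B)"
    using pair.linear_independent_extend_subspace[OF B(2), of "\<lambda>x. x"] by metis
  have SB: "span B = S" using B assms span_minimal by (metis subset_antisym)
  have "Q x = x" if "x \<in> span B" for x
    using pair.linear_eq_on[OF Q(2) endo_id that] Q(1) by simp
  moreover have "Q x \<in> S" for x using Q(3) SB by auto
  ultimately show ?thesis using Q(2) SB by metis
qed

text \<open>With \<open>Q\<close> a projector onto the range of \<open>N\<close>, the operators \<open>N = Q N\<close> and \<open>N Q\<close> have the same
  trace, and the nilpotency index of \<open>N Q\<close> is smaller.\<close>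

lemma trace_nilpotent:
  assumes "endo N" "\<And>x. (N ^^ n) x = 0"
  shows "trace N = 0"
  using assms
proof (induct n arbitrary: N)
  case 0
  then have "N = (\<lambda>x. 0)" by (auto simp: fun_eq_iff)
  then show ?case by (simp only: trace_zero)
next
  case (Suc n)
  have "subspace (range N)" by (rule subspace_endo_image[OF Suc.prems(1) subspace_UNIV])
  then obtain Q where Q: "endo Q" "\<And>x. Q x \<in> range N" "\<And>x. Q (N x) = N x"
    using projector_exists[of "range N"] by blast
  show ?case
  proof (cases n)
    case 0
    then have "N = (\<lambda>x. 0)" using Suc.prems(2) by (auto simp: fun_eq_iff)
    then show ?thesis by (simp only: trace_zero)
  next
    case (Suc m)
    have power: "((\<lambda>x. N (Q x)) ^^ Suc k) x = (N ^^ Suc k) (Q x)" for k x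
      by (induct k) (simp_all add: Q(3))
    have "trace (\<lambda>x. N (Q x)) = 0"
    proof (rule Suc.hyps)
      show "endo (\<lambda>x. N (Q x))" by (rule endo_comp[OF Suc.prems(1) Q(1)])
      fix x
      obtain y where y: "Q x = N y" using Q(2)[of x] by auto
      have "((\<lambda>x. N (Q x)) ^^ n) x = (N ^^ n) (N y)"
        unfolding Suc power y ..
      also have "\<dots> = 0" using Suc.prems(2)[of y] by (simp add: funpow_swap1)
      finally show "((\<lambda>x. N (Q x)) ^^ n) x = 0" .
    qed
    moreover have "trace N = trace (\<lambda>x. Q (N x))" by (simp only: Q(3))
    ultimately show ?thesis
      by (simp only: trace_comp_commute[OF Q(1) Suc.prems(1)])
  qed
qed

lemma trace_locally_nilpotent:
  assumes "endo N" "\<And>x. \<exists>n. (N ^^ n) x = 0"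
  shows "trace N = 0"
proof -
  obtain n where n: "\<And>x. (N ^^ n x) x = 0" using assms(2) by metis
  define m where "m = (\<Sum>b\<in>Basis. n b)"
  have basis: "(N ^^ m) b = 0" if "b \<in> Basis" for b
  proof (rule funpow_zero_mono[OF assms(1) n])
    show "n b \<le> m" unfolding m_def by (rule member_le_sum[OF that]) (simp_all add: finite_Basis)
  qed
  have "(N ^^ m) x = 0" for x
  proof -
    have "(N ^^ m) x = (N ^^ m) (\<Sum>b\<in>Basis. representation Basis x b *s b)" by (simp add: sum_rep)
    also have "\<dots> = (\<Sum>b\<in>Basis. representation Basis x b *s (N ^^ m) b)"
      by (simp add: endo_sum[OF endo_funpow[OF assms(1)]] endo_scale[OF endo_funpow[OF assms(1)]])
    also have "\<dots> = 0" by (simp add: basis)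
    finally show ?thesis .
  qed
  then show ?thesis by (rule trace_nilpotent[OF assms(1)])
qed

lemma trace_projector:
  assumes "endo P" "\<And>x. P x \<in> S" "\<And>x. x \<in> S \<Longrightarrow> P x = x" "subspace S"
  shows "trace P = of_nat (dim S)"
proof -
  obtain B where B: "B \<subseteq> S" "independent B" "S \<subseteq> span B" "card B = dim S"
    using basis_exists[of S] by metis
  have fin: "finite B" by (rule finiteI_independent[OF B(2)])
  have inB: "P x \<in> span B" for x using assms(2) B(3) by blast
  have form: "linear_form (\<lambda>x. representation B (P x) b)" for b
    by (rule linear_formI)
      (simp_all add: endo_add[OF assms(1)] endo_scale[OF assms(1)] representation_add
        representation_scale B(2) inB)
  have "P x = (\<Sum>b\<in>B. representation B (P x) b *s b)" for x
    using sum_representation_eq[OF B(2) inB fin subset_refl] by simp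
  then have "trace P = trace (\<lambda>x. \<Sum>b\<in>B. representation B (P x) b *s b)" by metis
  also have "\<dots> = (\<Sum>b\<in>B. representation B (P b) b)"
    by (simp add: trace_sum trace_rank_one[OF form])
  also have "\<dots> = (\<Sum>b\<in>B. 1)"
  proof (rule sum.cong)
    fix b assume "b \<in> B"
    then show "representation B (P b) b = 1"
      using assms(3)[of b] B(1) representation_basis[OF B(2), of b] by auto
  qed simp
  finally show ?thesis by (simp add: B(4))
qed

section \<open>The adjoint representation\<close>

lemma endo_br: "endo (br x)"
  by (rule endoI) (simp_all add: br_add_right br_scale_right)

lemma endo_br_right: "endo (\<lambda>x. br x y)"
  by (rule endoI) (simp_all add: br_add_left br_scale_left)

lemmas br_zero_right = endo_zero[OF endo_br] and br_zero_left = endo_zero[OF endo_br_right]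
  and br_diff_right = endo_diff[OF endo_br] and br_diff_left = endo_diff[OF endo_br_right]
  and br_sum_right = endo_sum[OF endo_br] and br_sum_left = endo_sum[OF endo_br_right]

lemma br_antisym: "br y x = - br x y"
proof -
  have "br (x + y) (x + y) = br x y + br y x"
    by (simp only: br_add_left br_add_right) (simp add: br_self)
  then have "br x y + br y x = 0" by (simp add: br_self)
  then show ?thesis by (simp add: eq_neg_iff_add_eq_0 add.commute)
qed

lemma br_minus_right: "br x (- y) = - br x y"
  using br_diff_right[of x 0 y] by (simp add: br_zero_right)

lemma br_minus_left: "br (- x) y = - br x y"
  using br_diff_left[of 0 x y] by (simp add: br_zero_left)

lemma br_br_left: "br (br x y) z = br x (br y z) - br y (br x z)"
proof -
  have "br x (br y z) - br y (br x z) - br (br x y) z = 0"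
    using jacobi[of x y z] by (simp add: br_antisym[of z x] br_antisym[of z "br x y"] br_minus_right)
  then show ?thesis by simp
qed

lemma br_br_right: "br x (br y z) = br (br x y) z + br y (br x z)"
  by (simp add: br_br_left)

lemma killing_commute: "killing x y = killing y x"
  unfolding killing_def by (rule trace_comp_commute[OF endo_br endo_br])

lemma killing_add_left: "killing (x + y) z = killing x z + killing y z"
  by (simp add: killing_def br_add_left trace_add)

lemma killing_scale_left: "killing (c *s x) z = c * killing x z"
  by (simp add: killing_def br_scale_left trace_scale)

lemma linear_form_killing: "linear_form (\<lambda>x. killing x y)"
  by (rule linear_formI) (simp_all add: killing_add_left killing_scale_left)

lemma linear_form_killing_right: "linear_form (killing x)"
  using linear_form_killing[of x] by (subst killing_commute[abs_def]) simp

lemma killing_invariant: "killing (br x y) z = killing x (br y z)"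
proof -
  have "killing (br x y) z = trace (\<lambda>w. br x (br y (br z w))) - trace (\<lambda>w. br y (br x (br z w)))"
    by (simp add: killing_def br_br_left trace_diff)
  also have "trace (\<lambda>w. br y (br x (br z w))) = trace (\<lambda>w. br x (br z (br y w)))"
    by (rule trace_comp_commute[OF endo_br endo_comp[OF endo_br endo_br]])
  also have "trace (\<lambda>w. br x (br y (br z w))) - trace (\<lambda>w. br x (br z (br y w)))
      = killing x (br y z)"
    by (simp add: killing_def br_br_left br_diff_right trace_diff)
  finally show ?thesis .
qed

text \<open>In a basis \<open>B\<close> of \<open>S\<close>, sending \<open>x\<close> to the vector with coordinates \<open>K(x, b)\<close> is an injective, hence
  surjective, endomorphism of \<open>S\<close>.\<close>

lemma killing_represents:
  assumes S: "subspace S" and nondeg: "\<And>x. x \<in> S \<Longrightarrow> (\<And>y. y \<in> S \<Longrightarrow> killing x y = 0) \<Longrightarrow> x = 0"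
    and \<phi>: "\<And>x y. x \<in> S \<Longrightarrow> y \<in> S \<Longrightarrow> \<phi> (x + y) = \<phi> x + \<phi> y"
      "\<And>c x. x \<in> S \<Longrightarrow> \<phi> (c *s x) = c * \<phi> x"
  shows "\<exists>h\<in>S. \<forall>x\<in>S. killing h x = \<phi> x"
proof -
  interpret pair: finite_dimensional_vector_space_pair_1 scale Basis scale by unfold_locales
  obtain B where B: "B \<subseteq> S" "independent B" "S \<subseteq> span B"
    using basis_exists[of S] by metis
  have fin: "finite B" by (rule finiteI_independent[OF B(2)])
  have SB: "span B = S" using B(1,3) span_minimal[OF B(1) S] by auto
  note K_add = linear_form_add[OF linear_form_killing_right]
    and K_scale = linear_form_scale[OF linear_form_killing_right]
    and K_zero = linear_form_zero[OF linear_form_killing_right]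
  define T where "T x = (\<Sum>b\<in>B. killing x b *s b)" for x
  have T: "endo T"
    by (rule endoI) (simp_all add: T_def killing_add_left killing_scale_left scale_left_distrib
        sum.distrib scale_sum_right)
  have TS: "T x \<in> S" for x
    unfolding T_def using B(1) by (intro subspace_sum S subspace_scale) auto
  have agree: "killing h x = \<phi> x" if h: "\<And>b. b \<in> B \<Longrightarrow> killing h b = \<phi> b" and x: "x \<in> S" for h x
  proof -
    have "\<phi> 0 = 0" using \<phi>(2)[OF subspace_0[OF S], of 0] by simp
    then have "subspace {x \<in> S. killing h x = \<phi> x}"
      by (intro subspaceI) (auto simp: subspace_0 subspace_add subspace_scale S K_add K_scale K_zero \<phi>)
    moreover have "B \<subseteq> {x \<in> S. killing h x = \<phi> x}" using B(1) h by auto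
    ultimately have "span B \<subseteq> {x \<in> S. killing h x = \<phi> x}" by (intro span_minimal)
    then show ?thesis using x SB by auto
  qed
  have zero: "x = 0" if x: "x \<in> S" "T x = 0" for x
  proof (rule nondeg[OF x(1)])
    fix y assume y: "y \<in> S"
    have B0: "killing x b = 0" if "b \<in> B" for b
      using independentD[OF B(2) fin subset_refl _ that, of "killing x"] x(2) by (simp add: T_def)
    have "subspace {y \<in> S. killing x y = 0}"
      by (intro subspaceI) (auto simp: subspace_0 subspace_add subspace_scale S K_add K_scale K_zero)
    moreover have "B \<subseteq> {y \<in> S. killing x y = 0}" using B(1) B0 by auto
    ultimately have "span B \<subseteq> {y \<in> S. killing x y = 0}" by (intro span_minimal)
    then show "killing x y = 0" using y SB by auto
  qed
  have "inj_on T (span S)"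
  proof (rule inj_onI)
    fix x y assume xy: "x \<in> span S" "y \<in> span S" "T x = T y"
    then have "x - y \<in> S" using span_of_subspace[OF S] subspace_diff[OF S] by simp
    moreover have "T (x - y) = 0" using xy(3) by (simp add: endo_diff[OF T])
    ultimately have "x - y = 0" by (rule zero)
    then show "x = y" by simp
  qed
  then have "dim (T ` S) = dim S" by (rule pair.dim_image_eq[OF T])
  moreover have "subspace (T ` S)" by (rule subspace_endo_image[OF T S])
  ultimately have "T ` S = S" using TS by (intro subspace_dim_equal S) auto
  moreover have "(\<Sum>b\<in>B. \<phi> b *s b) \<in> S" using B(1) by (intro subspace_sum S subspace_scale) auto
  ultimately have "(\<Sum>b\<in>B. \<phi> b *s b) \<in> T ` S" by simp
  then obtain h where h: "h \<in> S" "T h = (\<Sum>b\<in>B. \<phi> b *s b)" by auto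
  have "killing h b = \<phi> b" if "b \<in> B" for b
  proof -
    have "(\<Sum>b\<in>B. (killing h b - \<phi> b) *s b) = 0"
      using h(2) by (simp add: T_def scale_left_diff_distrib sum_subtractf)
    then have "killing h b - \<phi> b = 0"
      using independentD[OF B(2) fin subset_refl _ that, of "\<lambda>b. killing h b - \<phi> b"] by simp
    then show ?thesis by simp
  qed
  then show ?thesis using h(1) agree by auto
qed

lemma endo_casimir_action: "endo (casimir_action n e e')"
  unfolding casimir_action_def by (intro endo_sums endo_comp[OF endo_br endo_br])

lemma dual_bases_exist:
  assumes S: "subspace S" and nondeg: "\<And>x. x \<in> S \<Longrightarrow> (\<And>y. y \<in> S \<Longrightarrow> killing x y = 0) \<Longrightarrow> x = 0"
  shows "\<exists>n e e'. dual_bases S n e e'"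
proof -
  obtain B where B: "B \<subseteq> S" "independent B" "S \<subseteq> span B" "card B = dim S"
    using basis_exists[of S] by metis
  have fin: "finite B" by (rule finiteI_independent[OF B(2)])
  have SB: "span B = S" using B(1,3) span_minimal[OF B(1) S] by auto
  define n where "n = card B"
  obtain e where e: "bij_betw e {..<n} B"
    using ex_bij_betw_nat_finite[OF fin] by (auto simp: n_def atLeast0LessThan)
  have inj: "inj_on e {..<n}" and img: "e ` {..<n} = B" using e by (auto simp: bij_betw_def)
  have "\<exists>h\<in>S. \<forall>x\<in>S. killing h x = representation B x (e j)" for j
    using S nondeg
    by (rule killing_represents)
      (simp_all add: representation_add representation_scale B(2) SB)
  then obtain e' where e': "\<And>j. e' j \<in> S" "\<And>j x. x \<in> S \<Longrightarrow> killing (e' j) x = representation B x (e j)"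
    by metis
  have dual: "killing (e i) (e' j) = (if i = j then 1 else 0)" if "i < n" "j < n" for i j
  proof -
    have "e i \<in> B" using img that by auto
    then have "killing (e' j) (e i) = (if e j = e i then 1 else 0)"
      using e'(2)[of "e i" j] B(1) representation_basis[OF B(2), of "e i"] by auto
    moreover have "e j = e i \<longleftrightarrow> i = j" using inj that by (auto simp: inj_on_def)
    ultimately show ?thesis by (simp add: killing_commute)
  qed
  have inj': "inj_on e' {..<n}"
  proof (rule inj_onI)
    fix i j assume ij: "i \<in> {..<n}" "j \<in> {..<n}" "e' i = e' j"
    then have "killing (e i) (e' i) = killing (e i) (e' j)" by simp
    then show "i = j" using dual[of i i] dual[of i j] ij by (auto split: if_splits)
  qed
  have ind': "independent (e' ` {..<n})"
  proof (rule independent_if_scalars_zero)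
    fix c x assume sum: "(\<Sum>x\<in>e' ` {..<n}. c x *s x) = 0" and "x \<in> e' ` {..<n}"
    then obtain i where i: "i < n" "x = e' i" by auto
    have "0 = killing (e i) (\<Sum>j<n. c (e' j) *s e' j)"
      using sum inj' by (simp add: sum.reindex linear_form_zero[OF linear_form_killing_right])
    also have "\<dots> = (\<Sum>j<n. c (e' j) * killing (e i) (e' j))"
      by (simp add: linear_form_sum[OF linear_form_killing_right] linear_form_scale[OF linear_form_killing_right])
    also have "\<dots> = (\<Sum>j<n. if j = i then c x else 0)"
      using i by (intro sum.cong refl) (simp add: dual)
    also have "\<dots> = c x" using i by simp
    finally show "c x = 0" by simp
  qed simp
  have "card (e' ` {..<n}) = dim S" using inj' B(4) by (simp add: card_image n_def)
  then have "S \<subseteq> span (e' ` {..<n})"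
    using e'(1) ind' by (intro card_ge_dim_independent) auto
  moreover have "span (e' ` {..<n}) \<subseteq> S" using e'(1) by (intro span_minimal S) auto
  ultimately have "dual_bases S n e e'"
    unfolding dual_bases_def using inj img B(2) SB inj' ind' dual by auto
  then show ?thesis by blast
qed

end

section \<open>Graded Lie algebras\<close>

locale graded_lie_algebra = lie_algebra scale Basis br + direct_sum scale Basis I V
  for scale :: "'k::field \<Rightarrow> 'g::ab_group_add \<Rightarrow> 'g" (infixr \<open>*s\<close> 75)
  and Basis br and I :: "'i::ab_group_add set" and V +
  assumes br_part: "x \<in> V i \<Longrightarrow> y \<in> V j \<Longrightarrow> br x y \<in> V (i + j)"
begin

lemma trace_decompose:
  "trace f = (\<Sum>i\<in>I. trace (\<lambda>x. proj i (f x)))"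
  using trace_sum[of "\<lambda>i x. proj i (f x)" I] by (simp add: sum_proj)

lemma trace_proj_right:
  assumes "endo f" shows "trace (\<lambda>x. proj i (f x)) = trace (\<lambda>x. proj i (f (proj i x)))"
proof -
  have "trace (\<lambda>x. proj i (proj i (f x))) = trace (\<lambda>x. proj i (f (proj i x)))"
    by (rule trace_comp_commute[OF endo_proj endo_comp[OF endo_proj assms]])
  then show ?thesis by (simp add: proj_proj)
qed

lemma trace_proj_cong:
  assumes "endo f" "endo g" "\<And>x. x \<in> V i \<Longrightarrow> proj i (f x) = proj i (g x)"
  shows "trace (\<lambda>x. proj i (f x)) = trace (\<lambda>x. proj i (g x))"
  by (simp add: trace_proj_right[OF assms(1)] trace_proj_right[OF assms(2)] assms(3)[OF proj_mem])

lemma trace_proj_zero: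
  assumes "endo f" "\<And>x. x \<in> V i \<Longrightarrow> proj i (f x) = 0"
  shows "trace (\<lambda>x. proj i (f x)) = 0"
  by (simp add: trace_proj_right[OF assms(1)] assms(2)[OF proj_mem] trace_zero)

lemma trace_proj: "trace (proj i) = of_nat (dim (V i))"
  by (rule trace_projector) (auto simp: endo_proj proj_mem proj_self subspace_part)

lemma proj_br:
  assumes "x \<in> V i" shows "proj (i + j) (br x z) = br x (proj j z)"
  by (rule proj_shift[OF endo_br, where \<sigma> = "\<lambda>j. i + j"]) (auto intro: br_part[OF assms])

lemma trace_shift:
  assumes "endo f" "\<And>i x. x \<in> V i \<Longrightarrow> f x \<in> V (k + i)" "k \<noteq> 0"
  shows "trace f = 0"
proof -
  have "trace (\<lambda>x. proj i (f x)) = 0" for i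
    using assms(3) by (intro trace_proj_zero[OF assms(1)]) (simp add: proj_part[OF assms(2)])
  then show ?thesis by (subst trace_decompose) simp
qed

lemma killing_orthogonal:
  assumes "x \<in> V i" "y \<in> V j" "i + j \<noteq> 0"
  shows "killing x y = 0"
  unfolding killing_def
proof (rule trace_shift[OF endo_comp[OF endo_br endo_br] _ assms(3)])
  fix k z assume "z \<in> V k"
  then have "br x (br y z) \<in> V (i + (j + k))" by (intro br_part assms)
  then show "br x (br y z) \<in> V (i + j + k)" by (simp add: add.assoc)
qed

text \<open>For \<open>x\<close> of degree \<open>k\<close> and \<open>y\<close> of degree \<open>-k\<close>, moving \<open>ad y\<close> around the trace turns the trace of
  \<open>ad y ad x\<close> on degree \<open>i\<close> into that of \<open>ad x ad y\<close> on degree \<open>i + k\<close>, which differs from the trace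
  of \<open>ad y ad x\<close> there by that of \<open>ad [x, y]\<close>.\<close>

lemma trace_step:
  assumes x: "x \<in> V k" and y: "y \<in> V (- k)"
  shows "trace (\<lambda>z. proj i (br y (br x z))) =
    trace (\<lambda>z. proj (i + k) (br y (br x z))) + trace (\<lambda>z. proj (i + k) (br (br x y) z))"
proof -
  have "proj i (br y (br x z)) = br y (proj (i + k) (br x z))" for z
    using proj_br[OF y, of "i + k"] by simp
  then have "trace (\<lambda>z. proj i (br y (br x z))) = trace (\<lambda>z. br y (proj (i + k) (br x z)))" by simp
  also have "\<dots> = trace (\<lambda>z. proj (i + k) (br x (br y z)))"
    by (rule trace_comp_commute[OF endo_br endo_comp[OF endo_proj endo_br]])
  also have "\<dots> = trace (\<lambda>z. proj (i + k) (br y (br x z)) + proj (i + k) (br (br x y) z))"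
    by (simp add: br_br_right[of x y] endo_add[OF endo_proj] add.commute)
  finally show ?thesis by (simp add: trace_add)
qed

text \<open>Either the summand of degree \<open>i\<close> is zero or \<open>ad x\<close> maps it into one that is.\<close>

lemma trace_step_zero:
  assumes x: "x \<in> V k" and y: "y \<in> V (- k)" and "i \<notin> I \<or> i + k \<notin> I"
  shows "trace (\<lambda>z. proj i (br y (br x z))) = 0"
proof (rule trace_proj_zero[OF endo_comp[OF endo_br endo_br]])
  fix z assume "z \<in> V i"
  then have "br x z \<in> V (k + i)" by (rule br_part[OF x])
  then have "z = 0 \<or> br x z = 0" using assms(3) \<open>z \<in> V i\<close> part_outside by (auto simp: add.commute)
  then show "proj i (br y (br x z)) = 0"
    by (auto simp: br_zero_right endo_zero[OF endo_proj])
qed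

text \<open>Used with powers of \<open>ad h - \<mu> h\<close>, this yields traces on generalized weight spaces.\<close>

lemma trace_proj_locally_nilpotent:
  assumes f: "endo f" "\<And>j x. x \<in> V j \<Longrightarrow> f x \<in> V j"
    and nil: "\<And>x. x \<in> V i \<Longrightarrow> \<exists>n. (f ^^ n) x = 0"
  shows "trace (\<lambda>x. proj i (f x)) = 0"
proof (rule trace_locally_nilpotent[OF endo_comp[OF endo_proj f(1)]])
  fix x
  have comm: "proj i (f z) = f (proj i z)" for z
    using proj_shift[OF f(1), where \<sigma> = "\<lambda>j. j"] f(2) by (simp add: inj_on_def)
  have stay: "proj i ((f ^^ n) (proj i x)) = (f ^^ n) (proj i x)" for n
    by (induct n) (simp_all add: comm proj_proj)
  have power: "((\<lambda>x. proj i (f x)) ^^ Suc n) x = (f ^^ Suc n) (proj i x)" for n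
    by (induct n) (simp_all add: comm stay)
  obtain n where "(f ^^ n) (proj i x) = 0" using nil proj_mem by metis
  then have "(f ^^ Suc n) (proj i x) = 0" by (simp add: endo_zero[OF f(1)])
  then show "\<exists>n. ((\<lambda>x. proj i (f x)) ^^ n) x = 0" using power by metis
qed

text \<open>The step from degree \<open>i\<close> to \<open>i + k\<close>, iterated along an arithmetic progression \<open>s 0, s 1, \<dots>\<close>.\<close>

lemma trace_telescope:
  assumes x: "x \<in> V k" and y: "y \<in> V (- k)" and s: "\<And>n. s (Suc n) = s n + k"
  shows "trace (\<lambda>z. proj (s 0) (br y (br x z))) =
    (\<Sum>n<N. trace (\<lambda>z. proj (s (Suc n)) (br (br x y) z))) +
    trace (\<lambda>z. proj (s N) (br y (br x z)))"
proof (induct N)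
  case (Suc N)
  then show ?case
    using trace_step[OF x y, of "s N"] by (simp add: s algebra_simps)
qed simp

lemma killing_degree_zero:
  assumes "y \<in> V 0" shows "killing x y = killing (proj 0 x) y"
proof -
  have "killing x y = (\<Sum>i\<in>I. killing (proj i x) y)"
    by (simp add: linear_form_sum[OF linear_form_killing, symmetric] sum_proj)
  also have "\<dots> = (\<Sum>i\<in>I. if i = 0 then killing (proj 0 x) y else 0)"
    using killing_orthogonal[OF proj_mem assms] by (intro sum.cong refl) auto
  also have "\<dots> = killing (proj 0 x) y"
    using finite_index part_outside[of 0] proj_mem[of 0 x]
    by (auto simp: linear_form_zero[OF linear_form_killing])
  finally show ?thesis .
qed

text \<open>By invariance \<open>K(C x, y) = \<Sum>j. K([y, [x, e j]], e' j)\<close>, and pairing with \<open>e' j\<close> reads off the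
  coefficient of \<open>e j\<close>.\<close>

lemma killing_casimir:
  assumes dual: "dual_bases (V 0) n e e'"
  shows "killing (casimir_action n e e' x) y = trace (\<lambda>z. proj 0 (br y (br x z)))"
proof -
  have inj: "inj_on e {..<n}" and ind: "independent (e ` {..<n})" and sp: "span (e ` {..<n}) = V 0"
    and sp': "span (e' ` {..<n}) = V 0"
    and K: "\<And>i j. i < n \<Longrightarrow> j < n \<Longrightarrow> killing (e i) (e' j) = (if i = j then 1 else 0)"
    using dual unfolding dual_bases_def by auto
  have e': "e' j \<in> V 0" if "j < n" for j
    unfolding sp'[symmetric] by (rule span_base) (use that in auto)
  have e: "e j \<in> V 0" if "j < n" for j
    unfolding sp[symmetric] by (rule span_base) (use that in auto)
  have expand: "(\<Sum>j<n. killing w (e' j) *s e j) = w" if "w \<in> V 0" for w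
  proof -
    let ?g = "\<lambda>w. (\<Sum>j<n. killing w (e' j) *s e j) - w"
    have "?g w = 0"
    proof (rule endo_span_zero[of ?g "e ` {..<n}" w])
      show "endo ?g"
        by (rule endoI) (simp_all add: killing_add_left killing_scale_left scale_left_distrib sum.distrib
            scale_sum_right scale_right_diff_distrib)
      show "w \<in> span (e ` {..<n})" using that sp by simp
      fix z assume "z \<in> e ` {..<n}"
      then obtain i where i: "i < n" "z = e i" by auto
      have "(\<Sum>j<n. killing (e i) (e' j) *s e j) = (\<Sum>j<n. if j = i then e i else 0)"
        using i by (intro sum.cong refl) (simp add: K)
      then show "?g z = 0" using i by simp
    qed
    then show ?thesis by simp
  qed
  let ?f = "\<lambda>z. br y (br x z)"
  have f: "endo ?f" by (rule endo_comp[OF endo_br endo_br])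
  have form: "linear_form (\<lambda>z. killing (?f z) (e' j))" for j
    by (rule linear_formI) (simp_all add: endo_add[OF f] endo_scale[OF f] killing_add_left killing_scale_left)
  have "proj 0 (?f z) = (\<Sum>j<n. killing (?f z) (e' j) *s e j)" for z
  proof -
    have "(\<Sum>j<n. killing (?f z) (e' j) *s e j) = (\<Sum>j<n. killing (proj 0 (?f z)) (e' j) *s e j)"
      by (intro sum.cong refl) (simp add: killing_degree_zero[OF e', of _ "?f z"])
    then show ?thesis using expand[OF proj_mem] by simp
  qed
  then have "trace (\<lambda>z. proj 0 (?f z)) = (\<Sum>j<n. killing (?f (e j)) (e' j))"
    by (simp add: trace_sum trace_rank_one[OF form])
  also have "\<dots> = (\<Sum>j<n. killing (br (e' j) (br (e j) x)) y)"
  proof (intro sum.cong refl)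
    fix j
    have "br (br (e j) x) y = br y (br x (e j))"
      by (simp add: br_antisym[of "e j" x] br_antisym[of "br x (e j)" y] br_minus_left)
    then show "killing (?f (e j)) (e' j) = killing (br (e' j) (br (e j) x)) y"
      by (simp only: killing_invariant[of "e' j"] killing_commute[of "e' j"])
  qed
  also have "\<dots> = killing (casimir_action n e e' x) y"
    by (simp add: casimir_action_def linear_form_sum[OF linear_form_killing])
  finally show ?thesis by simp
qed

end

section \<open>Generalized weight spaces of a nilpotent subalgebra\<close>

context lie_algebra
begin

text \<open>Induction along the Leibniz rule for \<open>ad h - (a + b)\<close>.\<close>

lemma eigenshift_br:
  assumes "(eigenshift (br h) a ^^ m) x = 0" "(eigenshift (br h) b ^^ n) y = 0"
  shows "(eigenshift (br h) (a + b) ^^ (m + n)) (br x y) = 0"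
  using assms
proof (induct "m + n" arbitrary: m n x y)
  case 0
  then show ?case by (simp add: br_zero_left)
next
  case (Suc k)
  note zero = endo_zero[OF endo_funpow[OF endo_eigenshift[OF endo_br]]]
  show ?case
  proof (cases "m = 0 \<or> n = 0")
    case True
    then have "br x y = 0" using Suc.prems by (auto simp: br_zero_left br_zero_right)
    then show ?thesis by (simp add: zero)
  next
    case False
    then obtain i j where ij: "m = Suc i" "n = Suc j" by (auto simp: gr0_conv_Suc)
    have k: "k = i + n" "k = m + j" using Suc.hyps(2) ij by auto
    have "eigenshift (br h) (a + b) (br x y) =
        br (eigenshift (br h) a x) y + br x (eigenshift (br h) b y)"
      by (simp add: eigenshift_def br_br_right[of h] br_diff_left br_diff_right br_scale_left
          br_scale_right algebra_simps)
    moreover have "(eigenshift (br h) (a + b) ^^ k) (br (eigenshift (br h) a x) y) = 0"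
      unfolding k(1)
    proof (rule Suc.hyps(1)[OF k(1)])
      show "(eigenshift (br h) a ^^ i) (eigenshift (br h) a x) = 0"
        using Suc.prems(1) by (simp add: ij(1) funpow_swap1)
    qed (rule Suc.prems(2))
    moreover have "(eigenshift (br h) (a + b) ^^ k) (br x (eigenshift (br h) b y)) = 0"
      unfolding k(2)
    proof (rule Suc.hyps(1)[OF k(2)])
      show "(eigenshift (br h) b ^^ j) (eigenshift (br h) b y) = 0"
        using Suc.prems(2) by (simp add: ij(2) funpow_swap1)
    qed (rule Suc.prems(1))
    moreover have "m + n = Suc k" using Suc.hyps(2) by simp
    ultimately show ?thesis
      by (simp add: funpow_Suc_right endo_add[OF endo_funpow[OF endo_eigenshift[OF endo_br]]]
          del: funpow.simps)
  qed
qed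

lemma gen_eigenspace_br:
  "x \<in> gen_eigenspace (br h) a \<Longrightarrow> y \<in> gen_eigenspace (br h) b \<Longrightarrow>
    br x y \<in> gen_eigenspace (br h) (a + b)"
  unfolding gen_eigenspace_def using eigenshift_br by blast

definition gen_weight_space :: "'g set \<Rightarrow> ('g \<Rightarrow> 'k) \<Rightarrow> 'g set"
  where "gen_weight_space t \<mu> = {x. \<forall>h\<in>t. x \<in> gen_eigenspace (br h) (\<mu> h)}"

lemma subspace_gen_weight_space: "subspace (gen_weight_space t \<mu>)"
proof -
  have "gen_weight_space t \<mu> = (\<Inter>h\<in>t. gen_eigenspace (br h) (\<mu> h))"
    by (auto simp: gen_weight_space_def)
  then show ?thesis by (simp add: subspace_Int subspace_gen_eigenspace endo_br)
qed

lemma br_gen_weight_space: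
  "x \<in> gen_weight_space t \<kappa> \<Longrightarrow> y \<in> gen_weight_space t \<mu> \<Longrightarrow>
    br x y \<in> gen_weight_space t (\<kappa> + \<mu>)"
  by (simp add: gen_weight_space_def gen_eigenspace_br)

lemma nilpotent_subset_gen_weight_space:
  assumes "lower_central t n = {0}"
  shows "t \<subseteq> gen_weight_space t 0"
proof
  fix x assume "x \<in> t"
  have "x \<in> gen_eigenspace (br h) 0" if "h \<in> t" for h
  proof -
    have "(br h ^^ m) x \<in> lower_central t m" for m
    proof (induct m)
      case (Suc m)
      then have "br h ((br h ^^ m) x) \<in> {br x y |x y. x \<in> t \<and> y \<in> lower_central t m}"
        using that by blast
      then show ?case by (simp add: span_base)
    qed (simp add: \<open>x \<in> t\<close>)
    from this[of n] have "(br h ^^ n) x = 0" using assms by simp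
    then show ?thesis unfolding gen_eigenspace_def eigenshift_def by auto
  qed
  then show "x \<in> gen_weight_space t 0" by (simp add: gen_weight_space_def)
qed

text \<open>A subspace on which every \<open>h \<in> t\<close> has a single eigenvalue lies in one weight space; any other
  splits into smaller \<open>t\<close>-stable pieces, the generalized eigenspaces of a suitable \<open>h\<close>.\<close>

lemma gen_weight_spaces_span:
  fixes t :: "'g set"
  assumes split: "\<And>p :: 'k poly. degree p > 0 \<Longrightarrow> \<exists>a. poly p a = 0"
    and nil: "t \<subseteq> gen_weight_space t 0"
    and "subspace U" "\<And>h x. h \<in> t \<Longrightarrow> x \<in> U \<Longrightarrow> br h x \<in> U"
  shows "U \<subseteq> span (\<Union>\<mu>\<in>{\<mu>. \<forall>h. h \<notin> t \<longrightarrow> \<mu> h = 0}. gen_weight_space t \<mu>)"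
  using assms(3,4)
proof (induct "dim U" arbitrary: U rule: less_induct)
  case less
  show ?case (is "U \<subseteq> span ?W")
  proof (cases "\<exists>h\<in>t. \<forall>c. \<not> U \<subseteq> gen_eigenspace (br h) c")
    case True
    then obtain h where h: "h \<in> t" "\<And>c. \<not> U \<subseteq> gen_eigenspace (br h) c" by auto
    have piece: "gen_eigenspace (br h) c \<inter> U \<subseteq> span ?W" for c
    proof (rule less.hyps)
      show sub: "subspace (gen_eigenspace (br h) c \<inter> U)"
        by (intro subspace_inter subspace_gen_eigenspace endo_br less.prems)
      show "dim (gen_eigenspace (br h) c \<inter> U) < dim U"
      proof (rule dim_psubset)
        have "gen_eigenspace (br h) c \<inter> U \<subset> U" using h(2)[of c] by auto
        then show "span (gen_eigenspace (br h) c \<inter> U) \<subset> span U"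
          by (simp only: span_of_subspace[OF sub] span_of_subspace[OF less.prems(1)])
      qed
      fix k x assume k: "k \<in> t" "x \<in> gen_eigenspace (br h) c \<inter> U"
      then have "k \<in> gen_eigenspace (br h) 0" using nil h(1) by (auto simp: gen_weight_space_def)
      then have "br k x \<in> gen_eigenspace (br h) (0 + c)" using k(2) by (intro gen_eigenspace_br) auto
      then show "br k x \<in> gen_eigenspace (br h) c \<inter> U" using k less.prems(2) by auto
    qed
    show ?thesis
    proof
      fix x assume "x \<in> U"
      then have "x \<in> span (\<Union>c. gen_eigenspace (br h) c \<inter> U)"
        using less.prems h(1) by (intro gen_eigenspaces_span[OF split endo_br]) auto
      also have "\<dots> \<subseteq> span ?W"
        using piece by (intro span_minimal subspace_span) auto
      finally show "x \<in> span ?W" .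
    qed
  next
    case False
    then have "\<forall>h\<in>t. \<exists>c. U \<subseteq> gen_eigenspace (br h) c" by simp
    then obtain \<mu> where \<mu>: "\<And>h. h \<in> t \<Longrightarrow> U \<subseteq> gen_eigenspace (br h) (\<mu> h)"
      by (metis (no_types, lifting))
    have "U \<subseteq> gen_weight_space t (\<lambda>h. if h \<in> t then \<mu> h else 0)"
      using \<mu> by (auto simp: gen_weight_space_def)
    also have "\<dots> \<subseteq> ?W" by (rule UN_upper) simp
    also have "\<dots> \<subseteq> span ?W" by (rule span_superset)
    finally show ?thesis .
  qed
qed

text \<open>The argument of Engel's theorem: among the ideals \<open>I\<close> of \<open>t\<close> that move some \<open>x \<notin> t\<close> of weight
  0 into \<open>t\<close>, a maximal one is all of \<open>t\<close>, because nilpotency of \<open>t\<close> provides \<open>h \<notin> I\<close> with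
  \<open>[t, h] \<subseteq> I\<close>, and then \<open>I + \<langle>h\<rangle>\<close> moves into \<open>t\<close> the last of the vectors
  \<open>x, [h, x], [h, [h, x]], \<dots>\<close> outside \<open>t\<close>.  So \<open>x\<close> would normalize \<open>t\<close>.\<close>

lemma cartan_subalgebra_zero_weight_space:
  assumes "cartan_subalgebra t"
  shows "gen_weight_space t 0 = t"
proof -
  define W where "W = gen_weight_space t 0"
  obtain n where n: "lower_central t n = {0}" using assms unfolding cartan_subalgebra_def by blast
  have norm: "{x. \<forall>y\<in>t. br x y \<in> t} = t"
    and sub: "subspace t" and brt: "\<And>x y. x \<in> t \<Longrightarrow> y \<in> t \<Longrightarrow> br x y \<in> t"
    using assms unfolding cartan_subalgebra_def lie_subalgebra_def by auto
  have tW: "t \<subseteq> W" unfolding W_def by (rule nilpotent_subset_gen_weight_space[OF n])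
  have subW: "subspace W" unfolding W_def by (rule subspace_gen_weight_space)
  have brW: "br x y \<in> W" if "x \<in> W" "y \<in> W" for x y
    using br_gen_weight_space[of x t 0 y 0] that by (simp add: W_def)
  have "W \<subseteq> t"
  proof (rule ccontr)
    assume "\<not> W \<subseteq> t"
    define P where "P I \<longleftrightarrow> subspace I \<and> I \<subseteq> t \<and> (\<forall>h\<in>t. \<forall>y\<in>I. br h y \<in> I) \<and>
      (\<exists>x\<in>W - t. \<forall>y\<in>I. br y x \<in> t)" for I
    have P0: "P {0}"
      using \<open>\<not> W \<subseteq> t\<close> subspace_0[OF sub] by (auto simp: P_def br_zero_right br_zero_left)
    have bound: "\<forall>I. P I \<longrightarrow> dim I < Suc dimension" using dim_subset_UNIV by (simp add: less_Suc_eq_le)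
    obtain I where I: "P I" "\<And>J. P J \<Longrightarrow> dim J \<le> dim I"
      using ex_has_greatest_nat[of P "{0}" dim, OF P0 bound] by auto
    have subI: "subspace I" and It: "I \<subseteq> t" and idI: "\<And>h y. h \<in> t \<Longrightarrow> y \<in> I \<Longrightarrow> br h y \<in> I"
      using I(1) by (auto simp: P_def)
    obtain x where x: "x \<in> W" "x \<notin> t" "\<And>y. y \<in> I \<Longrightarrow> br y x \<in> t" using I(1) by (auto simp: P_def)
    have "I = t"
    proof (rule ccontr)
      assume "I \<noteq> t"
      define k where "k = (LEAST k. lower_central t k \<subseteq> I)"
      have "lower_central t n \<subseteq> I" using n subspace_0[OF subI] by simp
      then have k: "lower_central t k \<subseteq> I" unfolding k_def by (rule LeastI)
      then have "k \<noteq> 0" using \<open>I \<noteq> t\<close> It by (cases k) auto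
      then obtain m where m: "k = Suc m" by (cases k) auto
      have "\<not> lower_central t m \<subseteq> I"
        using not_less_Least[of m "\<lambda>k. lower_central t k \<subseteq> I"] m by (simp add: k_def)
      then obtain h where h: "h \<in> lower_central t m" "h \<notin> I" by auto
      have "lower_central t j \<subseteq> t" for j
      proof (induct j)
        case (Suc j)
        then show ?case unfolding lower_central.simps
          by (intro span_minimal) (auto simp: sub intro: brt)
      qed simp
      then have ht: "h \<in> t" using h by auto
      have hI: "br y h \<in> I" if "y \<in> t" for y
      proof -
        have "br y h \<in> {br x y |x y. x \<in> t \<and> y \<in> lower_central t m}" using that h by blast
        then have "br y h \<in> lower_central t k" unfolding m by (simp add: span_base)
        then show ?thesis using k by auto
      qed
      define U where "U = {z \<in> W. \<forall>y\<in>I. br y z \<in> t}"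
      have stable: "br h z \<in> U" if "z \<in> U" for z
      proof -
        have "br h z \<in> W" using that tW ht brW by (auto simp: U_def)
        moreover have "br y (br h z) \<in> t" if y: "y \<in> I" for y
        proof -
          have "br y h \<in> I" using hI y It by auto
          then have "br (br y h) z \<in> t" using \<open>z \<in> U\<close> by (simp add: U_def)
          moreover have "br h (br y z) \<in> t" using \<open>z \<in> U\<close> y ht brt by (simp add: U_def)
          ultimately show ?thesis using br_br_right[of y h z] subspace_add[OF sub] by simp
        qed
        ultimately show ?thesis by (simp add: U_def)
      qed
      have U: "(br h ^^ j) x \<in> U" for j
      proof (induct j)
        case 0
        then show ?case using x by (simp add: U_def)
      qed (simp add: stable)
      have "x \<in> gen_eigenspace (br h) 0" using x(1) ht by (simp add: W_def gen_weight_space_def)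
      then obtain j where "(br h ^^ j) x = 0"
        unfolding gen_eigenspace_def eigenshift_def by auto
      then have j: "(br h ^^ j) x \<in> t" using subspace_0[OF sub] by simp
      define i where "i = (LEAST j. (br h ^^ j) x \<in> t)"
      have i: "(br h ^^ i) x \<in> t" unfolding i_def using j by (rule LeastI)
      then have "i \<noteq> 0" using x(2) by (cases i) auto
      then obtain l where l: "i = Suc l" by (cases i) auto
      have lt: "(br h ^^ l) x \<notin> t"
        using not_less_Least[of l "\<lambda>j. (br h ^^ j) x \<in> t"] l by (simp add: i_def)
      define J where "J = span (insert h I)"
      have J: "y \<in> J \<longleftrightarrow> (\<exists>c. y - c *s h \<in> I)" for y
        unfolding J_def span_breakdown_eq span_of_subspace[OF subI] ..
      have decomp: "y = (y - c *s h) + c *s h" for y c by simp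
      have "P J" unfolding P_def
      proof (intro conjI ballI)
        show "subspace J" by (simp add: J_def)
        show "J \<subseteq> t" unfolding J_def using It ht by (intro span_minimal sub) auto
        show "br y w \<in> J" if y: "y \<in> t" and w: "w \<in> J" for y w
        proof -
          obtain c where c: "w - c *s h \<in> I" using J w by auto
          have "br y w = br y (w - c *s h) + c *s br y h"
            by (subst decomp[of w c]) (simp only: br_add_right br_scale_right)
          then have "br y w \<in> I"
            using idI[OF y c] hI[OF y] subspace_add[OF subI] subspace_scale[OF subI] by simp
          then show ?thesis unfolding J_def by (intro span_base) simp
        qed
        have "br y ((br h ^^ l) x) \<in> t" if y: "y \<in> J" for y
        proof -
          obtain c where c: "y - c *s h \<in> I" using J y by auto
          have "br y ((br h ^^ l) x) = br (y - c *s h) ((br h ^^ l) x) + c *s br h ((br h ^^ l) x)"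
            by (subst decomp[of y c]) (simp only: br_add_left br_scale_left)
          moreover have "br h ((br h ^^ l) x) \<in> t" using i unfolding l by simp
          moreover have "br (y - c *s h) ((br h ^^ l) x) \<in> t" using U[of l] c by (simp add: U_def)
          ultimately show ?thesis using subspace_add[OF sub] subspace_scale[OF sub] by simp
        qed
        moreover have "(br h ^^ l) x \<in> W - t" using U[of l] lt by (simp add: U_def)
        ultimately show "\<exists>x\<in>W - t. \<forall>y\<in>J. br y x \<in> t" by (intro bexI) auto
      qed
      then have "dim J \<le> dim I" by (rule I(2))
      moreover have "dim I < dim J"
      proof (rule dim_psubset)
        have "h \<in> J" unfolding J_def by (intro span_base) simp
        moreover have "I \<subseteq> J" unfolding J_def using span_superset[of "insert h I"] by auto
        ultimately have "I \<subset> J" using h(2) by auto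
        moreover have "span I = I" "span J = J" using subI by (simp_all only: J_def span_of_subspace subspace_span)
        ultimately show "span I \<subset> span J" by (simp only:)
      qed
      ultimately show False by simp
    qed
    then have "br x y \<in> t" if "y \<in> t" for y
      using x(3)[of y] that subspace_neg[OF sub] by (subst br_antisym) simp
    then have "x \<in> t" using norm by blast
    then show False using x(2) by simp
  qed
  then show ?thesis using tW by (simp add: W_def)
qed

end

section \<open>The weight decomposition\<close>

locale cartan_decomposition = simple_lie_with_cartan scale Basis br t
  for scale :: "'k::{alg_closed_field, field_char_0} \<Rightarrow> 'g::ab_group_add \<Rightarrow> 'g" (infixr \<open>*s\<close> 75)
  and Basis br t
begin

lemma subspace_t: "subspace t"
  using cartan unfolding cartan_subalgebra_def lie_subalgebra_def by blast

text \<open>Weights are extended by zero outside \<open>t\<close>, so that they are determined by their values on \<open>t\<close>.\<close>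

definition V :: "('g \<Rightarrow> 'k) \<Rightarrow> 'g set"
  where "V \<mu> = (if \<forall>h. h \<notin> t \<longrightarrow> \<mu> h = 0 then gen_weight_space t \<mu> else {0})"

definition weights :: "('g \<Rightarrow> 'k) set"
  where "weights = {\<mu>. V \<mu> \<noteq> {0}}"

lemma subspace_V: "subspace (V \<mu>)"
  by (simp add: V_def subspace_gen_weight_space)

lemma V_zero: "V 0 = t"
  by (simp add: V_def cartan_subalgebra_zero_weight_space[OF cartan])

lemma br_V: "x \<in> V \<kappa> \<Longrightarrow> y \<in> V \<mu> \<Longrightarrow> br x y \<in> V (\<kappa> + \<mu>)"
proof (cases "(\<forall>h. h \<notin> t \<longrightarrow> \<kappa> h = 0) \<and> (\<forall>h. h \<notin> t \<longrightarrow> \<mu> h = 0)")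
  case True
  then show "x \<in> V \<kappa> \<Longrightarrow> y \<in> V \<mu> \<Longrightarrow> br x y \<in> V (\<kappa> + \<mu>)"
    by (simp add: V_def br_gen_weight_space)
next
  case False
  then show "x \<in> V \<kappa> \<Longrightarrow> y \<in> V \<mu> \<Longrightarrow> br x y \<in> V (\<kappa> + \<mu>)"
    using subspace_0[OF subspace_V[of "\<kappa> + \<mu>"]] unfolding V_def[of \<kappa>] V_def[of \<mu>]
    by (auto simp: br_zero_left br_zero_right split: if_splits)
qed

lemma br_t_V: "h \<in> t \<Longrightarrow> x \<in> V \<mu> \<Longrightarrow> br h x \<in> V \<mu>"
  using br_V[of h 0 x \<mu>] by (simp add: V_zero)

lemma weight_outside: "\<mu> \<in> weights \<Longrightarrow> h \<notin> t \<Longrightarrow> \<mu> h = 0"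
  by (auto simp: weights_def V_def split: if_splits)

lemma eigenshift_V_stable: "h \<in> t \<Longrightarrow> x \<in> V \<mu> \<Longrightarrow> eigenshift (br h) a x \<in> V \<mu>"
  unfolding eigenshift_def by (intro subspace_diff subspace_scale subspace_V br_t_V)

lemma eigenshift_V_nilpotent:
  assumes "h \<in> t" "x \<in> V \<mu>" shows "\<exists>n. (eigenshift (br h) (\<mu> h) ^^ n) x = 0"
proof (cases "\<forall>h. h \<notin> t \<longrightarrow> \<mu> h = 0")
  case True
  then show ?thesis using assms by (auto simp: V_def gen_weight_space_def gen_eigenspace_def)
next
  case False
  then have "V \<mu> = {0}" by (simp only: V_def if_not_P if_False)
  then have "(eigenshift (br h) (\<mu> h) ^^ 0) x = 0" using assms(2) by simp
  then show ?thesis by blast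
qed

lemma V_span: "span (\<Union>\<mu>. V \<mu>) = UNIV"
proof -
  have "UNIV \<subseteq> span (\<Union>\<mu>\<in>{\<mu>. \<forall>h. h \<notin> t \<longrightarrow> \<mu> h = 0}. gen_weight_space t \<mu>)"
  proof (rule gen_weight_spaces_span)
    show "\<exists>a. poly p a = 0" if "degree p > 0" for p :: "'k poly"
      using alg_closed_imp_poly_has_root[OF that] by auto
    show "t \<subseteq> gen_weight_space t 0" by (simp add: cartan_subalgebra_zero_weight_space[OF cartan])
  qed auto
  also have "\<dots> \<subseteq> span (\<Union>\<mu>. V \<mu>)" by (intro span_mono) (auto simp: V_def)
  finally show ?thesis by auto
qed

text \<open>Two different weights differ at some \<open>h \<in> t\<close>; a power of \<open>ad h - \<nu> h\<close> removes the component of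
  weight \<open>\<nu>\<close> and is injective on the other weight space.\<close>

lemma V_independent:
  assumes "finite F" "\<And>\<mu>. v \<mu> \<in> V \<mu>" "(\<Sum>\<mu>\<in>F. v \<mu>) = 0" "\<mu> \<in> F"
  shows "v \<mu> = 0"
  using assms
proof (induct F arbitrary: v \<mu> rule: finite_induct)
  case (insert \<nu> F)
  have F0: "v \<mu> = 0" if \<mu>: "\<mu> \<in> F" for \<mu>
  proof (rule ccontr)
    assume "v \<mu> \<noteq> 0"
    then have \<mu>0: "\<mu> h = 0" if "h \<notin> t" for h
      using insert.prems(1)[of \<mu>] that by (auto simp: V_def split: if_splits)
    show False
    proof (cases "v \<nu> = 0")
      case True
      then have "(\<Sum>\<mu>\<in>F. v \<mu>) = 0" using insert.prems(2) insert.hyps by simp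
      then show False using insert.hyps(3)[OF insert.prems(1)] \<mu> \<open>v \<mu> \<noteq> 0\<close> by simp
    next
      case False
      then have \<nu>0: "\<nu> h = 0" if "h \<notin> t" for h
        using insert.prems(1)[of \<nu>] that by (auto simp: V_def split: if_splits)
      have "\<mu> \<noteq> \<nu>" using \<mu> insert.hyps by auto
      then obtain h where h: "\<mu> h \<noteq> \<nu> h" by auto
      then have ht: "h \<in> t" using \<mu>0 \<nu>0 by metis
      obtain n where n: "(eigenshift (br h) (\<nu> h) ^^ n) (v \<nu>) = 0"
        using eigenshift_V_nilpotent[OF ht insert.prems(1)] by auto
      let ?A = "eigenshift (br h) (\<nu> h) ^^ n"
      have A: "endo ?A" by (intro endo_funpow endo_eigenshift endo_br)
      have "?A (v \<mu>) = 0"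
      proof (rule insert.hyps(3)[of "\<lambda>\<mu>. ?A (v \<mu>)" \<mu>])
        have "(eigenshift (br h) (\<nu> h) ^^ m) (v \<kappa>) \<in> V \<kappa>" for m \<kappa>
          by (induct m) (simp_all add: insert.prems(1) eigenshift_V_stable ht)
        then show "?A (v \<kappa>) \<in> V \<kappa>" for \<kappa> .
        have "?A (\<Sum>\<kappa>\<in>insert \<nu> F. v \<kappa>) = 0" unfolding insert.prems(2) by (rule endo_zero[OF A])
        then show "(\<Sum>\<kappa>\<in>F. ?A (v \<kappa>)) = 0"
          using insert.hyps n by (simp add: endo_add[OF A] endo_sum[OF A])
      qed (rule \<mu>)
      moreover have "v \<mu> \<in> gen_eigenspace (br h) (\<mu> h)"
        using eigenshift_V_nilpotent[OF ht insert.prems(1)] by (simp add: gen_eigenspace_def)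
      ultimately have "v \<mu> = 0"
        using eigenshift_inj_on[OF endo_br] h by metis
      then show False using \<open>v \<mu> \<noteq> 0\<close> by simp
    qed
  qed
  then have "v \<nu> = 0" using insert.prems(2) insert.hyps by simp
  then show ?case using F0 insert.prems(3) by auto
qed simp

text \<open>Each vector involves finitely many weights, and those of the basis vectors suffice for all.\<close>

lemma V_sum_exists:
  "\<exists>F. finite F \<and> (\<forall>x. \<exists>v. (\<forall>\<mu>. v \<mu> \<in> V \<mu>) \<and> x = (\<Sum>\<mu>\<in>F. v \<mu>))"
proof -
  define Z where "Z F = {x. \<exists>v. (\<forall>\<mu>. v \<mu> \<in> V \<mu>) \<and> x = (\<Sum>\<mu>\<in>F. v \<mu>)}" for F
  have subZ: "subspace (Z F)" for F
  proof (rule subspaceI)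
    show "0 \<in> Z F" unfolding Z_def using subspace_0[OF subspace_V] by (auto intro!: exI[of _ "\<lambda>_. 0"])
  next
    fix x y assume "x \<in> Z F" "y \<in> Z F"
    then obtain v w where "\<forall>\<mu>. v \<mu> \<in> V \<mu>" "\<forall>\<mu>. w \<mu> \<in> V \<mu>" "x = (\<Sum>\<mu>\<in>F. v \<mu>)" "y = (\<Sum>\<mu>\<in>F. w \<mu>)"
      by (auto simp: Z_def)
    then show "x + y \<in> Z F" unfolding Z_def
      by (auto intro!: exI[of _ "\<lambda>\<mu>. v \<mu> + w \<mu>"] subspace_add[OF subspace_V] simp: sum.distrib)
  next
    fix c x assume "x \<in> Z F"
    then obtain v where "\<forall>\<mu>. v \<mu> \<in> V \<mu>" "x = (\<Sum>\<mu>\<in>F. v \<mu>)" by (auto simp: Z_def)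
    then show "c *s x \<in> Z F" unfolding Z_def
      by (auto intro!: exI[of _ "\<lambda>\<mu>. c *s v \<mu>"] subspace_scale[OF subspace_V] simp: scale_sum_right)
  qed
  have "\<exists>A. finite A \<and> A \<subseteq> (\<Union>\<mu>. V \<mu>) \<and> b \<in> span A" for b
  proof -
    have "b \<in> span (\<Union>\<mu>. V \<mu>)" by (simp add: V_span)
    then obtain A r where "finite A" "A \<subseteq> (\<Union>\<mu>. V \<mu>)" "b = (\<Sum>a\<in>A. r a *s a)"
      unfolding span_explicit by blast
    moreover from this have "b \<in> span A" by (auto intro: span_sum span_scale span_base)
    ultimately show ?thesis by blast
  qed
  then obtain A where A: "\<And>b. finite (A b)" "\<And>b. A b \<subseteq> (\<Union>\<mu>. V \<mu>)" "\<And>b. b \<in> span (A b)" by metis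
  let ?A = "\<Union>b\<in>Basis. A b"
  have "\<forall>a\<in>?A. \<exists>\<mu>. a \<in> V \<mu>" using A(2) by blast
  then obtain \<mu> where \<mu>: "\<And>a. a \<in> ?A \<Longrightarrow> a \<in> V (\<mu> a)" by metis
  have fin: "finite (\<mu> ` ?A)" using A(1) finite_Basis by simp
  have "?A \<subseteq> Z (\<mu> ` ?A)"
  proof
    fix a assume a: "a \<in> ?A"
    then have "a = (\<Sum>\<kappa>\<in>\<mu> ` ?A. if \<kappa> = \<mu> a then a else 0)" using fin by (subst sum.delta) auto
    then show "a \<in> Z (\<mu> ` ?A)" unfolding Z_def
      using \<mu>[OF a] subspace_0[OF subspace_V] by (intro CollectI exI[of _ "\<lambda>\<kappa>. if \<kappa> = \<mu> a then a else 0"]) auto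
  qed
  then have "span ?A \<subseteq> Z (\<mu> ` ?A)" by (rule span_minimal[OF _ subZ])
  moreover have "b \<in> span ?A" if "b \<in> Basis" for b
    using A(3)[of b] span_mono[of "A b" ?A] that by auto
  ultimately have "Basis \<subseteq> Z (\<mu> ` ?A)" by auto
  then have "span Basis \<subseteq> Z (\<mu> ` ?A)" by (rule span_minimal[OF _ subZ])
  then have "\<forall>x. x \<in> Z (\<mu> ` ?A)" by (auto simp: span_Basis)
  then show ?thesis using fin unfolding Z_def by blast
qed

lemma weight_vector_exists: "\<mu> \<in> weights \<Longrightarrow> \<exists>x\<in>V \<mu>. x \<noteq> 0"
  using subspace_0[OF subspace_V[of \<mu>]] by (auto simp: weights_def)

lemma finite_weights: "finite weights"
  and weights_exhaust: "\<exists>v. (\<forall>\<mu>. v \<mu> \<in> V \<mu>) \<and> x = (\<Sum>\<mu>\<in>weights. v \<mu>)"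
proof -
  obtain F where F: "finite F" "\<forall>x. \<exists>v. (\<forall>\<mu>. v \<mu> \<in> V \<mu>) \<and> x = (\<Sum>\<mu>\<in>F. v \<mu>)"
    using V_sum_exists by auto
  have sub: "weights \<subseteq> F"
  proof (rule ccontr)
    assume "\<not> weights \<subseteq> F"
    then obtain \<mu> where \<mu>: "\<mu> \<in> weights" "\<mu> \<notin> F" by auto
    then obtain x where x: "x \<in> V \<mu>" "x \<noteq> 0"
      using weight_vector_exists[OF \<mu>(1)] by blast
    obtain v where v: "\<forall>\<mu>. v \<mu> \<in> V \<mu>" "x = (\<Sum>\<mu>\<in>F. v \<mu>)" using F(2) by metis
    let ?w = "\<lambda>\<kappa>. if \<kappa> = \<mu> then - x else v \<kappa>"
    have "?w \<mu> = 0"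
    proof (rule V_independent[of "insert \<mu> F" ?w \<mu>])
      show "finite (insert \<mu> F)" using F by simp
      show "?w \<kappa> \<in> V \<kappa>" for \<kappa> using v x subspace_neg[OF subspace_V] by simp
      have "(\<Sum>\<kappa>\<in>F. ?w \<kappa>) = x" unfolding v(2) using \<mu>(2) by (intro sum.cong) auto
      then show "(\<Sum>\<kappa>\<in>insert \<mu> F. ?w \<kappa>) = 0" using F(1) \<mu>(2) by simp
    qed simp
    then show False using x by simp
  qed
  then show "finite weights" using F(1) by (rule finite_subset)
  obtain v where v: "\<forall>\<mu>. v \<mu> \<in> V \<mu>" "x = (\<Sum>\<mu>\<in>F. v \<mu>)" using F(2) by metis
  have "(\<Sum>\<mu>\<in>F. v \<mu>) = (\<Sum>\<mu>\<in>weights. v \<mu>)"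
    using sub F(1) v(1) by (intro sum.mono_neutral_right) (auto simp: weights_def)
  then show "\<exists>v. (\<forall>\<mu>. v \<mu> \<in> V \<mu>) \<and> x = (\<Sum>\<mu>\<in>weights. v \<mu>)" using v by auto
qed

sublocale wt: graded_lie_algebra scale Basis br weights V
proof
  show "finite weights" by (rule finite_weights)
  show "subspace (V i)" for i by (rule subspace_V)
  show "i \<notin> weights \<Longrightarrow> V i = {0}" for i by (simp add: weights_def)
  show "\<exists>v. (\<forall>i. v i \<in> V i) \<and> x = sum v weights" for x by (rule weights_exhaust)
  show "v i = 0" if "\<And>i. v i \<in> V i" "sum v weights = 0" for v i
    using V_independent[OF finite_weights that] that(1)[of i]
    by (cases "i \<in> weights") (auto simp: weights_def)
  show "x \<in> V i \<Longrightarrow> y \<in> V j \<Longrightarrow> br x y \<in> V (i + j)" for x y i j by (rule br_V)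
qed

section \<open>Nondegeneracy of the Killing form\<close>

definition mult :: "('g \<Rightarrow> 'k) \<Rightarrow> nat"
  where "mult \<mu> = dim (V \<mu>)"

lemma mult_eq_0_iff: "mult \<mu> = 0 \<longleftrightarrow> \<mu> \<notin> weights"
proof -
  have "dim (V \<mu>) = 0 \<longleftrightarrow> V \<mu> \<subseteq> {0}" by (rule dim_eq_0)
  then show ?thesis using subspace_0[OF subspace_V[of \<mu>]] by (auto simp: mult_def weights_def)
qed

lemma trace_proj_wt: "trace (wt.proj \<mu>) = of_nat (mult \<mu>)"
  by (simp add: mult_def wt.trace_proj)

lemma trace_weight:
  assumes "h \<in> t" shows "trace (\<lambda>x. wt.proj \<mu> (br h x)) = of_nat (mult \<mu>) * \<mu> h"
proof -
  have "trace (\<lambda>x. wt.proj \<mu> (eigenshift (br h) (\<mu> h) x)) = 0"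
    using assms
    by (intro wt.trace_proj_locally_nilpotent endo_eigenshift endo_br eigenshift_V_stable
        eigenshift_V_nilpotent)
  then show ?thesis
    by (simp add: eigenshift_def endo_diff[OF wt.endo_proj] endo_scale[OF wt.endo_proj] trace_diff
        trace_scale trace_proj_wt mult.commute)
qed

lemma trace_weight_square:
  assumes "h \<in> t"
  shows "trace (\<lambda>x. wt.proj \<mu> (br h (br h x))) = of_nat (mult \<mu>) * (\<mu> h)\<^sup>2"
proof -
  let ?D = "eigenshift (br h) (\<mu> h)"
  have D: "endo ?D" by (intro endo_eigenshift endo_br)
  have "trace (\<lambda>x. wt.proj \<mu> (?D (?D x))) = 0"
  proof (rule wt.trace_proj_locally_nilpotent[OF endo_comp[OF D D]])
    show "?D (?D x) \<in> V j" if "x \<in> V j" for j x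
      by (intro eigenshift_V_stable assms that)
    fix x assume "x \<in> V \<mu>"
    then obtain n where n: "(?D ^^ n) x = 0" using eigenshift_V_nilpotent[OF assms] by metis
    have "((\<lambda>x. ?D (?D x)) ^^ n) x = (?D ^^ (2 * n)) x" for n
      by (induct n) simp_all
    then have "((\<lambda>x. ?D (?D x)) ^^ n) x = 0"
      using funpow_zero_mono[OF D n, of "2 * n"] by simp
    then show "\<exists>n. ((\<lambda>x. ?D (?D x)) ^^ n) x = 0" by blast
  qed
  moreover have "wt.proj \<mu> (?D (?D x)) = (wt.proj \<mu> (br h (br h x)) - (2 * \<mu> h) *s wt.proj \<mu> (br h x))
      + (\<mu> h)\<^sup>2 *s wt.proj \<mu> x" for x
  proof -
    have "?D (?D x) = (br h (br h x) - (2 * \<mu> h) *s br h x) + (\<mu> h)\<^sup>2 *s x"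
      by (simp add: eigenshift_def br_diff_right br_scale_right algebra_simps power2_eq_square
          scale_left_distrib[symmetric])
    then show ?thesis
      by (simp add: endo_add[OF wt.endo_proj] endo_diff[OF wt.endo_proj] endo_scale[OF wt.endo_proj])
  qed
  ultimately show ?thesis
    by (simp add: trace_add trace_diff trace_scale trace_weight[OF assms] trace_proj_wt
        power2_eq_square algebra_simps)
qed

text \<open>The product of \<open>\<mu> h\<close> with the multiplicity is a trace, hence linear in \<open>h\<close>, and the multiplicity
  can be cancelled in characteristic 0.\<close>

lemma weight_linear:
  assumes "\<mu> \<in> weights"
  shows "h \<in> t \<Longrightarrow> k \<in> t \<Longrightarrow> \<mu> (h + k) = \<mu> h + \<mu> k"
    and "h \<in> t \<Longrightarrow> \<mu> (c *s h) = c * \<mu> h"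
proof -
  have nz: "(of_nat (mult \<mu>) :: 'k) \<noteq> 0" using assms mult_eq_0_iff by auto
  show "\<mu> (h + k) = \<mu> h + \<mu> k" if "h \<in> t" "k \<in> t"
  proof -
    have "of_nat (mult \<mu>) * \<mu> (h + k) = of_nat (mult \<mu>) * \<mu> h + of_nat (mult \<mu>) * \<mu> k"
      using that subspace_add[OF subspace_t that]
      by (simp add: trace_weight[symmetric] br_add_left endo_add[OF wt.endo_proj] trace_add)
    then have "of_nat (mult \<mu>) * \<mu> (h + k) = of_nat (mult \<mu>) * (\<mu> h + \<mu> k)"
      by (simp add: distrib_left)
    then show ?thesis using nz by simp
  qed
  show "\<mu> (c *s h) = c * \<mu> h" if "h \<in> t"
  proof -
    have "of_nat (mult \<mu>) * \<mu> (c *s h) = c * (of_nat (mult \<mu>) * \<mu> h)"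
      using that subspace_scale[OF subspace_t that]
      by (simp add: trace_weight[symmetric] br_scale_left endo_scale[OF wt.endo_proj] trace_scale)
    then have "of_nat (mult \<mu>) * \<mu> (c *s h) = of_nat (mult \<mu>) * (c * \<mu> h)"
      by (simp add: mult.left_commute)
    then show ?thesis using nz by simp
  qed
qed

lemma weights_cartan_dual: "\<mu> \<in> weights \<Longrightarrow> \<mu> \<in> cartan_dual"
  by (simp add: cartan_dual_def weight_linear weight_outside)

lemma killing_t_square: "h \<in> t \<Longrightarrow> killing h h = (\<Sum>\<mu>\<in>weights. of_nat (mult \<mu>) * (\<mu> h)\<^sup>2)"
  unfolding killing_def by (subst wt.trace_decompose) (simp add: trace_weight_square)

lemma killing_t:
  assumes "h \<in> t" "k \<in> t"
  shows "killing h k = (\<Sum>\<mu>\<in>weights. of_nat (mult \<mu>) * (\<mu> h * \<mu> k))"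
proof -
  note r = linear_form_add[OF linear_form_killing_right]
  have "killing (h + k) (h + k) = killing h h + 2 * killing h k + killing k k"
    by (simp add: killing_add_left r killing_commute[of k h])
  moreover have "killing (h + k) (h + k) = (\<Sum>\<mu>\<in>weights. of_nat (mult \<mu>) * (\<mu> h + \<mu> k)\<^sup>2)"
    using assms by (simp add: killing_t_square subspace_add[OF subspace_t] weight_linear)
  moreover have "(\<Sum>\<mu>\<in>weights. of_nat (mult \<mu>) * (\<mu> h + \<mu> k)\<^sup>2) =
      (\<Sum>\<mu>\<in>weights. of_nat (mult \<mu>) * (\<mu> h)\<^sup>2) + 2 * (\<Sum>\<mu>\<in>weights. of_nat (mult \<mu>) * (\<mu> h * \<mu> k)) +
      (\<Sum>\<mu>\<in>weights. of_nat (mult \<mu>) * (\<mu> k)\<^sup>2)"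
    by (simp add: sum_distrib_left sum.distrib[symmetric] power2_eq_square algebra_simps)
  ultimately have "2 * killing h k = 2 * (\<Sum>\<mu>\<in>weights. of_nat (mult \<mu>) * (\<mu> h * \<mu> k))"
    using assms by (simp add: killing_t_square)
  then show ?thesis by simp
qed

lemma progression_leaves_weights:
  assumes "\<nu> \<noteq> 0"
  shows "\<exists>N. \<forall>n\<ge>N. \<mu> + scale_fun (of_nat n) \<nu> \<notin> weights \<and> \<mu> - scale_fun (of_nat n) \<nu> \<notin> weights"
proof -
  obtain h where h: "\<nu> h \<noteq> 0" using assms by (auto simp: fun_eq_iff)
  have "inj (\<lambda>n::nat. \<mu> + scale_fun (of_nat n) \<nu>)" "inj (\<lambda>n::nat. \<mu> - scale_fun (of_nat n) \<nu>)"
    using h by (auto intro!: injI dest!: fun_cong[of _ _ h] simp: scale_fun_def)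
  then have "finite ((\<lambda>n::nat. \<mu> + scale_fun (of_nat n) \<nu>) -` weights \<union>
      (\<lambda>n::nat. \<mu> - scale_fun (of_nat n) \<nu>) -` weights)" (is "finite ?S")
    using finite_weights by (simp add: finite_vimageI)
  then obtain N where N: "?S \<subseteq> {..<N}" using finite_nat_bounded by blast
  show ?thesis
  proof (intro exI allI impI)
    fix n assume "N \<le> n"
    then have "n \<notin> ?S" using N by auto
    then show "\<mu> + scale_fun (of_nat n) \<nu> \<notin> weights \<and> \<mu> - scale_fun (of_nat n) \<nu> \<notin> weights" by simp
  qed
qed

lemma br_opposite_in_t: "x \<in> V \<nu> \<Longrightarrow> y \<in> V (- \<nu>) \<Longrightarrow> br x y \<in> t"
  using br_V[of x \<nu> y "- \<nu>"] by (simp add: V_zero)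

text \<open>Telescoping from \<open>s 0\<close> to \<open>s N\<close>: both end terms vanish, because \<open>ad x\<close> starts from the zero space
  at \<open>s 0\<close> and arrives in the zero space after \<open>s N\<close>.\<close>

lemma string_trace:
  assumes x: "x \<in> V \<nu>" and y: "y \<in> V (- \<nu>)"
    and s: "\<And>n. s (Suc n) = s n + \<nu>" and ends: "s 0 \<notin> weights" "s (Suc N) \<notin> weights"
  shows "(\<Sum>n<N. of_nat (mult (s (Suc n))) * s (Suc n) (br x y)) = 0"
proof -
  note h = br_opposite_in_t[OF x y]
  have "trace (\<lambda>z. wt.proj (s 0) (br y (br x z))) = 0"
    by (rule wt.trace_step_zero[OF x y]) (simp add: ends)
  moreover have "trace (\<lambda>z. wt.proj (s N) (br y (br x z))) = 0"
    by (rule wt.trace_step_zero[OF x y]) (simp add: ends s[symmetric])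
  ultimately show ?thesis
    using wt.trace_telescope[OF x y, where s = s and N = N] s by (simp add: trace_weight[OF h])
qed

text \<open>For \<open>h = [x, y]\<close> the vanishing of \<open>\<Sum>n. m n * (\<mu> + n \<nu>) h\<close>, with \<open>m n\<close> the multiplicity of
  \<open>\<mu> + n \<nu>\<close>, expresses \<open>\<mu> h\<close> as a rational multiple of \<open>\<nu> h\<close>.  Gaps in the string do no harm,
  as they contribute multiplicity zero.\<close>

lemma weight_rational_on_bracket:
  assumes x: "x \<in> V \<nu>" and y: "y \<in> V (- \<nu>)" and \<mu>: "\<mu> \<in> weights"
  shows "\<exists>r. \<mu> (br x y) = of_rat r * \<nu> (br x y)"
proof (cases "\<nu> = 0")
  case True
  note h = br_opposite_in_t[OF x y]
  have "trace (\<lambda>z. wt.proj \<mu> (br (br x y) z)) = 0"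
    using wt.trace_step[OF x y, of \<mu>] True by simp
  then have "of_nat (mult \<mu>) * \<mu> (br x y) = 0" by (simp add: trace_weight[OF h])
  then have "\<mu> (br x y) = 0" using \<mu> mult_eq_0_iff by simp
  then show ?thesis by (intro exI[of _ 0]) simp
next
  case False
  obtain N where N: "\<And>n. n \<ge> N \<Longrightarrow>
      \<mu> + scale_fun (of_nat n) \<nu> \<notin> weights \<and> \<mu> - scale_fun (of_nat n) \<nu> \<notin> weights"
    using progression_leaves_weights[OF False] by metis
  \<comment> \<open>the string through \<open>\<mu>\<close>, extended beyond both of its ends\<close>
  define s where "s n = \<mu> + scale_fun (of_nat n - of_nat (Suc N)) \<nu>" for n
  have step: "s (Suc n) = s n + \<nu>" for n
    by (simp add: s_def scale_fun_def fun_eq_iff algebra_simps)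
  have s0: "s 0 = \<mu> - scale_fun (of_nat (Suc N)) \<nu>"
    by (simp add: s_def scale_fun_def fun_eq_iff algebra_simps)
  have s2: "s (Suc (2 * N + 1)) = \<mu> + scale_fun (of_nat (Suc N)) \<nu>"
    by (simp add: s_def scale_fun_def fun_eq_iff algebra_simps)
  define m where "m n = mult (s (Suc n))" for n
  define A where "A = (\<Sum>n<2 * N + 1. m n)"
  define B where "B = (\<Sum>n<2 * N + 1. int (m n) * (int n - int N))"
  let ?h = "br x y"
  have sN: "s (Suc N) = \<mu>" by (simp add: s_def scale_fun_def fun_eq_iff)
  have "m N \<le> A" unfolding A_def by (rule member_le_sum) auto
  moreover have "m N > 0" using \<mu> mult_eq_0_iff by (auto simp: m_def sN)
  ultimately have A: "A > 0" by simp
  have "s 0 \<notin> weights" "s (Suc (2 * N + 1)) \<notin> weights" unfolding s0 s2 using N[of "Suc N"] by (simp_all del: of_nat_Suc)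
  then have "0 = (\<Sum>n<2 * N + 1. of_nat (m n) * s (Suc n) ?h)"
    using string_trace[OF x y, where s = s and N = "2 * N + 1"] step by (simp add: m_def)
  also have "\<dots> = (\<Sum>n<2 * N + 1. of_nat (m n) * \<mu> ?h + of_int (int (m n) * (int n - int N)) * \<nu> ?h)"
    by (intro sum.cong refl) (simp add: s_def scale_fun_def algebra_simps)
  also have "\<dots> = of_nat A * \<mu> ?h + of_int B * \<nu> ?h"
    by (simp only: A_def B_def sum.distrib sum_distrib_right of_nat_sum of_int_sum)
  finally have "of_nat A * \<mu> ?h = - of_int B * \<nu> ?h"
    by (simp add: eq_neg_iff_add_eq_0)
  then have "\<mu> ?h = of_rat (- of_int B / of_nat A) * \<nu> ?h"
    using A by (simp add: of_rat_divide of_rat_minus field_simps)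
  then show ?thesis by blast
qed

text \<open>With \<open>\<mu> h = r \<mu> * \<nu> h\<close> for rational \<open>r \<mu>\<close>, the number \<open>K(h, h)\<close> is \<open>(\<nu> h)\<^sup>2\<close> times a sum of
  squares of rationals with positive coefficients.\<close>

lemma weight_zero_on_bracket:
  assumes x: "x \<in> V \<nu>" and y: "y \<in> V (- \<nu>)" and \<mu>: "\<mu> \<in> weights"
    and "\<nu> (br x y) = 0 \<or> killing (br x y) (br x y) = 0"
  shows "\<mu> (br x y) = 0"
proof -
  let ?h = "br x y"
  obtain r where r: "\<And>\<mu>. \<mu> \<in> weights \<Longrightarrow> \<mu> ?h = of_rat (r \<mu>) * \<nu> ?h"
    using weight_rational_on_bracket[OF x y] by metis
  show ?thesis
  proof (cases "\<nu> ?h = 0")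
    case False
    then have "0 = killing ?h ?h" using assms(4) by simp
    also have "\<dots> = (\<Sum>\<mu>\<in>weights. of_nat (mult \<mu>) * (of_rat (r \<mu>) * \<nu> ?h)\<^sup>2)"
      by (simp add: killing_t_square[OF br_opposite_in_t[OF x y]] r)
    also have "\<dots> = of_rat (\<Sum>\<mu>\<in>weights. of_nat (mult \<mu>) * (r \<mu>)\<^sup>2) * (\<nu> ?h)\<^sup>2"
      by (simp add: of_rat_sum of_rat_mult of_rat_power power_mult_distrib sum_distrib_right mult.assoc)
    finally have "(of_rat (\<Sum>\<mu>\<in>weights. of_nat (mult \<mu>) * (r \<mu>)\<^sup>2) :: 'k) = 0" using False by simp
    then have "(\<Sum>\<mu>\<in>weights. of_nat (mult \<mu>) * (r \<mu>)\<^sup>2) = 0" by simp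
    then have "of_nat (mult \<mu>) * (r \<mu>)\<^sup>2 = 0"
      using \<mu> finite_weights by (subst (asm) sum_nonneg_eq_0_iff) auto
    then have "r \<mu> = 0" using \<mu> mult_eq_0_iff by simp
    then show ?thesis using r[OF \<mu>] by simp
  qed (simp add: r[OF \<mu>])
qed

lemma derived_algebra: "span {br x y | x y. True} = UNIV"
proof -
  let ?S = "span {br x y | x y. True}"
  have mem: "br x y \<in> ?S" for x y by (rule span_base) auto
  have "lie_ideal ?S" unfolding lie_ideal_def using mem by simp
  moreover have "?S \<noteq> {0}" using nonabelian mem by blast
  ultimately show ?thesis using simple by blast
qed

text \<open>The algebra is spanned by brackets; \<open>t\<close> consists of their components of weight 0.\<close>

lemma t_generated_by_brackets:
  assumes T: "subspace T" and br: "\<And>\<nu> x y. x \<in> V \<nu> \<Longrightarrow> y \<in> V (- \<nu>) \<Longrightarrow> br x y \<in> T"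
  shows "t \<subseteq> T"
proof -
  have "wt.proj 0 (br x y) \<in> T" for x y
  proof -
    have "br x y = (\<Sum>\<nu>\<in>weights. br (wt.proj \<nu> x) y)"
      by (subst wt.sum_proj[symmetric, of x]) (rule br_sum_left)
    then have "wt.proj 0 (br x y) = (\<Sum>\<nu>\<in>weights. wt.proj 0 (br (wt.proj \<nu> x) y))"
      by (simp add: endo_sum[OF wt.endo_proj])
    also have "\<dots> = (\<Sum>\<nu>\<in>weights. br (wt.proj \<nu> x) (wt.proj (- \<nu>) y))"
      using wt.proj_br[OF wt.proj_mem, of _ "- _"] by (intro sum.cong refl) (metis add.right_inverse)
    also have "\<dots> \<in> T" by (intro subspace_sum T) (rule br[OF wt.proj_mem wt.proj_mem])
    finally show ?thesis .
  qed
  then have bracket: "wt.proj 0 u \<in> T" if "u \<in> {br x y | x y. True}" for u using that by auto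
  have "wt.proj 0 z \<in> T" for z
  proof (rule endo_span[OF wt.endo_proj T])
    show "z \<in> span {br x y | x y. True}" unfolding derived_algebra by (rule UNIV_I)
  qed (rule bracket)
  moreover have "wt.proj 0 z = z" if "z \<in> t" for z using that V_zero by (simp add: wt.proj_self)
  ultimately show ?thesis by (metis subsetI)
qed

lemma t_proper: "t \<noteq> UNIV"
proof
  assume t: "t = UNIV"
  obtain n where "lower_central UNIV n = {0}" using cartan unfolding cartan_subalgebra_def t by blast
  moreover have "lower_central UNIV n = UNIV" for n
    by (induct n) (use derived_algebra in simp_all)
  ultimately have "(UNIV :: 'g set) = {0}" by simp
  then show False using nonabelian by (metis UNIV_I singletonD)
qed

lemma not_all_weights_vanish: "\<exists>\<mu>\<in>weights. \<exists>h\<in>t. \<mu> h \<noteq> 0"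
proof (rule ccontr)
  assume "\<not> ?thesis"
  then have "\<mu> = 0" if "\<mu> \<in> weights" for \<mu>
    using that weight_outside by (auto simp: fun_eq_iff)
  then have "wt.proj \<mu> x \<in> V 0" if "\<mu> \<in> weights" for \<mu> x
    using that wt.proj_mem[of \<mu>] by metis
  then have "(\<Sum>\<mu>\<in>weights. wt.proj \<mu> x) \<in> t" for x
    by (intro subspace_sum subspace_t) (simp add: V_zero)
  then show False using t_proper by (auto simp: wt.sum_proj)
qed

text \<open>Cartan's criterion in the simple case: a degenerate Killing form vanishes identically; then all
  weights vanish on all brackets \<open>[V \<nu>, V (-\<nu>)]\<close>, hence on \<open>t\<close>.\<close>

theorem killing_nondegenerate:
  assumes "\<And>y. killing x y = 0" shows "x = 0"
proof -
  let ?R = "{x. \<forall>y. killing x y = 0}"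
  have "lie_ideal ?R"
    unfolding lie_ideal_def
  proof (intro conjI allI ballI)
    show "subspace ?R"
      by (rule subspaceI)
        (simp_all add: killing_add_left killing_scale_left linear_form_zero[OF linear_form_killing])
    fix x y assume y: "y \<in> ?R"
    have "killing (br x y) z = - killing y (br x z)" for z
    proof -
      have "killing (br x y) z = killing ((- 1) *s br y x) z" by (simp add: br_antisym[of x y])
      then show ?thesis by (simp only: killing_scale_left killing_invariant) simp
    qed
    then show "br x y \<in> ?R" using y by simp
  qed
  moreover have "?R \<noteq> UNIV"
  proof
    assume "?R = UNIV"
    then have K0: "killing x y = 0" for x y by blast
    have "\<mu> h = 0" if \<mu>: "\<mu> \<in> weights" and h: "h \<in> t" for \<mu> h
    proof -
      have "t \<subseteq> {h \<in> t. \<mu> h = 0}"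
      proof (rule t_generated_by_brackets)
        have "\<mu> 0 = 0" using weight_linear(2)[OF \<mu> subspace_0[OF subspace_t], of 0] by simp
        then show "subspace {h \<in> t. \<mu> h = 0}"
          by (intro subspaceI)
            (auto simp: weight_linear[OF \<mu>] subspace_0 subspace_add subspace_scale subspace_t)
        show "br x y \<in> {h \<in> t. \<mu> h = 0}" if "x \<in> V \<nu>" "y \<in> V (- \<nu>)" for \<nu> x y
          using weight_zero_on_bracket[OF that \<mu>] br_opposite_in_t[OF that] K0 by simp
      qed
      then show ?thesis using h by auto
    qed
    then show False using not_all_weights_vanish by auto
  qed
  ultimately have "?R = {0}" using simple by blast
  then show ?thesis using assms by blast
qed

lemma killing_t_nondegenerate:
  assumes "h \<in> t" "\<And>k. k \<in> t \<Longrightarrow> killing h k = 0" shows "h = 0"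
proof (rule killing_nondegenerate)
  fix y
  have "killing h (wt.proj \<mu> y) = 0" for \<mu>
  proof (cases "\<mu> = 0")
    case True
    then show ?thesis using assms(2) wt.proj_mem[of 0 y] by (simp add: V_zero)
  next
    case False
    then show ?thesis using wt.killing_orthogonal[of h 0 "wt.proj \<mu> y" \<mu>] wt.proj_mem assms(1)
      by (simp add: V_zero)
  qed
  then have "(\<Sum>\<mu>\<in>weights. killing h (wt.proj \<mu> y)) = 0" by simp
  then show "killing h y = 0"
    by (simp add: linear_form_sum[OF linear_form_killing_right, symmetric] wt.sum_proj)
qed

lemma zero_if_weights_vanish:
  assumes "h \<in> t" "\<And>\<mu>. \<mu> \<in> weights \<Longrightarrow> \<mu> h = 0" shows "h = 0"
  by (rule killing_t_nondegenerate[OF assms(1)]) (simp add: killing_t assms)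

section \<open>The Cartan subalgebra acts diagonally\<close>

text \<open>\<open>K(n x, y) = tr ([n, ad x] ad y) = tr (n ad [x, y]) = 0\<close>, by cyclicity of the trace.\<close>

lemma derivation_zero:
  assumes n: "endo n" and der: "\<And>x y. n (br x y) = br (n x) y + br x (n y)"
    and tr: "\<And>x. trace (\<lambda>z. n (br x z)) = 0"
  shows "n x = 0"
proof (rule killing_nondegenerate)
  fix y
  have "killing (n x) y = trace (\<lambda>z. n (br x (br y z))) - trace (\<lambda>z. br x (n (br y z)))"
    by (simp add: killing_def der[of x] trace_diff[symmetric])
  also have "trace (\<lambda>z. br x (n (br y z))) = trace (\<lambda>z. n (br y (br x z)))"
    by (rule trace_comp_commute[OF endo_br endo_comp[OF n endo_br]])
  also have "trace (\<lambda>z. n (br x (br y z))) - trace (\<lambda>z. n (br y (br x z))) =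
      trace (\<lambda>z. n (br (br x y) z))"
    by (simp add: br_br_left endo_diff[OF n] trace_diff)
  also have "\<dots> = 0" by (rule tr)
  finally show "killing (n x) y = 0" .
qed

text \<open>Let \<open>s\<close> be multiplication by \<open>\<mu> h\<close> on each \<open>V \<mu>\<close>.  It is a derivation, because weights add up under
  brackets, and hence so is \<open>n = ad h - s\<close>.  For \<open>x\<close> of nonzero weight \<open>n ad x\<close> shifts weights and has
  trace 0; for \<open>x \<in> t\<close> both \<open>ad h ad x\<close> and \<open>s ad x\<close> have trace \<open>K(h, x)\<close>.\<close>

lemma t_acts_diagonally:
  assumes h: "h \<in> t" and x: "x \<in> V \<mu>"
  shows "br h x = \<mu> h *s x"
proof -
  define s where "s x = (\<Sum>\<mu>\<in>weights. \<mu> h *s wt.proj \<mu> x)" for x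
  have s_part: "s x = \<mu> h *s x" if "x \<in> V \<mu>" for \<mu> x
  proof (cases "x = 0")
    case False
    have "s x = (\<Sum>\<kappa>\<in>weights. if \<kappa> = \<mu> then \<mu> h *s x else 0)"
      unfolding s_def by (intro sum.cong refl) (simp add: wt.proj_part[OF that])
    then show ?thesis using wt.part_nonzero_index[OF that False] finite_weights by simp
  qed (simp add: s_def endo_zero[OF wt.endo_proj])
  have s: "endo s" unfolding s_def by (intro endo_sums endo_scaled wt.endo_proj)
  let ?n = "\<lambda>x. br h x - s x"
  have n: "endo ?n" by (rule endo_minus[OF endo_br s])
  have n_part: "?n x \<in> V \<mu>" if "x \<in> V \<mu>" for \<mu> x
    using that by (simp add: s_part subspace_diff subspace_scale subspace_V br_t_V h)
  have "?n x = 0"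
  proof (rule derivation_zero[OF n])
    show "?n (br x y) = br (?n x) y + br x (?n y)" for x y
    proof -
      have part: "s (br x y) = br (s x) y + br x (s y)" if "x \<in> V \<mu>" "y \<in> V \<kappa>" for \<mu> \<kappa> x y
        using that br_V[OF that] weight_outside[of \<mu> h]
        by (simp add: s_part br_scale_left br_scale_right scale_left_distrib)
      have right: "s (br x y) = br (s x) y + br x (s y)" if "x \<in> V \<mu>" for \<mu> x y
      proof -
        have "s (br x (\<Sum>\<kappa>\<in>weights. wt.proj \<kappa> y)) =
            br (s x) (\<Sum>\<kappa>\<in>weights. wt.proj \<kappa> y) + br x (s (\<Sum>\<kappa>\<in>weights. wt.proj \<kappa> y))"
          by (simp only: br_sum_right endo_sum[OF s] part[OF that wt.proj_mem] sum.distrib)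
        then show ?thesis by (simp only: wt.sum_proj)
      qed
      have "s (br (\<Sum>\<kappa>\<in>weights. wt.proj \<kappa> x) y) =
          br (s (\<Sum>\<kappa>\<in>weights. wt.proj \<kappa> x)) y + br (\<Sum>\<kappa>\<in>weights. wt.proj \<kappa> x) (s y)"
        by (simp only: br_sum_left endo_sum[OF s] right[OF wt.proj_mem] sum.distrib)
      then have "s (br x y) = br (s x) y + br x (s y)" by (simp only: wt.sum_proj)
      then show ?thesis by (simp add: br_br_right[of h] br_diff_left br_diff_right)
    qed
    fix x
    have part: "trace (\<lambda>z. ?n (br x z)) = 0" if x: "x \<in> V \<mu>" for \<mu> x
    proof (cases "\<mu> = 0")
      case False
      show ?thesis
        by (rule wt.trace_shift[OF endo_comp[OF n endo_br] _ False]) (intro n_part br_V x)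
    next
      case True
      then have xt: "x \<in> t" using x by (simp add: V_zero)
      have "trace (\<lambda>z. s (br x z)) = (\<Sum>\<mu>\<in>weights. \<mu> h * trace (\<lambda>z. wt.proj \<mu> (br x z)))"
        unfolding s_def by (simp add: trace_sum trace_scale)
      also have "\<dots> = killing h x"
        by (simp add: trace_weight[OF xt] killing_t[OF h xt] mult.left_commute)
      finally show ?thesis by (simp add: trace_diff killing_def)
    qed
    have "trace (\<lambda>z. ?n (br (\<Sum>\<mu>\<in>weights. wt.proj \<mu> x) z)) =
        (\<Sum>\<mu>\<in>weights. trace (\<lambda>z. ?n (br (wt.proj \<mu> x) z)))"
      unfolding br_sum_left endo_sum[OF n] by (rule trace_sum)
    then show "trace (\<lambda>z. ?n (br x z)) = 0"
      by (simp add: wt.sum_proj part[OF wt.proj_mem])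
  qed
  then show ?thesis using s_part[OF x] by simp
qed

section \<open>The form on the dual of the Cartan subalgebra\<close>

lemma cartan_dual_add: "f \<in> cartan_dual \<Longrightarrow> x \<in> t \<Longrightarrow> y \<in> t \<Longrightarrow> f (x + y) = f x + f y"
  and cartan_dual_scale: "f \<in> cartan_dual \<Longrightarrow> x \<in> t \<Longrightarrow> f (c *s x) = c * f x"
  and cartan_dual_outside: "f \<in> cartan_dual \<Longrightarrow> x \<notin> t \<Longrightarrow> f x = 0"
  by (auto simp: cartan_dual_def)

lemma subspace_cartan_dual: "functionals.subspace cartan_dual"
  by (rule functionals.subspaceI) (auto simp: cartan_dual_def scale_fun_def algebra_simps)

lemma cartan_dual_eqI:
  assumes "f \<in> cartan_dual" "g \<in> cartan_dual" "\<And>h. h \<in> t \<Longrightarrow> f h = g h"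
  shows "f = g"
proof
  show "f h = g h" for h
    using assms(3)[of h] cartan_dual_outside[OF assms(1), of h] cartan_dual_outside[OF assms(2), of h]
    by (cases "h \<in> t") auto
qed

lemma killing_dual_vector_unique:
  assumes "h \<in> t" "\<And>x. x \<in> t \<Longrightarrow> killing h x = f x"
  shows "killing_dual_vector f = h"
  unfolding killing_dual_vector_def
proof (rule the_equality)
  show "h \<in> t \<and> (\<forall>x\<in>t. killing h x = f x)" using assms by blast
  fix k assume k: "k \<in> t \<and> (\<forall>x\<in>t. killing k x = f x)"
  have "k - h = 0"
  proof (rule killing_t_nondegenerate)
    show "k - h \<in> t" using k assms(1) subspace_diff[OF subspace_t] by simp
    fix x assume "x \<in> t"
    then have "killing ((k - h) + h) x = killing h x" using k assms(2) by simp
    then show "killing (k - h) x = 0" unfolding killing_add_left by simp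
  qed
  then show "k = h" by simp
qed

lemma killing_dual_vector:
  assumes "f \<in> cartan_dual"
  shows "killing_dual_vector f \<in> t"
    and "x \<in> t \<Longrightarrow> killing (killing_dual_vector f) x = f x"
proof -
  obtain h where h: "h \<in> t" "\<forall>x\<in>t. killing h x = f x"
    using killing_represents[OF subspace_t killing_t_nondegenerate, of f]
      cartan_dual_add[OF assms] cartan_dual_scale[OF assms] by metis
  then have "killing_dual_vector f = h" by (intro killing_dual_vector_unique) auto
  then show "killing_dual_vector f \<in> t" "x \<in> t \<Longrightarrow> killing (killing_dual_vector f) x = f x"
    using h by auto
qed

lemma dual_form_eq: "f \<in> cartan_dual \<Longrightarrow> g \<in> cartan_dual \<Longrightarrow> dual_form f g = f (killing_dual_vector g)"
  by (simp add: dual_form_def killing_dual_vector)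

lemma dual_form_commute: "dual_form f g = dual_form g f"
  by (simp add: dual_form_def killing_commute)

lemma dual_form_add_left:
  assumes "f \<in> cartan_dual" "g \<in> cartan_dual" "k \<in> cartan_dual"
  shows "dual_form (f + g) k = dual_form f k + dual_form g k"
  using assms functionals.subspace_add[OF subspace_cartan_dual, of f g] by (simp add: dual_form_eq)

lemma dual_form_scale_left:
  assumes "f \<in> cartan_dual" "k \<in> cartan_dual"
  shows "dual_form (scale_fun c f) k = c * dual_form f k"
  using assms functionals.subspace_scale[OF subspace_cartan_dual, of f]
  by (simp add: dual_form_eq scale_fun_def)

lemma dual_form_sum_left:
  assumes "\<And>i. i \<in> A \<Longrightarrow> f i \<in> cartan_dual" "k \<in> cartan_dual"
  shows "dual_form (\<Sum>i\<in>A. f i) k = (\<Sum>i\<in>A. dual_form (f i) k)"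
proof -
  have "(\<Sum>i\<in>A. f i) \<in> cartan_dual" by (intro functionals.subspace_sum[OF subspace_cartan_dual] assms)
  moreover have "(\<Sum>i\<in>A. f i) h = (\<Sum>i\<in>A. f i h)" for h
    by (induct A rule: infinite_finite_induct) auto
  ultimately show ?thesis using assms by (simp add: dual_form_eq)
qed

lemma dual_form_weights:
  assumes "f \<in> cartan_dual" "g \<in> cartan_dual"
  shows "dual_form f g = (\<Sum>\<mu>\<in>weights. of_nat (mult \<mu>) * (dual_form \<mu> f * dual_form \<mu> g))"
  unfolding dual_form_def[of f g]
  by (simp add: killing_t killing_dual_vector assms dual_form_eq weights_cartan_dual)

lemma dual_form_nondegenerate:
  assumes f: "f \<in> cartan_dual" and "\<And>g. g \<in> cartan_dual \<Longrightarrow> dual_form f g = 0"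
  shows "f = 0"
proof (rule cartan_dual_eqI[OF f functionals.subspace_0[OF subspace_cartan_dual]])
  have "killing_dual_vector f = 0"
  proof (rule zero_if_weights_vanish)
    fix \<mu> assume "\<mu> \<in> weights"
    then show "\<mu> (killing_dual_vector f) = 0"
      using assms(2)[of \<mu>] f by (simp add: weights_cartan_dual dual_form_commute[of f] dual_form_eq)
  qed (rule killing_dual_vector[OF f])
  then show "f h = 0 h" if "h \<in> t" for h
    using killing_dual_vector(2)[OF f that] by (simp add: linear_form_zero[OF linear_form_killing])
qed

section \<open>Roots and root strings\<close>

lemma V_root_space:
  assumes "\<And>h. h \<notin> t \<Longrightarrow> \<gamma> h = 0" shows "V \<gamma> = root_space \<gamma>"
proof
  show "V \<gamma> \<subseteq> root_space \<gamma>" by (auto simp: root_space_def t_acts_diagonally)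
  show "root_space \<gamma> \<subseteq> V \<gamma>"
  proof
    fix x assume x: "x \<in> root_space \<gamma>"
    have "x \<in> gen_eigenspace (br h) (\<gamma> h)" if "h \<in> t" for h
    proof -
      have "(eigenshift (br h) (\<gamma> h) ^^ 1) x = 0"
        using x that by (simp add: root_space_def eigenshift_def)
      then show ?thesis unfolding gen_eigenspace_def by blast
    qed
    then show "x \<in> V \<gamma>" using assms by (simp add: V_def gen_weight_space_def)
  qed
qed

lemma zero_weight: "0 \<in> weights"
proof -
  have "t \<noteq> {0}"
  proof
    assume "t = {0}"
    then have "{x. \<forall>y\<in>t. br x y \<in> t} = UNIV" by (auto simp: br_zero_right)
    then show False using cartan t_proper unfolding cartan_subalgebra_def by simp
  qed
  then show ?thesis by (simp add: weights_def V_zero)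
qed

lemma roots_eq: "roots = weights - {0}"
proof
  show "roots \<subseteq> weights - {0}"
  proof
    fix \<gamma> assume "\<gamma> \<in> roots"
    then have "\<gamma> \<noteq> 0" "root_space \<gamma> \<noteq> {0}" "\<gamma> \<in> cartan_dual" by (auto simp: roots_def)
    then show "\<gamma> \<in> weights - {0}" using V_root_space[of \<gamma>] by (simp add: weights_def cartan_dual_outside)
  qed
  show "weights - {0} \<subseteq> roots"
  proof
    fix \<gamma> assume \<gamma>: "\<gamma> \<in> weights - {0}"
    then have "V \<gamma> = root_space \<gamma>" using V_root_space weight_outside by blast
    then show "\<gamma> \<in> roots" using \<gamma> weights_cartan_dual[of \<gamma>] by (simp add: weights_def roots_def)
  qed
qed

lemma weights_eq: "weights = insert 0 roots"
  using zero_weight by (auto simp: roots_eq)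

lemma root_weight: "\<gamma> \<in> roots \<Longrightarrow> \<gamma> \<in> weights"
  and root_nonzero: "\<gamma> \<in> roots \<Longrightarrow> \<gamma> \<noteq> 0"
  and root_cartan_dual: "\<gamma> \<in> roots \<Longrightarrow> \<gamma> \<in> cartan_dual"
  by (auto simp: roots_eq weights_cartan_dual)

lemma V_root: "\<gamma> \<in> roots \<Longrightarrow> V \<gamma> = root_space \<gamma>"
  by (rule V_root_space) (simp add: cartan_dual_outside root_cartan_dual)

lemma finite_roots: "finite roots"
  using finite_weights by (simp add: roots_eq)

lemma roots_nonempty: "roots \<noteq> {}"
  using not_all_weights_vanish by (auto simp: weights_eq)

lemma weight_pairing:
  assumes "x \<in> V \<nu>" "x \<noteq> 0" shows "\<exists>y\<in>V (- \<nu>). killing x y = 1"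
proof -
  obtain z where z: "killing x z \<noteq> 0" using killing_nondegenerate assms(2) by blast
  have "killing x z = (\<Sum>\<mu>\<in>weights. killing x (wt.proj \<mu> z))"
    by (simp add: linear_form_sum[OF linear_form_killing_right, symmetric] wt.sum_proj)
  then have "(\<Sum>\<mu>\<in>weights. killing x (wt.proj \<mu> z)) \<noteq> 0" using z by simp
  then obtain \<mu> where \<mu>: "killing x (wt.proj \<mu> z) \<noteq> 0"
    by (rule sum.not_neutral_contains_not_neutral)
  then have "\<nu> + \<mu> = 0" using wt.killing_orthogonal[OF assms(1) wt.proj_mem] by blast
  then have "\<mu> = - \<nu>" by (simp add: eq_neg_iff_add_eq_0 add.commute)
  define y where "y = (1 / killing x (wt.proj \<mu> z)) *s wt.proj \<mu> z"
  have "killing x y = 1"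
    using \<mu> by (simp add: y_def linear_form_scale[OF linear_form_killing_right])
  moreover have "y \<in> V (- \<nu>)"
    unfolding y_def \<open>\<mu> = - \<nu>\<close> by (intro subspace_scale subspace_V wt.proj_mem)
  ultimately show ?thesis by blast
qed

lemma br_opposite:
  assumes "x \<in> V \<nu>" "y \<in> V (- \<nu>)" "\<nu> \<in> weights"
  shows "br x y = killing x y *s killing_dual_vector \<nu>"
proof -
  note dual = killing_dual_vector[OF weights_cartan_dual[OF assms(3)]]
  note t1 = br_opposite_in_t[OF assms(1,2)] and t2 = subspace_scale[OF subspace_t dual(1)]
  have "br x y - killing x y *s killing_dual_vector \<nu> = 0"
  proof (rule killing_t_nondegenerate)
    show "br x y - killing x y *s killing_dual_vector \<nu> \<in> t" by (rule subspace_diff[OF subspace_t t1 t2])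
    fix h assume h: "h \<in> t"
    have "br y h = \<nu> h *s y" using t_acts_diagonally[OF h assms(2)] by (simp add: br_antisym[of h y])
    then have "killing (br x y) h = \<nu> h * killing x y"
      by (simp add: killing_invariant linear_form_scale[OF linear_form_killing_right])
    moreover have "killing (br x y) h = killing (br x y - killing x y *s killing_dual_vector \<nu>) h
        + killing (killing x y *s killing_dual_vector \<nu>) h"
      by (simp only: killing_add_left[symmetric] diff_add_cancel)
    ultimately show "killing (br x y - killing x y *s killing_dual_vector \<nu>) h = 0"
      using dual(2)[OF h] by (simp add: killing_scale_left)
  qed
  then show ?thesis by simp
qed

lemma weight_pair_exists:
  assumes "\<nu> \<in> weights"
  obtains x y where "x \<in> V \<nu>" "y \<in> V (- \<nu>)" "killing x y = 1" "br x y = killing_dual_vector \<nu>"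
proof -
  obtain x where x: "x \<in> V \<nu>" "x \<noteq> 0"
    using weight_vector_exists[OF assms] by blast
  then obtain y where y: "y \<in> V (- \<nu>)" "killing x y = 1" using weight_pairing by blast
  have "br x y = killing_dual_vector \<nu>" using br_opposite[OF x(1) y(1) assms] y(2) by simp
  then show thesis using that x(1) y by blast
qed

lemma weight_uminus:
  assumes "\<nu> \<in> weights" shows "- \<nu> \<in> weights"
proof -
  obtain x y where "y \<in> V (- \<nu>)" "killing x y = 1" using weight_pair_exists[OF assms] by metis
  moreover from this have "y \<noteq> 0" using linear_form_zero[OF linear_form_killing_right, of x] by auto
  ultimately show ?thesis by (auto simp: weights_def)
qed

lemma root_uminus: "\<gamma> \<in> roots \<Longrightarrow> - \<gamma> \<in> roots"
  by (simp add: roots_eq weight_uminus)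

text \<open>The vector of \<open>t\<close> dual to \<open>\<nu>\<close> is a bracket \<open>[x, y]\<close>; if \<open>\<nu>\<close> vanishes on it then so do all
  weights.\<close>

lemma dual_form_root_nonzero:
  assumes "\<nu> \<in> roots" shows "dual_form \<nu> \<nu> \<noteq> 0"
proof
  assume zero: "dual_form \<nu> \<nu> = 0"
  note dual = root_cartan_dual[OF assms]
  obtain x y where xy: "x \<in> V \<nu>" "y \<in> V (- \<nu>)" "br x y = killing_dual_vector \<nu>"
    using weight_pair_exists[OF root_weight[OF assms]] by metis
  have "killing_dual_vector \<nu> = 0"
  proof (rule zero_if_weights_vanish)
    show "\<mu> (killing_dual_vector \<nu>) = 0" if "\<mu> \<in> weights" for \<mu>
      using weight_zero_on_bracket[OF xy(1,2) that] zero by (simp add: xy(3) dual_form_eq dual)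
  qed (rule killing_dual_vector[OF dual])
  then have "\<nu> h = 0" if "h \<in> t" for h
    using killing_dual_vector(2)[OF dual that] by (simp add: linear_form_zero[OF linear_form_killing])
  then have "\<nu> = 0"
    by (intro cartan_dual_eqI[OF dual functionals.subspace_0[OF subspace_cartan_dual]]) simp
  then show False using root_nonzero[OF assms] by simp
qed

text \<open>On \<open>t\<close> the operator \<open>ad y ad x\<close> has rank one: it is \<open>h \<mapsto> \<nu> h *s [x, y]\<close>.\<close>

lemma trace_zero_part:
  assumes x: "x \<in> V \<nu>" and y: "y \<in> V (- \<nu>)" and \<nu>: "\<nu> \<in> weights"
  shows "trace (\<lambda>z. wt.proj 0 (br y (br x z))) = killing x y * dual_form \<nu> \<nu>"
proof -
  note dual = weights_cartan_dual[OF \<nu>]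
  have proj_t: "wt.proj 0 z \<in> t" for z using wt.proj_mem[of 0 z] by (simp add: V_zero)
  have proj_id: "wt.proj 0 z = z" if "z \<in> t" for z using that by (simp add: V_zero wt.proj_self)
  have form: "linear_form (\<lambda>z. \<nu> (wt.proj 0 z))"
    by (rule linear_formI)
      (simp_all add: endo_add[OF wt.endo_proj] endo_scale[OF wt.endo_proj] cartan_dual_add[OF dual]
        cartan_dual_scale[OF dual] proj_t)
  have rank: "endo (\<lambda>z. \<nu> (wt.proj 0 z) *s br x y)"
    by (rule endoI) (simp_all add: linear_form_add[OF form] linear_form_scale[OF form] scale_left_distrib)
  note xy = br_opposite_in_t[OF x y]
  have "trace (\<lambda>z. wt.proj 0 (br y (br x z))) = trace (\<lambda>z. wt.proj 0 (\<nu> (wt.proj 0 z) *s br x y))"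
  proof (rule wt.trace_proj_cong[OF endo_comp[OF endo_br endo_br] rank])
    fix z assume "z \<in> V 0"
    then have z: "z \<in> t" by (simp add: V_zero)
    have "br x z = - br z x" by (rule br_antisym)
    then have "br x z = - (\<nu> z *s x)" using t_acts_diagonally[OF z x] by simp
    then have "br y (br x z) = \<nu> z *s br x y"
      by (simp add: br_minus_right br_scale_right br_antisym[of x y])
    then show "wt.proj 0 (br y (br x z)) = wt.proj 0 (\<nu> (wt.proj 0 z) *s br x y)"
      by (simp add: proj_id z)
  qed
  also have "\<dots> = trace (\<lambda>z. \<nu> (wt.proj 0 z) *s br x y)"
    by (simp add: proj_id subspace_scale[OF subspace_t] xy)
  also have "\<dots> = \<nu> (br x y)" by (simp add: trace_rank_one[OF form] proj_id xy)
  also have "\<dots> = killing x y * dual_form \<nu> \<nu>"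
    by (simp add: br_opposite[OF x y \<nu>] cartan_dual_scale[OF dual] killing_dual_vector[OF dual]
        dual_form_eq[OF dual dual])
  finally show ?thesis .
qed

text \<open>Telescoping along the multiples of a root \<open>\<nu>\<close>, starting from the trace on \<open>t\<close>, gives
  \<open>1 = \<Sum>n\<ge>1. n * mult (n \<nu>)\<close>.\<close>

lemma mult_root_multiples:
  assumes \<nu>: "\<nu> \<in> roots"
  shows "mult \<nu> = 1" and "n \<ge> 2 \<Longrightarrow> scale_fun (of_nat n) \<nu> \<notin> weights"
proof -
  note dual = root_cartan_dual[OF \<nu>]
  let ?s = "\<lambda>n::nat. scale_fun (of_nat n) \<nu>"
  obtain x y where xy: "x \<in> V \<nu>" "y \<in> V (- \<nu>)" "killing x y = 1" "br x y = killing_dual_vector \<nu>"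
    by (rule weight_pair_exists[OF root_weight[OF \<nu>]])
  obtain N where N: "\<And>n. n \<ge> N \<Longrightarrow> ?s n \<notin> weights"
    using progression_leaves_weights[OF root_nonzero[OF \<nu>], of 0] by auto
  have total: "(\<Sum>n<M. mult (?s (Suc n)) * Suc n) = 1" if "M \<ge> N" for M
  proof -
    have "trace (\<lambda>z. wt.proj (?s 0) (br y (br x z))) =
        (\<Sum>n<M. trace (\<lambda>z. wt.proj (?s (Suc n)) (br (br x y) z))) +
        trace (\<lambda>z. wt.proj (?s M) (br y (br x z)))"
      by (rule wt.trace_telescope[OF xy(1,2)]) (simp add: scale_fun_def fun_eq_iff algebra_simps)
    moreover have "trace (\<lambda>z. wt.proj (?s M) (br y (br x z))) = 0"
      by (rule wt.trace_step_zero[OF xy(1,2)]) (simp add: N that)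
    moreover have "?s 0 = 0" by simp
    ultimately have "dual_form \<nu> \<nu> = (\<Sum>n<M. of_nat (mult (?s (Suc n))) * ?s (Suc n) (killing_dual_vector \<nu>))"
      using trace_zero_part[OF xy(1,2) root_weight[OF \<nu>]] xy(3)
      by (simp only: xy(4) trace_weight[OF killing_dual_vector(1)[OF dual]]) simp
    also have "\<dots> = (\<Sum>n<M. of_nat (mult (?s (Suc n)) * Suc n) * dual_form \<nu> \<nu>)"
      by (intro sum.cong refl) (simp add: dual_form_eq[OF dual dual], simp add: scale_fun_def algebra_simps)
    also have "\<dots> = of_nat (\<Sum>n<M. mult (?s (Suc n)) * Suc n) * dual_form \<nu> \<nu>"
      by (simp only: sum_distrib_right of_nat_sum)
    finally have "of_nat (\<Sum>n<M. mult (?s (Suc n)) * Suc n) = (of_nat 1 :: 'k)"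
      using dual_form_root_nonzero[OF \<nu>] by simp
    then show ?thesis by (simp only: of_nat_eq_iff)
  qed
  have pos: "mult \<nu> \<ge> 1" using mult_eq_0_iff[of \<nu>] root_weight[OF \<nu>] by simp
  have one: "?s (Suc 0) = \<nu>" by simp
  have rest: "mult \<nu> + mult (?s (Suc n)) * Suc n \<le> 1" if "n > 0" for n
  proof -
    have "(\<Sum>i\<in>{0, n}. mult (?s (Suc i)) * Suc i) \<le> (\<Sum>i<N + n + 1. mult (?s (Suc i)) * Suc i)"
      by (rule sum_mono2) auto
    then show ?thesis using total[of "N + n + 1"] that one by simp
  qed
  show "mult \<nu> = 1" using rest[of 1] pos by simp
  show "scale_fun (of_nat n) \<nu> \<notin> weights" if "n \<ge> 2"
  proof -
    obtain m where m: "n = Suc m" "m > 0" using \<open>n \<ge> 2\<close> by (cases n) auto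
    then have "mult (?s n) * Suc m = 0" using rest[of m] pos by simp
    then show ?thesis using mult_eq_0_iff[of "?s n"] by simp
  qed
qed

lemma root_multiple:
  assumes \<beta>: "\<beta> \<in> roots" and "scale_fun (of_int n) \<beta> \<in> roots"
  shows "n = 1 \<or> n = - 1"
proof (rule ccontr)
  assume n: "\<not> ?thesis"
  have "n \<noteq> 0" using root_nonzero[OF assms(2)] by auto
  then have "nat \<bar>n\<bar> \<ge> 2" using n by linarith
  then have "scale_fun (of_nat (nat \<bar>n\<bar>)) \<beta> \<notin> weights" by (rule mult_root_multiples[OF \<beta>])
  moreover have "(of_nat (nat \<bar>n\<bar>) :: 'k) = of_int \<bar>n\<bar>" by simp
  then have "scale_fun (of_nat (nat \<bar>n\<bar>)) \<beta> = scale_fun (of_int n) \<beta> \<or>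
      scale_fun (of_nat (nat \<bar>n\<bar>)) \<beta> = - scale_fun (of_int n) \<beta>"
    by (cases "n \<ge> 0") (simp_all add: functionals.scale_minus_left)
  ultimately show False using assms(2) root_weight weight_uminus by metis
qed

text \<open>The string \<open>\<gamma> - p \<beta>, \<dots>, \<gamma> + r \<beta>\<close> consists of roots of multiplicity one, so the vanishing of its
  trace says \<open>2 (\<gamma>, \<beta>) = (p - r) (\<beta>, \<beta>)\<close>.\<close>

lemma cartan_integer_string:
  assumes \<gamma>: "\<gamma> \<in> roots" and \<beta>: "\<beta> \<in> roots" and "\<And>n. \<gamma> + scale_fun (of_int n) \<beta> \<noteq> 0"
  shows "\<exists>a::int. 2 * dual_form \<gamma> \<beta> = of_int a * dual_form \<beta> \<beta> \<and> (a > 0 \<longrightarrow> \<gamma> - \<beta> \<in> weights)"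
proof -
  note dual = root_cartan_dual[OF \<gamma>] root_cartan_dual[OF \<beta>]
  let ?m = "\<lambda>n::int. \<gamma> + scale_fun (of_int n) \<beta>"
  obtain N where N: "\<And>n. n \<ge> N \<Longrightarrow>
      \<gamma> + scale_fun (of_nat n) \<beta> \<notin> weights \<and> \<gamma> - scale_fun (of_nat n) \<beta> \<notin> weights"
    using progression_leaves_weights[OF root_nonzero[OF \<beta>]] by metis
  have ex: "?m (int (Suc N)) \<notin> weights" "?m (- int (Suc N)) \<notin> weights"
    using N[of "Suc N"] by (simp_all del: of_nat_Suc add: functionals.scale_minus_left)
  define r where "r = (LEAST r. ?m (int (Suc r)) \<notin> weights)"
  define p where "p = (LEAST p. ?m (- int (Suc p)) \<notin> weights)"
  have r: "?m (int (Suc r)) \<notin> weights" unfolding r_def using ex(1) by (rule LeastI)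
  have p: "?m (- int (Suc p)) \<notin> weights" unfolding p_def using ex(2) by (rule LeastI)
  have below_r: "?m (int n) \<in> weights" if "n \<le> r" for n
  proof (cases n)
    case (Suc k)
    then show ?thesis using not_less_Least[of k "\<lambda>r. ?m (int (Suc r)) \<notin> weights"] that by (simp add: r_def)
  qed (simp add: root_weight[OF \<gamma>])
  have below_p: "?m (- int n) \<in> weights" if "n \<le> p" for n
  proof (cases n)
    case (Suc k)
    then show ?thesis using not_less_Least[of k "\<lambda>p. ?m (- int (Suc p)) \<notin> weights"] that by (simp add: p_def)
  qed (simp add: root_weight[OF \<gamma>])
  have inside: "mult (?m n) = 1" if n: "- int p \<le> n" "n \<le> int r" for n
  proof -
    have "?m n \<in> weights"
    proof (cases "n \<ge> 0")
      case True
      then show ?thesis using below_r[of "nat n"] n by simp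
    next
      case False
      then show ?thesis using below_p[of "nat (- n)"] n by simp
    qed
    then have "?m n \<in> roots" using assms(3) by (simp add: roots_eq)
    then show ?thesis by (rule mult_root_multiples)
  qed
  obtain x y where xy: "x \<in> V \<beta>" "y \<in> V (- \<beta>)" "br x y = killing_dual_vector \<beta>"
    using weight_pair_exists[OF root_weight[OF \<beta>]] by metis
  \<comment> \<open>starts one step below the string, as \<open>string_trace\<close> requires\<close>
  define s where "s n = ?m (int n - int (Suc p))" for n
  define L where "L = p + r + 1"
  have step: "s (Suc n) = s n + \<beta>" for n
    by (simp add: s_def scale_fun_def fun_eq_iff algebra_simps)
  have "s 0 \<notin> weights" using p by (simp add: s_def)
  moreover have "s (Suc L) = ?m (int (Suc r))" unfolding s_def L_def
    by (rule arg_cong[where f = ?m]) simp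
  ultimately have "0 = (\<Sum>n<L. of_nat (mult (s (Suc n))) * s (Suc n) (killing_dual_vector \<beta>))"
    using string_trace[OF xy(1,2), where s = s and N = L] step r xy(3) by simp
  also have "\<dots> = (\<Sum>n<L. dual_form \<gamma> \<beta> + (of_nat n - of_nat p) * dual_form \<beta> \<beta>)"
  proof (intro sum.cong refl)
    fix n assume "n \<in> {..<L}"
    then have "mult (s (Suc n)) = 1" unfolding s_def L_def by (intro inside) auto
    then show "of_nat (mult (s (Suc n))) * s (Suc n) (killing_dual_vector \<beta>) =
        dual_form \<gamma> \<beta> + (of_nat n - of_nat p) * dual_form \<beta> \<beta>"
      by (simp add: dual_form_eq dual) (simp add: s_def scale_fun_def)
  qed
  also have "\<dots> = of_nat L * dual_form \<gamma> \<beta> + ((\<Sum>n<L. of_nat n) - of_nat L * of_nat p) * dual_form \<beta> \<beta>"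
    by (simp add: sum.distrib sum_subtractf sum_distrib_right[symmetric])
  finally have "of_nat L * dual_form \<gamma> \<beta> =
      (of_nat L * of_nat p - (\<Sum>n<L. of_nat n)) * dual_form \<beta> \<beta>"
    by (simp add: algebra_simps)
  then have "2 * (of_nat L * dual_form \<gamma> \<beta>) =
      2 * ((of_nat L * of_nat p - (\<Sum>n<L. of_nat n)) * dual_form \<beta> \<beta>)"
    by simp
  also have "\<dots> = (2 * of_nat L * of_nat p - 2 * (\<Sum>n<L. of_nat n)) * dual_form \<beta> \<beta>"
    by (simp add: algebra_simps)
  also have "2 * (\<Sum>n<L. of_nat n) = (of_nat L * (of_nat L - 1) :: 'k)"
    by (induct L) (simp_all add: algebra_simps)
  also have "2 * of_nat L * of_nat p - of_nat L * (of_nat L - 1) =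
      (of_nat L * of_int (int p - int r) :: 'k)"
    by (simp add: L_def algebra_simps)
  finally have "of_nat L * (2 * dual_form \<gamma> \<beta>) = of_nat L * (of_int (int p - int r) * dual_form \<beta> \<beta>)"
    by (simp add: mult.assoc mult.left_commute)
  moreover have "(of_nat L :: 'k) \<noteq> 0" by (simp add: L_def del: of_nat_add of_nat_Suc)
  ultimately have "2 * dual_form \<gamma> \<beta> = of_int (int p - int r) * dual_form \<beta> \<beta>" by simp
  moreover have "\<gamma> - \<beta> \<in> weights" if "int p - int r > 0"
    using below_p[of 1] that by (simp add: functionals.scale_minus_left)
  ultimately show ?thesis by blast
qed

lemma cartan_integer:
  assumes \<gamma>: "\<gamma> \<in> roots" and \<beta>: "\<beta> \<in> roots"
  shows "\<exists>a::int. 2 * dual_form \<gamma> \<beta> = of_int a * dual_form \<beta> \<beta> \<and> (a > 0 \<longrightarrow> \<gamma> - \<beta> \<in> weights)"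
proof (cases "\<exists>n::int. \<gamma> + scale_fun (of_int n) \<beta> = 0")
  case True
  then obtain n :: int where n: "\<gamma> = scale_fun (of_int (- n)) \<beta>"
    by (auto simp: eq_neg_iff_add_eq_0[symmetric] functionals.scale_minus_left)
  then have "- n = 1 \<or> - n = - 1" using root_multiple[OF \<beta>] \<gamma> by blast
  then show ?thesis
  proof
    assume "- n = 1"
    then have "\<gamma> = \<beta>" using n by simp
    then show ?thesis using zero_weight by (intro exI[of _ 2]) simp
  next
    assume "- n = - 1"
    then have "\<gamma> = scale_fun (- 1) \<beta>" using n by (metis of_int_1 of_int_minus)
    then have "dual_form \<gamma> \<beta> = - 1 * dual_form \<beta> \<beta>"
      using dual_form_scale_left root_cartan_dual[OF \<beta>] by metis
    then show ?thesis by (intro exI[of _ "- 2"]) simp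
  qed
qed (use cartan_integer_string[OF assms] in blast)

text \<open>Inserting \<open>2 (\<mu>, \<gamma>) = a \<mu> * (\<gamma>, \<gamma>)\<close> with integers \<open>a \<mu>\<close> into \<open>(\<gamma>, \<gamma>) = \<Sum>\<mu>. (\<mu>, \<gamma>)\<^sup>2\<close> gives
  \<open>(\<gamma>, \<gamma>) = 4 / \<Sum>\<mu>. (a \<mu>)\<^sup>2\<close>.\<close>

lemma dual_form_root_positive:
  assumes \<gamma>: "\<gamma> \<in> roots" shows "\<exists>r>0. dual_form \<gamma> \<gamma> = of_rat r"
proof -
  note dual = root_cartan_dual[OF \<gamma>]
  obtain a :: "('g \<Rightarrow> 'k) \<Rightarrow> int"
    where a: "\<And>\<mu>. \<mu> \<in> roots \<Longrightarrow> 2 * dual_form \<mu> \<gamma> = of_int (a \<mu>) * dual_form \<gamma> \<gamma>"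
    using cartan_integer[OF _ \<gamma>] by metis
  let ?g = "dual_form \<gamma> \<gamma>"
  define A where "A = (\<Sum>\<mu>\<in>roots. (a \<mu>)\<^sup>2)"
  have zero: "dual_form 0 \<gamma> = 0"
    using dual_form_scale_left[OF dual dual, of 0] by simp
  have "0 \<notin> roots" by (simp add: roots_eq)
  then have "4 * ?g = 4 * (\<Sum>\<mu>\<in>roots. of_nat (mult \<mu>) * (dual_form \<mu> \<gamma> * dual_form \<mu> \<gamma>))"
    using dual_form_weights[OF dual dual] finite_roots \<open>0 \<notin> roots\<close> by (simp add: weights_eq zero)
  also have "\<dots> = (\<Sum>\<mu>\<in>roots. (2 * dual_form \<mu> \<gamma>)\<^sup>2)"
    by (simp add: sum_distrib_left mult_root_multiples(1) power2_eq_square algebra_simps)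
  also have "\<dots> = (\<Sum>\<mu>\<in>roots. of_int ((a \<mu>)\<^sup>2) * ?g\<^sup>2)"
    by (intro sum.cong refl) (simp add: a power_mult_distrib)
  also have "\<dots> = of_int A * ?g\<^sup>2" by (simp only: A_def of_int_sum sum_distrib_right)
  finally have "?g * 4 = ?g * (of_int A * ?g)" by (simp add: power2_eq_square mult.left_commute mult.commute)
  then have A: "of_int A * ?g = 4" using dual_form_root_nonzero[OF \<gamma>] by simp
  have "A \<ge> 0" unfolding A_def by (rule sum_nonneg) simp
  moreover have "A \<noteq> 0" using A by auto
  ultimately have "A > 0" by simp
  have "?g = 4 / of_int A" using A \<open>A \<noteq> 0\<close> by (simp add: field_simps)
  also have "\<dots> = of_rat (4 / of_int A)" using \<open>A \<noteq> 0\<close> by (simp add: of_rat_divide)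
  finally show ?thesis using \<open>A > 0\<close> by (intro exI[of _ "4 / of_int A"]) simp
qed

end

section \<open>Heights and the highest root\<close>

locale based_cartan_decomposition =
  cartan_decomposition scale Basis br t + simple_lie_with_base scale Basis br t simples
  for scale :: "'k::{alg_closed_field, field_char_0} \<Rightarrow> 'g::ab_group_add \<Rightarrow> 'g" (infixr \<open>*s\<close> 75)
  and Basis br t simples
begin

lemma simple_root: "\<beta> \<in> simples \<Longrightarrow> \<beta> \<in> roots"
  and simples_independent: "functionals.independent simples"
  and simples_span: "functionals.span simples = cartan_dual"
  using simple_system unfolding simple_system_def by auto

lemma simple_cartan_dual: "\<beta> \<in> simples \<Longrightarrow> \<beta> \<in> cartan_dual"
  by (intro root_cartan_dual simple_root)

definition combination :: "(('g \<Rightarrow> 'k) \<Rightarrow> int) \<Rightarrow> 'g \<Rightarrow> 'k"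
  where "combination m = (\<Sum>\<beta>\<in>simples. scale_fun (of_int (m \<beta>)) \<beta>)"

lemma finite_simples: "finite simples"
proof (rule ccontr)
  assume "infinite simples"
  then have "\<gamma> = 0" if "\<gamma> \<in> roots" for \<gamma>
    using simple_system that unfolding simple_system_def by fastforce
  then show False using roots_nonempty root_nonzero by blast
qed

lemma ht_combination:
  assumes "\<beta> \<in> simples" shows "ht \<beta> (combination m) = m \<beta>"
proof -
  have "functionals.representation simples (combination m) \<beta> =
      (\<Sum>\<delta>\<in>simples. functionals.representation simples (scale_fun (of_int (m \<delta>)) \<delta>) \<beta>)"
    unfolding combination_def
    by (subst functionals.representation_sum[OF simples_independent])
      (auto intro: functionals.span_scale functionals.span_base)
  also have "\<dots> = (\<Sum>\<delta>\<in>simples. if \<delta> = \<beta> then of_int (m \<beta>) else 0)"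
    by (intro sum.cong refl)
      (auto simp: functionals.representation_scale[OF simples_independent functionals.span_base]
        functionals.representation_basis[OF simples_independent])
  also have "\<dots> = of_int (m \<beta>)" using assms finite_simples by simp
  finally show ?thesis unfolding ht_def by (simp add: the_equality)
qed

lemma root_combination:
  assumes "\<gamma> \<in> roots"
  shows "\<gamma> = combination (\<lambda>\<beta>. ht \<beta> \<gamma>)"
    and "(\<forall>\<beta>\<in>simples. ht \<beta> \<gamma> \<ge> 0) \<or> (\<forall>\<beta>\<in>simples. ht \<beta> \<gamma> \<le> 0)"
proof -
  obtain m where m: "\<gamma> = combination m" "(\<forall>\<beta>\<in>simples. m \<beta> \<ge> 0) \<or> (\<forall>\<beta>\<in>simples. m \<beta> \<le> 0)"
    using simple_system assms unfolding simple_system_def combination_def by metis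
  have ht: "ht \<beta> \<gamma> = m \<beta>" if "\<beta> \<in> simples" for \<beta> unfolding m(1) by (rule ht_combination[OF that])
  have "combination m = combination (\<lambda>\<beta>. ht \<beta> \<gamma>)"
    unfolding combination_def by (intro sum.cong refl) (simp add: ht)
  then show "\<gamma> = combination (\<lambda>\<beta>. ht \<beta> \<gamma>)" using m(1) by simp
  show "(\<forall>\<beta>\<in>simples. ht \<beta> \<gamma> \<ge> 0) \<or> (\<forall>\<beta>\<in>simples. ht \<beta> \<gamma> \<le> 0)" using m(2) ht by simp
qed

lemma combination_add: "combination m + combination n = combination (\<lambda>\<beta>. m \<beta> + n \<beta>)"
  by (simp add: combination_def functionals.scale_left_distrib sum.distrib)

lemma combination_uminus: "- combination m = combination (\<lambda>\<beta>. - m \<beta>)"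
  by (simp add: combination_def functionals.scale_minus_left sum_negf)

lemma combination_zero: "combination (\<lambda>\<beta>. 0) = 0"
  by (simp add: combination_def)

lemma ht_zero: "\<beta> \<in> simples \<Longrightarrow> ht \<beta> 0 = 0"
  using ht_combination[of \<beta> "\<lambda>_. 0"] by (simp add: combination_zero)

lemma weight_combination: "\<mu> \<in> weights \<Longrightarrow> \<mu> = combination (\<lambda>\<beta>. ht \<beta> \<mu>)"
proof -
  assume "\<mu> \<in> weights"
  moreover have "combination (\<lambda>\<beta>. ht \<beta> 0) = combination (\<lambda>\<beta>. 0)"
    unfolding combination_def by (intro sum.cong refl) (simp add: ht_zero)
  ultimately show ?thesis using root_combination(1) combination_zero by (auto simp: weights_eq)
qed

lemma ht_add:
  assumes "\<beta> \<in> simples" "\<mu> \<in> weights" "\<nu> \<in> weights"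
  shows "ht \<beta> (\<mu> + \<nu>) = ht \<beta> \<mu> + ht \<beta> \<nu>"
proof -
  have "\<mu> + \<nu> = combination (\<lambda>\<beta>. ht \<beta> \<mu> + ht \<beta> \<nu>)"
    using weight_combination[OF assms(2)] weight_combination[OF assms(3)] combination_add by metis
  then show ?thesis using ht_combination[OF assms(1)] by metis
qed

lemma ht_uminus:
  assumes "\<beta> \<in> simples" "\<mu> \<in> weights" shows "ht \<beta> (- \<mu>) = - ht \<beta> \<mu>"
proof -
  have "- \<mu> = combination (\<lambda>\<beta>. - ht \<beta> \<mu>)"
    using weight_combination[OF assms(2)] combination_uminus by metis
  then show ?thesis using ht_combination[OF assms(1)] by metis
qed

lemma ht_simple:
  assumes "\<beta> \<in> simples" "\<alpha> \<in> simples" shows "ht \<beta> \<alpha> = (if \<beta> = \<alpha> then 1 else 0)"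
proof -
  have "combination (\<lambda>\<delta>. if \<delta> = \<alpha> then 1 else 0) = (\<Sum>\<delta>\<in>simples. if \<delta> = \<alpha> then \<alpha> else 0)"
    unfolding combination_def by (intro sum.cong refl) simp
  then have "combination (\<lambda>\<delta>. if \<delta> = \<alpha> then 1 else 0) = \<alpha>" using assms(2) finite_simples by simp
  then show ?thesis using ht_combination[OF assms(1), of "\<lambda>\<delta>. if \<delta> = \<alpha> then 1 else 0"] by simp
qed

lemma root_has_height:
  assumes "\<gamma> \<in> roots" shows "\<exists>\<beta>\<in>simples. ht \<beta> \<gamma> \<noteq> 0"
proof (rule ccontr)
  assume "\<not> ?thesis"
  then have "combination (\<lambda>\<beta>. ht \<beta> \<gamma>) = combination (\<lambda>\<beta>. 0)"
    unfolding combination_def by (intro sum.cong refl) simp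
  also have "\<dots> = 0" by (rule combination_zero)
  finally show False using root_combination(1)[OF assms] root_nonzero[OF assms] by argo
qed

lemma positive_rootsD:
  "\<gamma> \<in> positive_roots \<Longrightarrow> \<gamma> \<in> roots" "\<gamma> \<in> positive_roots \<Longrightarrow> \<beta> \<in> simples \<Longrightarrow> ht \<beta> \<gamma> \<ge> 0"
  by (auto simp: positive_roots_def)

lemma positive_root_height:
  assumes "\<gamma> \<in> positive_roots" shows "\<exists>\<beta>\<in>simples. ht \<beta> \<gamma> > 0"
  using root_has_height[of \<gamma>] positive_rootsD[OF assms] by (metis order_le_less)

lemma root_cases: "\<gamma> \<in> roots \<Longrightarrow> \<gamma> \<in> positive_roots \<or> - \<gamma> \<in> positive_roots"
  using root_combination(2)[of \<gamma>] root_uminus[of \<gamma>]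
  by (auto simp: positive_roots_def ht_uminus root_weight)

lemma positive_root_uminus:
  assumes "\<gamma> \<in> positive_roots" shows "- \<gamma> \<notin> positive_roots"
proof
  assume neg: "- \<gamma> \<in> positive_roots"
  obtain \<beta> where \<beta>: "\<beta> \<in> simples" "ht \<beta> \<gamma> > 0" using positive_root_height[OF assms] by blast
  then show False
    using positive_rootsD(2)[OF neg \<beta>(1)] positive_rootsD(1)[OF assms] by (simp add: ht_uminus root_weight)
qed

lemma roots_split: "roots = positive_roots \<union> uminus ` positive_roots"
proof -
  have "\<gamma> \<in> uminus ` positive_roots" if "- \<gamma> \<in> positive_roots" for \<gamma> :: "'g \<Rightarrow> 'k"
    using that by (intro image_eqI[of _ _ "- \<gamma>"]) auto
  then show ?thesis using root_cases root_uminus positive_rootsD(1) by auto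
qed

definition total_height :: "('g \<Rightarrow> 'k) \<Rightarrow> int"
  where "total_height \<mu> = (\<Sum>\<beta>\<in>simples. ht \<beta> \<mu>)"

lemma total_height_add:
  "\<mu> \<in> weights \<Longrightarrow> \<nu> \<in> weights \<Longrightarrow> total_height (\<mu> + \<nu>) = total_height \<mu> + total_height \<nu>"
  by (simp add: total_height_def ht_add sum.distrib)

lemma total_height_positive:
  assumes "\<gamma> \<in> positive_roots" shows "total_height \<gamma> > 0"
proof -
  obtain \<beta> where "\<beta> \<in> simples" "ht \<beta> \<gamma> > 0" using positive_root_height[OF assms] by blast
  then show ?thesis
    unfolding total_height_def by (intro sum_pos2[OF finite_simples]) (auto intro: positive_rootsD(2)[OF assms])
qed

inductive_set lowered :: "'g \<Rightarrow> 'g set" for x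
  where
    base: "x \<in> lowered x"
  | step: "w \<in> lowered x \<Longrightarrow> \<gamma> \<in> positive_roots \<Longrightarrow> f \<in> V (- \<gamma>) \<Longrightarrow> br f w \<in> lowered x"

text \<open>The words in negative root vectors applied to a vector killed by all positive root vectors span
  a submodule: a bracket with \<open>z\<close> from the left is moved inside by the Jacobi identity.\<close>

lemma lowered_ideal:
  assumes x: "x \<in> V \<theta>" and max: "\<And>\<gamma>. \<gamma> \<in> positive_roots \<Longrightarrow> \<theta> + \<gamma> \<notin> weights"
    and "v \<in> lowered x"
  shows "br z v \<in> span (lowered x)"
  using assms(3)
proof (induct arbitrary: z rule: lowered.induct)
  case base
  have part: "br z x \<in> span (lowered x)" if z: "z \<in> V \<mu>" and \<mu>: "\<mu> \<in> weights" for z \<mu>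
  proof -
    consider "\<mu> = 0" | "\<mu> \<in> positive_roots" | "- \<mu> \<in> positive_roots"
      using \<mu> root_cases by (auto simp: weights_eq)
    then show ?thesis
    proof cases
      case 1
      then have "br z x = \<theta> z *s x" using z x by (intro t_acts_diagonally) (simp add: V_zero)
      then show ?thesis by (simp add: span_scale span_base lowered.base)
    next
      case 2
      have "br z x \<in> V (\<mu> + \<theta>)" by (rule br_V[OF z x])
      then have "br z x = 0" using max[OF 2] by (simp add: add.commute weights_def)
      then show ?thesis by (simp add: span_zero)
    next
      case 3
      then show ?thesis using lowered.step[OF lowered.base 3, of z] z by (simp add: span_base)
    qed
  qed
  have "(\<Sum>\<mu>\<in>weights. br (wt.proj \<mu> z) x) \<in> span (lowered x)"
    by (rule span_sum) (rule part[OF wt.proj_mem])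
  then show ?case by (simp add: br_sum_left[symmetric] wt.sum_proj)
next
  case (step w \<gamma> f)
  have stable: "br f u \<in> span (lowered x)" if "u \<in> span (lowered x)" for u
    using step(3,4) by (intro endo_span[OF endo_br subspace_span _ that] span_base lowered.step)
  have "br (br z f) w + br f (br z w) \<in> span (lowered x)"
    by (rule span_add[OF step(2) stable[OF step(2)]])
  then show ?case by (simp only: br_br_right[of z f w])
qed

text \<open>For a root \<open>\<theta>\<close> of maximal total height this submodule is the whole algebra, by simplicity, so
  every root is \<open>\<theta>\<close> minus a sum of positive roots.\<close>

lemma highest_root_exists: "\<exists>\<theta>\<in>roots. \<forall>\<gamma>\<in>roots. \<forall>\<beta>\<in>simples. ht \<beta> \<gamma> \<le> ht \<beta> \<theta>"
proof -
  have "Max (total_height ` roots) \<in> total_height ` roots"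
    using finite_roots roots_nonempty by (intro Max_in) auto
  then obtain \<theta> where \<theta>: "\<theta> \<in> roots" "total_height \<theta> = Max (total_height ` roots)" by auto
  have le: "total_height \<gamma> \<le> total_height \<theta>" if "\<gamma> \<in> roots" for \<gamma>
    unfolding \<theta>(2) using finite_roots that by (intro Max_ge) auto
  obtain \<gamma>0 where "\<gamma>0 \<in> positive_roots" using roots_nonempty root_cases by blast
  then have pos: "total_height \<theta> > 0"
    using total_height_positive[of \<gamma>0] le[of \<gamma>0] positive_rootsD(1) by fastforce
  have max: "\<theta> + \<gamma> \<notin> weights" if \<gamma>: "\<gamma> \<in> positive_roots" for \<gamma>
  proof
    assume "\<theta> + \<gamma> \<in> weights"
    moreover have "total_height (\<theta> + \<gamma>) > total_height \<theta>"
      using total_height_positive[OF \<gamma>] \<theta>(1) positive_rootsD(1)[OF \<gamma>]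
      by (simp add: total_height_add root_weight)
    moreover have "total_height 0 = 0" by (simp add: total_height_def ht_zero)
    ultimately show False using le[of "\<theta> + \<gamma>"] pos by (auto simp: weights_eq)
  qed
  obtain x where x: "x \<in> V \<theta>" "x \<noteq> 0"
    using weight_vector_exists[OF root_weight[OF \<theta>(1)]] by blast
  let ?S = "span (lowered x)"
  have "lie_ideal ?S"
    unfolding lie_ideal_def
  proof (intro conjI allI ballI)
    fix z v assume v: "v \<in> ?S"
    show "br z v \<in> ?S"
      by (rule endo_span[OF endo_br subspace_span _ v]) (rule lowered_ideal[OF x(1) max])
  qed simp
  moreover have "x \<in> ?S" by (intro span_base lowered.base)
  ultimately have S: "?S = UNIV" using simple[of ?S] x(2) by auto
  \<comment> \<open>holds for the degree of every lowered word, also when that degree is not a weight\<close>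
  define P where "P \<mu> \<longleftrightarrow> (\<exists>m. \<mu> = combination m \<and> (\<forall>\<beta>\<in>simples. m \<beta> \<le> ht \<beta> \<theta>))" for \<mu>
  have low: "\<exists>\<mu>. P \<mu> \<and> v \<in> V \<mu>" if "v \<in> lowered x" for v
    using that
  proof induct
    case base
    have "P \<theta>" unfolding P_def using root_combination(1)[OF \<theta>(1)] by blast
    then show ?case using x(1) by blast
  next
    case (step w \<gamma> f)
    then obtain \<mu> m where \<mu>: "w \<in> V \<mu>" "\<mu> = combination m" "\<forall>\<beta>\<in>simples. m \<beta> \<le> ht \<beta> \<theta>"
      unfolding P_def by blast
    have "- \<gamma> + \<mu> = combination (\<lambda>\<beta>. - ht \<beta> \<gamma> + m \<beta>)"
      using root_combination(1)[OF positive_rootsD(1)[OF step(3)]] \<mu>(2) combination_uminus combination_add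
      by metis
    moreover have "\<forall>\<beta>\<in>simples. - ht \<beta> \<gamma> + m \<beta> \<le> ht \<beta> \<theta>"
      using \<mu>(3) positive_rootsD(2)[OF step(3)] by fastforce
    ultimately have "P (- \<gamma> + \<mu>)" unfolding P_def by blast
    then show ?case using br_V[OF step(4) \<mu>(1)] by blast
  qed
  have "P \<gamma>" if \<gamma>: "\<gamma> \<in> roots" for \<gamma>
  proof (rule ccontr)
    assume "\<not> P \<gamma>"
    have word: "wt.proj \<gamma> v = 0" if "v \<in> lowered x" for v
      using low[OF that] \<open>\<not> P \<gamma>\<close> wt.proj_part[of v _ \<gamma>] by auto
    have "wt.proj \<gamma> v = 0" for v
    proof (rule endo_span_zero[OF wt.endo_proj])
      show "v \<in> ?S" unfolding S by (rule UNIV_I)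
    qed (rule word)
    then have "V \<gamma> = {0}"
      using wt.proj_self[of _ \<gamma>] subspace_0[OF subspace_V[of \<gamma>]] by auto
    then show False using root_weight[OF \<gamma>] by (simp add: weights_def)
  qed
  then have "\<forall>\<gamma>\<in>roots. \<forall>\<beta>\<in>simples. ht \<beta> \<gamma> \<le> ht \<beta> \<theta>"
    unfolding P_def using ht_combination by metis
  then show ?thesis using \<theta>(1) by blast
qed

lemma highest_root_root: "highest_root \<in> roots"
  and highest_root_max: "\<gamma> \<in> roots \<Longrightarrow> \<beta> \<in> simples \<Longrightarrow> ht \<beta> \<gamma> \<le> ht \<beta> highest_root"
proof -
  obtain \<theta> where \<theta>: "\<theta> \<in> roots" "\<forall>\<gamma>\<in>roots. \<forall>\<beta>\<in>simples. ht \<beta> \<gamma> \<le> ht \<beta> \<theta>"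
    using highest_root_exists by blast
  have "highest_root = \<theta>"
    unfolding highest_root_def
  proof (rule the_equality)
    show "\<theta> \<in> roots \<and> (\<forall>\<gamma>\<in>roots. \<forall>\<beta>\<in>simples. ht \<beta> \<gamma> \<le> ht \<beta> \<theta>)" using \<theta> by blast
    fix \<kappa> assume \<kappa>: "\<kappa> \<in> roots \<and> (\<forall>\<gamma>\<in>roots. \<forall>\<beta>\<in>simples. ht \<beta> \<gamma> \<le> ht \<beta> \<kappa>)"
    then have "ht \<beta> \<kappa> = ht \<beta> \<theta>" if "\<beta> \<in> simples" for \<beta> using \<theta> that by (meson order_antisym)
    then have "combination (\<lambda>\<beta>. ht \<beta> \<kappa>) = combination (\<lambda>\<beta>. ht \<beta> \<theta>)"
      unfolding combination_def by (intro sum.cong refl) simp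
    then show "\<kappa> = \<theta>" using root_combination(1) \<kappa> \<theta>(1) by metis
  qed
  then show "highest_root \<in> roots"
    "\<gamma> \<in> roots \<Longrightarrow> \<beta> \<in> simples \<Longrightarrow> ht \<beta> \<gamma> \<le> ht \<beta> highest_root" using \<theta> by auto
qed

lemma highest_root_positive: "\<beta> \<in> simples \<Longrightarrow> ht \<beta> highest_root \<ge> 1"
  using highest_root_max[of \<beta> \<beta>] simple_root ht_simple[of \<beta> \<beta>] by simp

lemma weight_height_le: "\<mu> \<in> weights \<Longrightarrow> \<beta> \<in> simples \<Longrightarrow> ht \<beta> \<mu> \<le> ht \<beta> highest_root"
  using highest_root_max[of \<mu> \<beta>] highest_root_positive[of \<beta>] ht_zero[of \<beta>] by (auto simp: weights_eq)

lemma highest_root_add: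
  assumes "\<gamma> \<in> positive_roots" shows "\<gamma> + highest_root \<notin> weights"
proof
  assume w: "\<gamma> + highest_root \<in> weights"
  obtain \<beta> where \<beta>: "\<beta> \<in> simples" "ht \<beta> \<gamma> > 0" using positive_root_height[OF assms] by blast
  have "ht \<beta> (\<gamma> + highest_root) = ht \<beta> \<gamma> + ht \<beta> highest_root"
    using assms by (intro ht_add \<beta> root_weight highest_root_root positive_rootsD(1))
  then show False using weight_height_le[OF w \<beta>(1)] \<beta>(2) by simp
qed

text \<open>The trace \<open>K(x, y) = tr (ad y ad x)\<close> for \<open>x\<close> in the highest root space and \<open>y\<close> in the opposite
  one is read off weight by weight: \<open>ad x\<close> kills the positive root spaces, \<open>ad y\<close> kills the negative
  ones, and \<open>[x, y]\<close> is dual to \<open>\<theta>\<close>.\<close>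

lemma dual_coxeter_highest_root:
  "dual_coxeter * dual_form highest_root highest_root = 1"
proof -
  let ?\<theta> = highest_root
  note \<theta> = root_weight[OF highest_root_root] and dual = root_cartan_dual[OF highest_root_root]
  obtain x y where xy: "x \<in> V ?\<theta>" "y \<in> V (- ?\<theta>)" "killing x y = 1" "br x y = killing_dual_vector ?\<theta>"
    by (rule weight_pair_exists[OF \<theta>])
  let ?T = "\<lambda>\<mu>. trace (\<lambda>z. wt.proj \<mu> (br y (br x z)))"
  have pos: "?T \<gamma> = 0" if "\<gamma> \<in> positive_roots" for \<gamma>
    by (rule wt.trace_step_zero[OF xy(1,2)]) (simp add: highest_root_add that)
  have neg: "?T (- \<gamma>) = dual_form \<gamma> ?\<theta>" if \<gamma>: "\<gamma> \<in> positive_roots" for \<gamma>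
  proof -
    have "- \<gamma> - ?\<theta> \<notin> weights"
      using highest_root_add[OF \<gamma>] weight_uminus[of "- \<gamma> - ?\<theta>"] by (auto simp: add.commute)
    then have "?T (- \<gamma> - ?\<theta>) = 0" by (intro wt.trace_step_zero[OF xy(1,2)]) simp
    moreover have "?T (- \<gamma> - ?\<theta>) = ?T (- \<gamma>) + trace (\<lambda>z. wt.proj (- \<gamma>) (br (br x y) z))"
      using wt.trace_step[OF xy(1,2), of "- \<gamma> - ?\<theta>"] by simp
    moreover have "trace (\<lambda>z. wt.proj (- \<gamma>) (br (br x y) z)) = - dual_form \<gamma> ?\<theta>"
      using mult_root_multiples(1)[OF root_uminus[OF positive_rootsD(1)[OF \<gamma>]]]
      by (simp add: xy(4) trace_weight[OF killing_dual_vector(1)[OF dual]] dual_form_eq dual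
          root_cartan_dual positive_rootsD(1)[OF \<gamma>])
    ultimately show ?thesis by simp
  qed
  have fin: "finite positive_roots" using finite_roots by (rule rev_finite_subset) (auto simp: positive_roots_def)
  have zero: "0 \<notin> positive_roots \<union> uminus ` positive_roots" using root_nonzero by (metis roots_split)
  have disj: "positive_roots \<inter> uminus ` positive_roots = {}" using positive_root_uminus by auto
  have "1 = trace (\<lambda>z. br y (br x z))" using xy(3) killing_commute[of x y] by (simp add: killing_def)
  also have "\<dots> = (\<Sum>\<mu>\<in>weights. ?T \<mu>)" by (rule wt.trace_decompose)
  also have "\<dots> = ?T 0 + ((\<Sum>\<mu>\<in>positive_roots. ?T \<mu>) + (\<Sum>\<mu>\<in>uminus ` positive_roots. ?T \<mu>))"
    unfolding weights_eq roots_split using zero fin disj by (simp add: sum.union_disjoint)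
  also have "(\<Sum>\<mu>\<in>uminus ` positive_roots. ?T \<mu>) = (\<Sum>\<gamma>\<in>positive_roots. dual_form \<gamma> ?\<theta>)"
    by (subst sum.reindex) (simp_all add: neg inj_on_def)
  also have "?T 0 = dual_form ?\<theta> ?\<theta>" using trace_zero_part[OF xy(1,2) \<theta>] xy(3) by simp
  also have "(\<Sum>\<mu>\<in>positive_roots. ?T \<mu>) = 0" by (simp add: pos)
  finally have one: "1 = dual_form ?\<theta> ?\<theta> + (\<Sum>\<gamma>\<in>positive_roots. dual_form \<gamma> ?\<theta>)" by simp
  have mem: "\<gamma> \<in> cartan_dual" if "\<gamma> \<in> positive_roots" for \<gamma>
    using that by (intro root_cartan_dual positive_rootsD(1))
  have "(\<Sum>\<gamma>\<in>positive_roots. \<gamma>) \<in> cartan_dual"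
    by (intro functionals.subspace_sum[OF subspace_cartan_dual] mem)
  then have "2 * dual_form rho ?\<theta> = (\<Sum>\<gamma>\<in>positive_roots. dual_form \<gamma> ?\<theta>)"
    unfolding rho_def by (simp add: dual_form_scale_left dual_form_sum_left[OF mem dual] dual)
  then have "dual_coxeter = 1 + (\<Sum>\<gamma>\<in>positive_roots. dual_form \<gamma> ?\<theta>) / dual_form ?\<theta> ?\<theta>"
    unfolding dual_coxeter_def by simp
  then show ?thesis
    using one dual_form_root_nonzero[OF highest_root_root] by (simp add: distrib_right)
qed

section \<open>Inner products with the simple roots\<close>

lemma zero_if_orthogonal_to_simples:
  assumes f: "f \<in> cartan_dual" and "\<And>\<beta>. \<beta> \<in> simples \<Longrightarrow> dual_form f \<beta> = 0"
  shows "f = 0"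
proof (rule dual_form_nondegenerate[OF f])
  fix g assume g: "g \<in> cartan_dual"
  note sub = subspace_cartan_dual
  have "functionals.subspace {g \<in> cartan_dual. dual_form g f = 0}"
  proof (rule functionals.subspaceI)
    show "0 \<in> {g \<in> cartan_dual. dual_form g f = 0}"
      using functionals.subspace_0[OF sub] f by (simp add: dual_form_eq)
  qed (auto simp: functionals.subspace_add[OF sub] functionals.subspace_scale[OF sub]
      dual_form_add_left dual_form_scale_left f)
  moreover have "simples \<subseteq> {g \<in> cartan_dual. dual_form g f = 0}"
    using assms(2) simple_root root_cartan_dual by (auto simp: dual_form_commute[of _ f])
  ultimately have "functionals.span simples \<subseteq> {g \<in> cartan_dual. dual_form g f = 0}"
    by (rule functionals.span_minimal[rotated])
  then show "dual_form f g = 0" using g simples_span by (auto simp: dual_form_commute[of f])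
qed

lemma eq_if_equal_on_simples:
  assumes f: "f \<in> cartan_dual" and g: "g \<in> cartan_dual"
    and eq: "\<And>\<beta>. \<beta> \<in> simples \<Longrightarrow> dual_form f \<beta> = dual_form g \<beta>"
  shows "f = g"
proof -
  have neg: "scale_fun (- 1) g \<in> cartan_dual" by (rule functionals.subspace_scale[OF subspace_cartan_dual g])
  have "f + scale_fun (- 1) g = 0"
  proof (rule zero_if_orthogonal_to_simples)
    show "f + scale_fun (- 1) g \<in> cartan_dual" by (rule functionals.subspace_add[OF subspace_cartan_dual f neg])
    fix \<beta> assume \<beta>: "\<beta> \<in> simples"
    note mem = simple_cartan_dual[OF \<beta>]
    show "dual_form (f + scale_fun (- 1) g) \<beta> = 0"
      unfolding dual_form_add_left[OF f neg mem] dual_form_scale_left[OF g mem] using eq[OF \<beta>] by simp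
  qed
  then show ?thesis by (simp add: functionals.scale_minus_left)
qed

lemma dual_form_expand:
  assumes f: "f \<in> cartan_dual" and \<gamma>: "\<gamma> \<in> roots"
  shows "dual_form f \<gamma> = (\<Sum>\<beta>\<in>simples. of_int (ht \<beta> \<gamma>) * dual_form f \<beta>)"
proof -
  note mem = simple_cartan_dual
  have "dual_form \<gamma> f = dual_form (\<Sum>\<beta>\<in>simples. scale_fun (of_int (ht \<beta> \<gamma>)) \<beta>) f"
    using root_combination(1)[OF \<gamma>] by (simp only: combination_def[symmetric])
  also have "\<dots> = (\<Sum>\<beta>\<in>simples. of_int (ht \<beta> \<gamma>) * dual_form \<beta> f)"
    by (subst dual_form_sum_left)
      (auto intro!: functionals.subspace_scale[OF subspace_cartan_dual] sum.cong
        simp: mem f dual_form_scale_left)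
  finally show ?thesis unfolding dual_form_commute[of f] .
qed

section \<open>All heights between \<open>1\<close> and the maximum occur\<close>

text \<open>If a positive root had no positive inner product with any simple root in its support, then
  \<open>(\<gamma>, \<gamma>) \<le> 0\<close>.\<close>

lemma positive_root_descends:
  assumes "\<gamma> \<in> positive_roots"
  shows "\<exists>\<beta>\<in>simples. \<gamma> - \<beta> \<in> weights"
proof (rule ccontr)
  assume no: "\<not> ?thesis"
  note \<gamma> = positive_rootsD(1)[OF assms]
  obtain a :: "('g \<Rightarrow> 'k) \<Rightarrow> int" where
    a: "\<And>\<beta>. \<beta> \<in> simples \<Longrightarrow> 2 * dual_form \<gamma> \<beta> = of_int (a \<beta>) * dual_form \<beta> \<beta>"
      "\<And>\<beta>. \<beta> \<in> simples \<Longrightarrow> a \<beta> > 0 \<Longrightarrow> \<gamma> - \<beta> \<in> weights"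
    using cartan_integer[OF \<gamma> simple_root] by metis
  obtain r where r: "\<And>\<beta>. \<beta> \<in> simples \<Longrightarrow> r \<beta> > 0" "\<And>\<beta>. \<beta> \<in> simples \<Longrightarrow> dual_form \<beta> \<beta> = of_rat (r \<beta>)"
    using dual_form_root_positive[OF simple_root] by metis
  obtain s where s: "s > 0" "dual_form \<gamma> \<gamma> = of_rat s" using dual_form_root_positive[OF \<gamma>] by blast
  have "2 * dual_form \<gamma> \<gamma> = (\<Sum>\<beta>\<in>simples. of_int (ht \<beta> \<gamma>) * (2 * dual_form \<gamma> \<beta>))"
    by (subst dual_form_expand[OF root_cartan_dual[OF \<gamma>] \<gamma>]) (simp add: sum_distrib_left mult.left_commute)
  also have "\<dots> = of_rat (\<Sum>\<beta>\<in>simples. of_int (ht \<beta> \<gamma> * a \<beta>) * r \<beta>)"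
    by (simp add: a r of_rat_sum of_rat_mult mult.assoc)
  finally have "(of_rat (2 * s) :: 'k) = of_rat (\<Sum>\<beta>\<in>simples. of_int (ht \<beta> \<gamma> * a \<beta>) * r \<beta>)"
    using s(2) by (simp add: of_rat_mult)
  then have "2 * s = (\<Sum>\<beta>\<in>simples. of_int (ht \<beta> \<gamma> * a \<beta>) * r \<beta>)" by (simp only: of_rat_eq_iff)
  also have "\<dots> \<le> 0"
  proof (rule sum_nonpos)
    fix \<beta> assume \<beta>: "\<beta> \<in> simples"
    then have "a \<beta> \<le> 0" using a(2) no by force
    then have "ht \<beta> \<gamma> * a \<beta> \<le> 0" using positive_rootsD(2)[OF assms \<beta>] by (simp add: mult_nonneg_nonpos)
    then have "(of_int (ht \<beta> \<gamma> * a \<beta>) :: rat) \<le> 0" by (simp only: of_int_le_0_iff)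
    then show "of_int (ht \<beta> \<gamma> * a \<beta>) * r \<beta> \<le> 0" using r(1)[OF \<beta>] by (simp add: mult_nonpos_nonneg)
  qed
  finally show False using s(1) by simp
qed

text \<open>Descending from \<open>\<gamma>\<close> by simple roots lowers the \<open>\<alpha>\<close>-height by at most one in each step.\<close>

lemma height_occurs:
  assumes \<alpha>: "\<alpha> \<in> simples" and "\<gamma> \<in> roots" "1 \<le> k" "k \<le> ht \<alpha> \<gamma>"
  shows "\<exists>\<delta>\<in>roots. ht \<alpha> \<delta> = k"
  using assms(2-)
proof (induct "nat (total_height \<gamma>)" arbitrary: \<gamma> rule: less_induct)
  case less
  have pos: "\<gamma> \<in> positive_roots"
    using root_combination(2)[OF less.prems(1)] less.prems \<alpha> by (fastforce simp: positive_roots_def)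
  show ?case
  proof (cases "k = ht \<alpha> \<gamma>")
    case False
    obtain \<beta> where \<beta>: "\<beta> \<in> simples" "\<gamma> - \<beta> \<in> weights" using positive_root_descends[OF pos] by blast
    have ht: "ht \<delta> \<gamma> = ht \<delta> (\<gamma> - \<beta>) + ht \<delta> \<beta>" if "\<delta> \<in> simples" for \<delta>
      using ht_add[OF that \<beta>(2) root_weight[OF simple_root[OF \<beta>(1)]]] by simp
    have k: "k \<le> ht \<alpha> (\<gamma> - \<beta>)" using ht[OF \<alpha>] ht_simple[OF \<alpha> \<beta>(1)] False less.prems by (auto split: if_splits)
    then have "\<gamma> - \<beta> \<noteq> 0" using less.prems(2) ht_zero[OF \<alpha>] by auto
    then have "\<gamma> - \<beta> \<in> roots" using \<beta>(2) by (simp add: roots_eq)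
    moreover have "total_height \<gamma> = total_height (\<gamma> - \<beta>) + total_height \<beta>"
      using total_height_add[OF \<beta>(2) root_weight[OF simple_root[OF \<beta>(1)]]] by simp
    moreover have "total_height \<beta> > 0"
      using \<beta>(1) by (intro total_height_positive) (simp add: positive_roots_def simple_root ht_simple)
    moreover have "total_height \<gamma> > 0" by (rule total_height_positive[OF pos])
    ultimately show ?thesis using less.hyps[of "\<gamma> - \<beta>"] less.prems(2) k by simp
  qed (use less.prems in blast)
qed

section \<open>Fundamental weights\<close>

text \<open>An \<open>h \<in> t\<close> is dual to the functional \<open>K(h, \<cdot>)\<close> on \<open>t\<close>; the value of the fundamental weight at \<open>h\<close> is
  the \<open>\<alpha>\<close>-coordinate of that functional, up to the factor \<open>(\<alpha>, \<alpha>) / 2\<close>.\<close>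

lemma fundamental_weight_exists:
  assumes "\<alpha> \<in> simples"
  shows "\<exists>\<phi>\<in>cartan_dual. \<forall>\<beta>\<in>simples. dual_form \<phi> \<beta> = (if \<beta> = \<alpha> then dual_form \<alpha> \<alpha> / 2 else 0)"
proof -
  define D where "D h x = (if x \<in> t then killing h x else 0)" for h x
  let ?rep = "functionals.representation simples"
  define \<phi> where "\<phi> h = (if h \<in> t then ?rep (D h) \<alpha> * (dual_form \<alpha> \<alpha> / 2) else 0)" for h
  have D: "D h \<in> functionals.span simples" for h
    unfolding simples_span cartan_dual_def D_def
    by (simp add: subspace_add subspace_scale subspace_t linear_form_add[OF linear_form_killing_right]
        linear_form_scale[OF linear_form_killing_right])
  have "D (h + k) = D h + D k" "D (c *s h) = scale_fun c (D h)" for h k c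
    by (auto simp: D_def fun_eq_iff scale_fun_def killing_add_left killing_scale_left)
  then have \<phi>: "\<phi> \<in> cartan_dual"
    by (simp add: cartan_dual_def \<phi>_def subspace_add subspace_scale subspace_t distrib_right
        functionals.representation_add[OF simples_independent D D]
        functionals.representation_scale[OF simples_independent D])
  have "dual_form \<phi> \<beta> = (if \<beta> = \<alpha> then dual_form \<alpha> \<alpha> / 2 else 0)" if \<beta>: "\<beta> \<in> simples" for \<beta>
  proof -
    note mem = simple_cartan_dual[OF \<beta>]
    have "D (killing_dual_vector \<beta>) = \<beta>"
      using killing_dual_vector(2)[OF mem] cartan_dual_outside[OF mem] by (auto simp: D_def fun_eq_iff)
    then show ?thesis
      by (simp add: dual_form_eq[OF \<phi> mem] \<phi>_def killing_dual_vector(1)[OF mem]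
          functionals.representation_basis[OF simples_independent \<beta>])
  qed
  then show ?thesis using \<phi> by blast
qed

lemma fundamental_weight:
  assumes "\<alpha> \<in> simples"
  shows "fundamental_weight \<alpha> \<in> cartan_dual"
    and "\<beta> \<in> simples \<Longrightarrow>
      dual_form (fundamental_weight \<alpha>) \<beta> = (if \<beta> = \<alpha> then dual_form \<alpha> \<alpha> / 2 else 0)"
proof -
  obtain \<phi> where \<phi>: "\<phi> \<in> cartan_dual"
    "\<And>\<beta>. \<beta> \<in> simples \<Longrightarrow> dual_form \<phi> \<beta> = (if \<beta> = \<alpha> then dual_form \<alpha> \<alpha> / 2 else 0)"
    using fundamental_weight_exists[OF assms] by blast
  note nz = dual_form_root_nonzero[OF simple_root]
  have "fundamental_weight \<alpha> = \<phi>"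
    unfolding fundamental_weight_def
  proof (rule the_equality)
    show "\<phi> \<in> cartan_dual \<and>
        (\<forall>\<beta>\<in>simples. 2 * dual_form \<phi> \<beta> / dual_form \<beta> \<beta> = (if \<beta> = \<alpha> then 1 else 0))"
      using \<phi> nz by auto
    fix \<psi> assume \<psi>: "\<psi> \<in> cartan_dual \<and>
        (\<forall>\<beta>\<in>simples. 2 * dual_form \<psi> \<beta> / dual_form \<beta> \<beta> = (if \<beta> = \<alpha> then 1 else 0))"
    show "\<psi> = \<phi>"
    proof (rule eq_if_equal_on_simples)
      show "\<psi> \<in> cartan_dual" using \<psi> by blast
      show "\<phi> \<in> cartan_dual" by (rule \<phi>(1))
      fix \<beta> assume \<beta>: "\<beta> \<in> simples"
      then have "2 * dual_form \<psi> \<beta> / dual_form \<beta> \<beta> = (if \<beta> = \<alpha> then 1 else 0)" using \<psi> by blast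
      then show "dual_form \<psi> \<beta> = dual_form \<phi> \<beta>"
        using nz[OF \<beta>] \<phi>(2)[OF \<beta>] by (auto simp: field_simps split: if_splits)
    qed
  qed
  then show "fundamental_weight \<alpha> \<in> cartan_dual"
    "\<beta> \<in> simples \<Longrightarrow>
      dual_form (fundamental_weight \<alpha>) \<beta> = (if \<beta> = \<alpha> then dual_form \<alpha> \<alpha> / 2 else 0)"
    using \<phi> by auto
qed

lemma fundamental_weight_nonzero:
  assumes \<alpha>: "\<alpha> \<in> simples" shows "fundamental_weight \<alpha> \<noteq> 0"
proof
  assume "fundamental_weight \<alpha> = 0"
  then have "dual_form 0 \<alpha> = dual_form \<alpha> \<alpha> / 2" using fundamental_weight(2)[OF \<alpha> \<alpha>] by simp
  moreover have "dual_form 0 \<alpha> = 0"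
    using functionals.subspace_0[OF subspace_cartan_dual] simple_cartan_dual[OF \<alpha>]
    by (simp add: dual_form_eq)
  ultimately show False using dual_form_root_nonzero[OF simple_root[OF \<alpha>]] by simp
qed

lemma dual_form_fundamental_weight_root:
  assumes \<alpha>: "\<alpha> \<in> simples" and \<gamma>: "\<gamma> \<in> roots"
  shows "dual_form (fundamental_weight \<alpha>) \<gamma> = of_int (ht \<alpha> \<gamma>) * (dual_form \<alpha> \<alpha> / 2)"
proof -
  note \<phi> = fundamental_weight[OF \<alpha>]
  have "dual_form (fundamental_weight \<alpha>) \<gamma> =
      (\<Sum>\<beta>\<in>simples. if \<beta> = \<alpha> then of_int (ht \<alpha> \<gamma>) * (dual_form \<alpha> \<alpha> / 2) else 0)"
    unfolding dual_form_expand[OF \<phi>(1) \<gamma>] by (intro sum.cong refl) (simp add: \<phi>(2))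
  then show ?thesis using \<alpha> finite_simples by simp
qed

section \<open>The grading by a simple root\<close>

lemma V_subset_grade: "\<mu> \<in> weights \<Longrightarrow> V \<mu> \<subseteq> grade \<alpha> (ht \<alpha> \<mu>)" if "\<alpha> \<in> simples"
proof -
  assume "\<mu> \<in> weights"
  then consider "\<mu> = 0" | "\<mu> \<in> roots" by (auto simp: weights_eq)
  then show ?thesis
  proof cases
    case 1
    then show ?thesis
      unfolding grade_def using span_superset[of "t \<union> \<Union> (root_space ` roots_of_height \<alpha> 0)"]
      by (auto simp: ht_zero[OF that] V_zero)
  next
    case 2
    then have "V \<mu> \<subseteq> (\<Union>\<gamma>\<in>roots_of_height \<alpha> (ht \<alpha> \<mu>). root_space \<gamma>)"
      by (auto simp: roots_of_height_def V_root)
    then show ?thesis unfolding grade_def using span_superset by blast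
  qed
qed

lemma subspace_grade: "subspace (grade \<alpha> i)"
  by (simp add: grade_def)

lemma grade_proj:
  assumes \<alpha>: "\<alpha> \<in> simples" and x: "x \<in> grade \<alpha> i" and "ht \<alpha> \<mu> \<noteq> i"
  shows "wt.proj \<mu> x = 0"
proof -
  have part: "wt.proj \<mu> x = 0" if mem: "x \<in> (if i = 0 then t else {}) \<union> (\<Union>\<gamma>\<in>roots_of_height \<alpha> i. root_space \<gamma>)" for x
  proof -
    consider "i = 0" "x \<in> V 0" | \<nu> where "\<nu> \<in> roots" "ht \<alpha> \<nu> = i" "x \<in> V \<nu>"
      using mem by (auto simp: V_zero roots_of_height_def V_root split: if_splits)
    then show ?thesis using ht_zero[OF \<alpha>] assms(3) by cases (auto simp: wt.proj_part)
  qed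
  show ?thesis
    by (rule endo_span_zero[OF wt.endo_proj _ x[unfolded grade_def]]) (rule part)
qed

definition grade_part :: "('g \<Rightarrow> 'k) \<Rightarrow> int \<Rightarrow> 'g \<Rightarrow> 'g"
  where "grade_part \<alpha> i x = (\<Sum>\<mu>\<in>{\<mu>\<in>weights. ht \<alpha> \<mu> = i}. wt.proj \<mu> x)"

lemma grade_part_mem: "\<alpha> \<in> simples \<Longrightarrow> grade_part \<alpha> i x \<in> grade \<alpha> i"
  unfolding grade_part_def using V_subset_grade wt.proj_mem
  by (intro subspace_sum subspace_grade) blast

lemma sum_grade_part: "(\<Sum>i\<in>ht \<alpha> ` weights. grade_part \<alpha> i x) = x"
  unfolding grade_part_def
  using sum.image_gen[OF finite_weights, of "\<lambda>\<mu>. wt.proj \<mu> x" "ht \<alpha>"] by (simp add: wt.sum_proj)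

lemma grade_part_self:
  assumes "\<alpha> \<in> simples" "x \<in> grade \<alpha> i" shows "grade_part \<alpha> i x = x"
proof -
  have "(\<Sum>\<mu>\<in>{\<mu>\<in>weights. ht \<alpha> \<mu> = i}. wt.proj \<mu> x) = (\<Sum>\<mu>\<in>weights. wt.proj \<mu> x)"
    using grade_proj[OF assms] finite_weights by (intro sum.mono_neutral_left) auto
  then show ?thesis by (simp add: grade_part_def wt.sum_proj)
qed

text \<open>Heights of weights are additive, so the weight grading coarsens to one by integers.\<close>

lemma grade_graded:
  assumes \<alpha>: "\<alpha> \<in> simples"
  shows "graded_lie_algebra scale Basis br (ht \<alpha> ` weights) (grade \<alpha>)"
proof
  show "finite (ht \<alpha> ` weights)" using finite_weights by simp
  show "subspace (grade \<alpha> i)" for i by (rule subspace_grade)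
  show "grade \<alpha> i = {0}" if "i \<notin> ht \<alpha> ` weights" for i
  proof -
    have "i \<noteq> 0" using that zero_weight ht_zero[OF \<alpha>] by force
    moreover have "roots_of_height \<alpha> i = {}" using that by (auto simp: roots_of_height_def weights_eq)
    ultimately show ?thesis by (simp add: grade_def)
  qed
  show "\<exists>v. (\<forall>i. v i \<in> grade \<alpha> i) \<and> x = sum v (ht \<alpha> ` weights)" for x
    using grade_part_mem[OF \<alpha>] sum_grade_part[of \<alpha> x]
    by (intro exI[of _ "\<lambda>i. grade_part \<alpha> i x"]) auto
  show "v i = 0" if v: "\<And>i. v i \<in> grade \<alpha> i" "sum v (ht \<alpha> ` weights) = 0" for v i
  proof -
    have "wt.proj \<mu> (v i) = 0" if \<mu>: "\<mu> \<in> weights" for \<mu>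
    proof (cases "ht \<alpha> \<mu> = i")
      case True
      have "wt.proj \<mu> (sum v (ht \<alpha> ` weights)) = (\<Sum>j\<in>ht \<alpha> ` weights. wt.proj \<mu> (v j))"
        by (rule endo_sum[OF wt.endo_proj])
      also have "\<dots> = (\<Sum>j\<in>ht \<alpha> ` weights. if j = i then wt.proj \<mu> (v i) else 0)"
        using grade_proj[OF \<alpha> v(1), of \<mu>] True by (intro sum.cong refl) auto
      also have "\<dots> = wt.proj \<mu> (v i)" using True \<mu> finite_weights by auto
      finally show ?thesis using v(2) by (simp add: endo_zero[OF wt.endo_proj])
    qed (rule grade_proj[OF \<alpha> v(1)])
    then have "(\<Sum>\<mu>\<in>weights. wt.proj \<mu> (v i)) = 0" by simp
    then show ?thesis by (simp add: wt.sum_proj)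
  qed
  show "br x y \<in> grade \<alpha> (i + j)" if x: "x \<in> grade \<alpha> i" and y: "y \<in> grade \<alpha> j" for x y i j
  proof -
    have "br (wt.proj \<mu> x) (wt.proj \<nu> y) \<in> grade \<alpha> (i + j)"
      if \<mu>: "\<mu> \<in> weights" "ht \<alpha> \<mu> = i" and \<nu>: "\<nu> \<in> weights" "ht \<alpha> \<nu> = j" for \<mu> \<nu>
    proof (cases "\<mu> + \<nu> \<in> weights")
      case True
      then show ?thesis
        using br_V[OF wt.proj_mem wt.proj_mem, of \<mu> x \<nu> y] V_subset_grade[OF \<alpha> True]
          ht_add[OF \<alpha> \<mu>(1) \<nu>(1)] \<mu>(2) \<nu>(2) by auto
    next
      case False
      then have "br (wt.proj \<mu> x) (wt.proj \<nu> y) = 0"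
        using br_V[OF wt.proj_mem wt.proj_mem, of \<mu> x \<nu> y] by (simp add: weights_def)
      then show ?thesis by (simp add: subspace_0 subspace_grade)
    qed
    then have "br (grade_part \<alpha> i x) (grade_part \<alpha> j y) \<in> grade \<alpha> (i + j)"
      unfolding grade_part_def br_sum_left br_sum_right by (intro subspace_sum subspace_grade) auto
    then show ?thesis by (simp add: grade_part_self[OF \<alpha>] x y)
  qed
qed

lemma grade_proj_eq:
  assumes \<alpha>: "\<alpha> \<in> simples"
  shows "direct_sum.proj (ht \<alpha> ` weights) (grade \<alpha>) i x = grade_part \<alpha> i x"
proof -
  interpret gr: graded_lie_algebra scale Basis br "ht \<alpha> ` weights" "grade \<alpha>"
    by (rule grade_graded[OF \<alpha>])
  show ?thesis by (rule gr.proj_unique) (simp_all add: grade_part_mem[OF \<alpha>] sum_grade_part)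
qed

text \<open>Roots have multiplicity one, and the weight 0 contributes nothing.\<close>

lemma trace_grade:
  assumes \<alpha>: "\<alpha> \<in> simples" and h: "h \<in> t"
  shows "trace (\<lambda>z. grade_part \<alpha> i (br h z)) = (\<Sum>\<gamma>\<in>roots_of_height \<alpha> i. \<gamma> h)"
proof -
  have "trace (\<lambda>z. grade_part \<alpha> i (br h z)) =
      (\<Sum>\<mu>\<in>{\<mu>\<in>weights. ht \<alpha> \<mu> = i}. of_nat (mult \<mu>) * \<mu> h)"
    unfolding grade_part_def by (simp add: trace_sum trace_weight[OF h])
  also have "\<dots> = (\<Sum>\<mu>\<in>roots_of_height \<alpha> i. of_nat (mult \<mu>) * \<mu> h)"
  proof (rule sum.mono_neutral_right)
    show "finite {\<mu> \<in> weights. ht \<alpha> \<mu> = i}" using finite_weights by simp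
  qed (auto simp: roots_of_height_def weights_eq)
  also have "\<dots> = (\<Sum>\<mu>\<in>roots_of_height \<alpha> i. \<mu> h)"
    by (intro sum.cong refl) (simp add: roots_of_height_def mult_root_multiples(1))
  finally show ?thesis .
qed

section \<open>Sums of the roots of a given height\<close>

lemma roots_of_height_mem: "\<gamma> \<in> roots_of_height \<alpha> i \<Longrightarrow> \<gamma> \<in> cartan_dual"
  by (simp add: roots_of_height_def root_cartan_dual)

lemma sum_roots_apply: "(\<Sum>\<gamma>\<in>A. \<gamma>) h = (\<Sum>\<gamma>\<in>A. \<gamma> h)" for A :: "('g \<Rightarrow> 'k) set"
  by (induct A rule: infinite_finite_induct) auto

text \<open>The sum is orthogonal to the simple roots \<open>\<beta> \<noteq> \<alpha>\<close>, because the vector dual to \<open>\<beta>\<close> is a bracket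
  of elements of degree 0 and so has trace 0 on each degree; integrality of its pairing with \<open>\<alpha>\<close> is
  that of the Cartan integers.\<close>

lemma sum_roots_of_height:
  assumes \<alpha>: "\<alpha> \<in> simples"
  shows "(\<Sum>\<gamma>\<in>roots_of_height \<alpha> i. \<gamma>) = scale_fun (of_int (q \<alpha> i)) (fundamental_weight \<alpha>)"
proof -
  interpret gr: graded_lie_algebra scale Basis br "ht \<alpha> ` weights" "grade \<alpha>"
    by (rule grade_graded[OF \<alpha>])
  let ?S = "\<Sum>\<gamma>\<in>roots_of_height \<alpha> i. \<gamma>" and ?\<phi> = "fundamental_weight \<alpha>"
  note \<phi> = fundamental_weight[OF \<alpha>]
  note mem = simple_cartan_dual
  have S: "?S \<in> cartan_dual"
    by (intro functionals.subspace_sum[OF subspace_cartan_dual] roots_of_height_mem)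
  have orth: "dual_form ?S \<beta> = 0" if \<beta>: "\<beta> \<in> simples" "\<beta> \<noteq> \<alpha>" for \<beta>
  proof -
    note w = root_weight[OF simple_root[OF \<beta>(1)]]
    obtain x y where xy: "x \<in> V \<beta>" "y \<in> V (- \<beta>)" "br x y = killing_dual_vector \<beta>"
      using weight_pair_exists[OF w] by metis
    have "x \<in> grade \<alpha> 0" "y \<in> grade \<alpha> (- 0)"
      using xy V_subset_grade[OF \<alpha> w] V_subset_grade[OF \<alpha> weight_uminus[OF w]]
        ht_uminus[OF \<alpha> w] ht_simple[OF \<alpha> \<beta>(1)] \<beta>(2) by auto
    then have "trace (\<lambda>z. gr.proj i (br (br x y) z)) = 0" using gr.trace_step[of x 0 y i] by simp
    then have "(\<Sum>\<gamma>\<in>roots_of_height \<alpha> i. \<gamma> (killing_dual_vector \<beta>)) = 0"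
      by (simp add: grade_proj_eq[OF \<alpha>] xy(3) trace_grade[OF \<alpha> killing_dual_vector(1)[OF mem[OF \<beta>(1)]]])
    then show ?thesis by (simp add: dual_form_eq S mem[OF \<beta>(1)] sum_roots_apply)
  qed
  obtain a :: "('g \<Rightarrow> 'k) \<Rightarrow> int"
    where a: "\<And>\<gamma>. \<gamma> \<in> roots \<Longrightarrow> 2 * dual_form \<gamma> \<alpha> = of_int (a \<gamma>) * dual_form \<alpha> \<alpha>"
    using cartan_integer[OF _ simple_root[OF \<alpha>]] by metis
  define m where "m = (\<Sum>\<gamma>\<in>roots_of_height \<alpha> i. a \<gamma>)"
  have "dual_form ?S \<alpha> = (\<Sum>\<gamma>\<in>roots_of_height \<alpha> i. dual_form \<gamma> \<alpha>)"
    by (rule dual_form_sum_left[OF roots_of_height_mem mem[OF \<alpha>]])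
  also have "\<dots> = (\<Sum>\<gamma>\<in>roots_of_height \<alpha> i. of_int (a \<gamma>) * (dual_form \<alpha> \<alpha> / 2))"
    using a by (intro sum.cong refl) (simp add: roots_of_height_def field_simps)
  also have "\<dots> = of_int m * (dual_form \<alpha> \<alpha> / 2)" by (simp only: m_def of_int_sum sum_distrib_right)
  finally have S\<alpha>: "dual_form ?S \<alpha> = of_int m * (dual_form \<alpha> \<alpha> / 2)" .
  have m: "?S = scale_fun (of_int m) ?\<phi>"
  proof (rule eq_if_equal_on_simples[OF S])
    show "scale_fun (of_int m) ?\<phi> \<in> cartan_dual"
      by (intro functionals.subspace_scale[OF subspace_cartan_dual] \<phi>)
    fix \<beta> assume \<beta>: "\<beta> \<in> simples"
    show "dual_form ?S \<beta> = dual_form (scale_fun (of_int m) ?\<phi>) \<beta>"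
      unfolding dual_form_scale_left[OF \<phi>(1) mem[OF \<beta>]] \<phi>(2)[OF \<beta>]
      using orth[OF \<beta>] S\<alpha> by (cases "\<beta> = \<alpha>") auto
  qed
  have "?\<phi> \<noteq> 0" by (rule fundamental_weight_nonzero[OF \<alpha>])
  then have "q \<alpha> i = m"
    unfolding q_def by (intro the_equality m) (simp add: m functionals.scale_cancel_right)
  then show ?thesis using m by simp
qed

lemma q_outside:
  assumes \<alpha>: "\<alpha> \<in> simples" and "roots_of_height \<alpha> i = {}"
  shows "q \<alpha> i = 0"
proof -
  have "scale_fun (of_int (q \<alpha> i)) (fundamental_weight \<alpha>) = 0"
    using sum_roots_of_height[OF \<alpha>, of i] assms(2) by simp
  then show ?thesis using fundamental_weight_nonzero[OF \<alpha>] by simp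
qed

section \<open>The Casimir eigenvalues\<close>

lemma sum_q_multiples:
  assumes \<alpha>: "\<alpha> \<in> simples" and k: "k \<ge> 1" and N: "int N \<ge> ht \<alpha> highest_root"
  shows "(\<Sum>i | i \<ge> 1 \<and> q \<alpha> (k * i) \<noteq> 0. of_int (q \<alpha> (k * i))) =
    (\<Sum>n<N. of_int (q \<alpha> (k * int (Suc n))) :: 'k)"
proof -
  have "i \<le> int N" if i: "i \<ge> 1" "q \<alpha> (k * i) \<noteq> 0" for i
  proof -
    obtain \<gamma> where "\<gamma> \<in> roots" "ht \<alpha> \<gamma> = k * i"
      using q_outside[OF \<alpha>, of "k * i"] i(2) by (auto simp: roots_of_height_def)
    then have "k * i \<le> int N" using highest_root_max[OF _ \<alpha>] N by fastforce
    moreover have "i \<le> k * i" using k i(1) by simp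
    ultimately show ?thesis by linarith
  qed
  then have "(\<Sum>i | i \<ge> 1 \<and> q \<alpha> (k * i) \<noteq> 0. of_int (q \<alpha> (k * i))) =
      (\<Sum>i\<in>{1..int N}. of_int (q \<alpha> (k * i)) :: 'k)"
    by (intro sum.mono_neutral_left) auto
  also have "\<dots> = (\<Sum>n<N. of_int (q \<alpha> (k * int (Suc n))))"
    by (rule sum.reindex_bij_witness[of _ "\<lambda>n. int (Suc n)" "\<lambda>i. nat (i - 1)"]) auto
  finally show ?thesis .
qed

text \<open>Telescoping along the degrees \<open>0, k, 2 k, \<dots>\<close>; unless the weights of \<open>x\<close> and \<open>y\<close> are opposite,
  both sides are zero.\<close>

lemma killing_casimir_root_vectors:
  assumes \<alpha>: "\<alpha> \<in> simples" and dual: "dual_bases (grade \<alpha> 0) n e e'"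
    and \<nu>: "\<nu> \<in> weights" "ht \<alpha> \<nu> = k" "k \<ge> 1" and x: "x \<in> V \<nu>" and y: "y \<in> V \<mu>"
  shows "killing (casimir_action n e e' x) y =
    of_int k * (dual_form \<alpha> \<alpha> / 2) * (\<Sum>i | i \<ge> 1 \<and> q \<alpha> (k * i) \<noteq> 0. of_int (q \<alpha> (k * i))) *
    killing x y" (is "_ = ?c * ?q * _")
proof -
  interpret gr: graded_lie_algebra scale Basis br "ht \<alpha> ` weights" "grade \<alpha>"
    by (rule grade_graded[OF \<alpha>])
  let ?f = "\<lambda>z. br y (br x z)"
  have cas: "killing (casimir_action n e e' x) y = trace (\<lambda>z. gr.proj 0 (?f z))"
    by (rule gr.killing_casimir[OF dual])
  show ?thesis
  proof (cases "\<mu> = - \<nu>")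
    case False
    have shift: "?f z \<in> V (\<mu> + \<nu> + \<kappa>)" if "z \<in> V \<kappa>" for z \<kappa>
      using br_V[OF y br_V[OF x that]] by (simp add: add.assoc)
    have nz: "\<mu> + \<nu> \<noteq> 0" using False by (simp add: eq_neg_iff_add_eq_0)
    have "trace (\<lambda>z. wt.proj \<kappa> (?f z)) = 0" for \<kappa>
      using nz by (intro wt.trace_proj_zero endo_comp[OF endo_br endo_br]) (simp add: wt.proj_part[OF shift])
    then have "trace (\<lambda>z. gr.proj 0 (?f z)) = 0"
      by (simp add: grade_proj_eq[OF \<alpha>] grade_part_def trace_sum)
    moreover have "killing x y = 0"
      using nz by (intro wt.killing_orthogonal[OF x y]) (simp add: add.commute)
    ultimately show ?thesis using cas by simp
  next
    case True
    have root: "\<nu> \<in> roots" using \<nu> ht_zero[OF \<alpha>] by (auto simp: weights_eq)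
    note y' = y[unfolded True] and h = killing_dual_vector(1)[OF root_cartan_dual[OF root]]
    have deg: "x \<in> grade \<alpha> k" "y \<in> grade \<alpha> (- k)"
      using V_subset_grade[OF \<alpha> \<nu>(1)] V_subset_grade[OF \<alpha> weight_uminus[OF \<nu>(1)]] x y'
        ht_uminus[OF \<alpha> \<nu>(1)] \<nu>(2) by auto
    have part: "trace (\<lambda>z. gr.proj i (br (br x y) z)) = of_int (q \<alpha> i) * ?c * killing x y" for i
    proof -
      have "trace (\<lambda>z. gr.proj i (br (br x y) z)) =
          killing x y * trace (\<lambda>z. gr.proj i (br (killing_dual_vector \<nu>) z))"
        by (simp add: br_opposite[OF x y' \<nu>(1)] br_scale_left endo_scale[OF gr.endo_proj] trace_scale)
      also have "trace (\<lambda>z. gr.proj i (br (killing_dual_vector \<nu>) z)) =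
          (\<Sum>\<gamma>\<in>roots_of_height \<alpha> i. \<gamma>) (killing_dual_vector \<nu>)"
        by (simp add: grade_proj_eq[OF \<alpha>] trace_grade[OF \<alpha> h] sum_roots_apply)
      also have "\<dots> = of_int (q \<alpha> i) * dual_form (fundamental_weight \<alpha>) \<nu>"
        by (simp add: sum_roots_of_height[OF \<alpha>] scale_fun_def
            dual_form_eq[OF fundamental_weight(1)[OF \<alpha>] root_cartan_dual[OF root]])
      finally show ?thesis by (simp add: dual_form_fundamental_weight_root[OF \<alpha> root] \<nu>(2))
    qed
    \<comment> \<open>past the maximal height, where the grading has ended\<close>
    define N where "N = nat (ht \<alpha> highest_root) + 1"
    have N: "int N > ht \<alpha> highest_root" by (simp add: N_def)
    have "trace (\<lambda>z. gr.proj (k * int 0) (?f z)) =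
        (\<Sum>n<N. trace (\<lambda>z. gr.proj (k * int (Suc n)) (br (br x y) z))) +
        trace (\<lambda>z. gr.proj (k * int N) (?f z))"
      by (rule gr.trace_telescope[OF deg, where s = "\<lambda>n. k * int n"]) (simp add: algebra_simps)
    moreover have "trace (\<lambda>z. gr.proj (k * int N) (?f z)) = 0"
    proof (rule gr.trace_step_zero[OF deg])
      have "1 * int N \<le> k * int N" using \<nu>(3) by (intro mult_right_mono) auto
      then have "ht \<alpha> \<mu> < k * int N" if "\<mu> \<in> weights" for \<mu>
        using weight_height_le[OF that \<alpha>] N by linarith
      then have "k * int N \<notin> ht \<alpha> ` weights" by (metis imageE less_irrefl)
      then show "k * int N \<notin> ht \<alpha> ` weights \<or> k * int N + k \<notin> ht \<alpha> ` weights" ..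
    qed
    ultimately have "trace (\<lambda>z. gr.proj 0 (?f z)) =
        (\<Sum>n<N. of_int (q \<alpha> (k * int (Suc n)))) * ?c * killing x y"
      by (simp add: part sum_distrib_right del: of_nat_Suc)
    also have "(\<Sum>n<N. of_int (q \<alpha> (k * int (Suc n)))) = ?q"
      by (rule sum_q_multiples[OF \<alpha> \<nu>(3), symmetric]) (use N in simp)
    finally show ?thesis using cas by (simp add: mult.commute mult.left_commute)
  qed
qed

text \<open>Nondegeneracy of the Killing form turns its values on \<open>C x\<close> and weight vectors into \<open>C x\<close> itself.\<close>

lemma casimir_scalar:
  assumes \<alpha>: "\<alpha> \<in> simples" and k: "k \<ge> 1"
  shows "casimir_acts_by_scalar \<alpha> k
    (of_int k * (dual_form \<alpha> \<alpha> / 2) * (\<Sum>i | i \<ge> 1 \<and> q \<alpha> (k * i) \<noteq> 0. of_int (q \<alpha> (k * i))))"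
    (is "casimir_acts_by_scalar \<alpha> k ?c")
  unfolding casimir_acts_by_scalar_def
proof (intro allI impI ballI)
  fix n e e' x assume dual: "dual_bases (grade \<alpha> 0) n e e'" and x: "x \<in> grade \<alpha> k"
  let ?C = "casimir_action n e e'"
  note C = endo_casimir_action[of n e e']
  have part: "?C (wt.proj \<nu> x) = ?c *s wt.proj \<nu> x" if \<nu>: "\<nu> \<in> weights" "ht \<alpha> \<nu> = k" for \<nu>
  proof -
    let ?x = "wt.proj \<nu> x"
    have "?C ?x - ?c *s ?x = 0"
    proof (rule killing_nondegenerate)
      fix y
      have "killing (?C ?x) (wt.proj \<mu> y) = killing (?c *s ?x) (wt.proj \<mu> y)" for \<mu>
        using killing_casimir_root_vectors[OF \<alpha> dual \<nu> k wt.proj_mem wt.proj_mem]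
        by (simp add: killing_scale_left)
      then have "(\<Sum>\<mu>\<in>weights. killing (?C ?x) (wt.proj \<mu> y)) =
          (\<Sum>\<mu>\<in>weights. killing (?c *s ?x) (wt.proj \<mu> y))" by simp
      then have "killing (?C ?x) y = killing (?c *s ?x) y"
        by (simp only: linear_form_sum[OF linear_form_killing_right, symmetric] wt.sum_proj)
      moreover have "killing (?C ?x) y = killing (?C ?x - ?c *s ?x) y + killing (?c *s ?x) y"
        by (simp only: killing_add_left[symmetric] diff_add_cancel)
      ultimately show "killing (?C ?x - ?c *s ?x) y = 0" by simp
    qed
    then show ?thesis by simp
  qed
  have "?C (grade_part \<alpha> k x) = ?c *s grade_part \<alpha> k x"
    unfolding grade_part_def endo_sum[OF C] scale_sum_right by (intro sum.cong refl) (simp add: part)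
  then show "?C x = ?c *s x" by (simp add: grade_part_self[OF \<alpha> x])
qed

text \<open>Uniqueness of the scalar: \<open>grade \<alpha> k\<close> is nonzero, as roots of height \<open>k\<close> exist, and \<open>grade \<alpha> 0\<close>
  has dual bases, as the Killing form is nondegenerate on it.\<close>

lemma casimir_eigenvalue:
  assumes \<alpha>: "\<alpha> \<in> simples" and k: "1 \<le> k" "k \<le> depth \<alpha>"
  shows "casimir_eigenvalue \<alpha> k =
    of_int k * (dual_form \<alpha> \<alpha> / 2) * (\<Sum>i | i \<ge> 1 \<and> q \<alpha> (k * i) \<noteq> 0. of_int (q \<alpha> (k * i)))"
    (is "_ = ?c")
proof -
  interpret gr: graded_lie_algebra scale Basis br "ht \<alpha> ` weights" "grade \<alpha>"
    by (rule grade_graded[OF \<alpha>])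
  have "\<exists>n e e'. dual_bases (grade \<alpha> 0) n e e'"
  proof (rule dual_bases_exist[OF subspace_grade])
    fix x assume x: "x \<in> grade \<alpha> 0" and zero: "\<And>y. y \<in> grade \<alpha> 0 \<Longrightarrow> killing x y = 0"
    show "x = 0"
    proof (rule killing_nondegenerate)
      show "killing x y = 0" for y
        using gr.killing_degree_zero[OF x, of y] zero[OF gr.proj_mem]
        by (simp add: killing_commute[of _ x])
    qed
  qed
  then obtain n e e' where dual: "dual_bases (grade \<alpha> 0) n e e'" by blast
  obtain \<gamma> where \<gamma>: "\<gamma> \<in> roots" "ht \<alpha> \<gamma> = k"
    using height_occurs[OF \<alpha> highest_root_root k(1)] k(2) by (auto simp: depth_def)
  obtain x where x: "x \<in> V \<gamma>" "x \<noteq> 0"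
    using weight_vector_exists[OF root_weight[OF \<gamma>(1)]] by blast
  have xk: "x \<in> grade \<alpha> k" using V_subset_grade[OF \<alpha> root_weight[OF \<gamma>(1)]] x(1) \<gamma>(2) by auto
  show ?thesis
    unfolding casimir_eigenvalue_def
  proof (rule the_equality)
    show c: "casimir_acts_by_scalar \<alpha> k ?c" by (rule casimir_scalar[OF \<alpha> k(1)])
    fix d assume d: "casimir_acts_by_scalar \<alpha> k d"
    have "d *s x = ?c *s x"
      using c[unfolded casimir_acts_by_scalar_def, rule_format, OF dual xk]
        d[unfolded casimir_acts_by_scalar_def, rule_format, OF dual xk] by simp
    then show "d = ?c" using x(2) by simp
  qed
qed

lemma normalization:
  assumes \<alpha>: "\<alpha> \<in> simples"
  shows "c / (2 * dual_coxeter * length_ratio \<alpha>) = c * (dual_form \<alpha> \<alpha> / 2)"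
proof -
  have "2 * dual_coxeter * length_ratio \<alpha> =
      2 * (dual_coxeter * dual_form highest_root highest_root) / dual_form \<alpha> \<alpha>"
    by (simp add: length_ratio_def)
  then show ?thesis by (simp add: dual_coxeter_highest_root)
qed

end

theorem theorem0p1:
  fixes scale :: "'k::{alg_closed_field, field_char_0} \<Rightarrow> 'g::ab_group_add \<Rightarrow> 'g"
    and Basis :: "'g set"
    and br :: "'g \<Rightarrow> 'g \<Rightarrow> 'g"
    and t :: "'g set"
    and simples :: "('g \<Rightarrow> 'k) set"
    and \<alpha> :: "'g \<Rightarrow> 'k"
  assumes "simple_lie_with_base scale Basis br t simples"
    and "\<alpha> \<in> simples"
  shows
    "let h = simple_lie_with_base.dual_coxeter scale Basis br t simples;
         r = simple_lie_with_base.length_ratio scale Basis br t simples \<alpha>;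
         d = simple_lie_with_base.depth scale br t simples \<alpha>;
         q = simple_lie_with_base.q scale Basis br t simples \<alpha>;
         q_total = simple_lie_with_base.q_total scale Basis br t simples \<alpha>;
         acts_by_scalar =
           simple_lie_with_base.casimir_acts_by_scalar scale Basis br t simples \<alpha>;
         \<gamma> = simple_lie_with_base.casimir_eigenvalue scale Basis br t simples \<alpha>
     in (\<forall>k::int. 1 \<le> k \<and> k \<le> d \<longrightarrow>
          acts_by_scalar k (\<gamma> k) \<and>
          \<gamma> k = of_int k / (2 * h * r) * (\<Sum>i | i \<ge> 1 \<and> q (k * i) \<noteq> 0. of_int (q (k * i)))) \<and>
        \<gamma> 1 = of_int q_total / (2 * h * r)"
proof -
  interpret simple_lie_with_base scale Basis br t simples by (rule assms(1))
  interpret based_cartan_decomposition scale Basis br t simples by unfold_locales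
  have eigenvalue: "casimir_acts_by_scalar \<alpha> k (casimir_eigenvalue \<alpha> k) \<and>
      casimir_eigenvalue \<alpha> k = of_int k / (2 * dual_coxeter * length_ratio \<alpha>) *
        (\<Sum>i | i \<ge> 1 \<and> q \<alpha> (k * i) \<noteq> 0. of_int (q \<alpha> (k * i)))"
    if "1 \<le> k" "k \<le> depth \<alpha>" for k
    unfolding normalization[OF assms(2)] casimir_eigenvalue[OF assms(2) that]
    using casimir_scalar[OF assms(2) that(1)] by simp
  have "1 \<le> depth \<alpha>" unfolding depth_def by (rule highest_root_positive[OF assms(2)])
  then have "casimir_eigenvalue \<alpha> 1 = 1 / (2 * dual_coxeter * length_ratio \<alpha>) *
      (\<Sum>i | i \<ge> 1 \<and> q \<alpha> i \<noteq> 0. of_int (q \<alpha> i))"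
    using eigenvalue[of 1] by simp
  then have "casimir_eigenvalue \<alpha> 1 = of_int (q_total \<alpha>) / (2 * dual_coxeter * length_ratio \<alpha>)"
    by (simp add: q_total_def)
  then show ?thesis using eigenvalue unfolding Let_def by blast
qed

end
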